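(* The operation which sends any oplax monoidal category $\mathcal V$ to the 2-category $\mathsf{Cat}_{\mathcal V}$ of categories enriched over $\mathcal V$, any lax monoidal functor $f$ between oplax monoidal categories to its pushforward $f_*$, and any monoidal natural transformation $t$ to its pushforward $t_*$, defines a 2-functor $$\mathsf{Oplax}_{\mathrm{lax}}\longrightarrow\mathsf{2}\text{-}\mathsf{Cat},\qquad \mathcal V\mapsto\mathsf{Cat}_{\mathcal V},$$ from the 2-category of oplax monoidal categories (with lax monoidal functors and monoidal natural transformations) to the 2-category of 2-categories (with 2-functors and 2-natural transformations).
   Context: **Oplax monoidal category.** $\mathcal V^\omega$ is a category $\mathcal V$ with functors $\omega^n:\mathcal V^{n+1}\to\mathcal V$ ($n\ge-1$), natural transformations $\omega^{p+q}\to\omega^p(-,\omega^q,-)$ for $p\ge0,q\ge-1$ and each of the $p+1$ insertion positions, and a counit $\omega^0\to\mathrm{Id}$, such that: $\omega^p\to\omega^0\omega^p\to\omega^p$ and $\omega^p\to\omega^p(-,\omega^0,-)\to\omega^p$ are identities; the two composites $\omega^{p+q+r}\to\omega^p(-,\omega^q,-,\omega^r,-)$ agree; the two composites $\omega^{p+q+r}\to\omega^p(-,\omega^q(-,\omega^r,-),-)$ agree. Write $1_\omega=\omega^{-1}$, $\otimes_\omega=\omega^1$. **Lax monoidal functor** $(F,\{l^n\}):\mathcal U^\psi\to\mathcal V^\omega$: a functor $F$ with natural transformations $l^n:\omega^n\circ(F\times\cdots\times F)\to F\psi^n$ ($n\ge-1$) such that $\omega^0F\xrightarrow{l^0}F\psi^0\to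 F$ is the counit of $\omega$ at $F$, and $\omega^{p+q}F\xrightarrow{l^{p+q}}F\psi^{p+q}\to F\psi^p(-,\psi^q,-)$ equals $\omega^{p+q}F\to\omega^p(-,\omega^q,-)F\xrightarrow{\omega^p(-,l^q,-)}\omega^pF(-,\psi^q,-)\xrightarrow{l^p}F\psi^p(-,\psi^q,-)$. **Monoidal natural transformation** $t:(F,k)\Rightarrow(G,l)$: a natural transformation with $l^n\circ\omega^n(t,\dots,t)=t_{\psi^n}\circ k^n$ for all $n\ge-1$. **The 2-category $\mathsf{Cat}_{\mathcal V}$.** An object is a category $\mathcal C$ with a functor $[-,-]:\mathcal C^{\mathrm{op}}\times\mathcal C\to\mathcal V$, maps $\eta_x:1_\omega\to[x,x]$ extranatural in $x$, and $\mu_{x,y,z}:[y,z]\otimes_\omega[x,y]\to[x,z]$ natural in $x,z$, extranatural in $y$, such that the two composites $\omega^2([y,z],[x,y],[w,x])\to[w,z]$, through $([y,z]\otimes_\omega[x,y])\otimes_\omega[w,x]$ and through $[y,z]\otimes_\omega([x,y]\otimes_\omega[w,x])$, agree, and the composites $\omega^0([x,y])\to1_\omega\otimes_\omega[x,y]\to[y,y]\otimes_\omega[x,y]\to[x,y]$ and $\omega^0([x,y])\to[x,y]\otimes_\omega1_\omega\to[x,y]\otimes_\omega[x,x]\to[x,y]$ both equal the counit. A 1-morphism $(\mathcal B,[-,-],\eta,\mu)\to(\mathcal C,\langle-,-\rangle,\theta,\nu)$ is a functor $F$ with a natural family $F_{x,y}:[x,y]\to\langle Fx,Fy\rangle$ such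 that $F_{x,x}\eta_x=\theta_{Fx}$ and $F_{x,z}\mu_{x,y,z}=\nu_{Fx,Fy,Fz}(F_{y,z}\otimes_\omega F_{x,y})$. A 2-morphism $F\Rightarrow G$ is a natural transformation $\alpha$ with $\langle-,\alpha_y\rangle F_{x,y}=\langle\alpha_x,-\rangle G_{x,y}$. **Pushforwards.** For $(f,\{l^n\}):\mathcal U^\psi\to\mathcal V^\omega$ lax monoidal, $f_*:\mathsf{Cat}_{\mathcal U}\to\mathsf{Cat}_{\mathcal V}$ sends $(\mathcal C,[-,-],\eta,\mu)$ to the same category $\mathcal C$ with hom bifunctor $f\circ[-,-]$, unit $1_\omega\xrightarrow{l^{-1}}f(1_\psi)\xrightarrow{f(\eta_x)}f[x,x]$ and composition $f[y,z]\otimes_\omega f[x,y]\xrightarrow{l^1}f([y,z]\otimes_\psi[x,y])\xrightarrow{f(\mu)}f[x,z]$; it sends an enriched functor $(F,F_{x,y})$ to $(F,f(F_{x,y}))$ and an enriched natural transformation to the same underlying natural transformation. For a monoidal natural transformation $t:f\Rightarrow g$, $t_*:f_*\Rightarrow g_*$ has component at $\mathcal C$ the $\mathcal V$-enriched functor $f_*\mathcal C\to g_*\mathcal C$ given by the identity functor of $\mathcal C$ with structure maps $t_{[x,y]}:f[x,y]\to g[x,y]$. *)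

theory Defs
  imports Main "HOL-Library.FuncSet"
begin

(* Size.  A "category" has its objects and arrows in (subsets of) two types, and the
   2-categories below consist of all structures living on given types; the types are
   arbitrary, so they play the role of a universe.
   Equality.  All structure is required to be undefined outside its carrier (cf. extensional),
   so that HOL equality of functors, transformations, ... is equality of the mathematical
   objects. *)

section \<open>Categories, functors, natural transformations\<close>

record ('o, 'a) cat =
  Obj :: "'o set"
  Arr :: "'a set"
  Dom :: "'a \<Rightarrow> 'o"
  Cod :: "'a \<Rightarrow> 'o"
  Ident :: "'o \<Rightarrow> 'a"
  Comp :: "'a \<Rightarrow> 'a \<Rightarrow> 'a"  \<comment> \<open>\<open>Comp C g f\<close> is "g after f"\<close>

definition Hom :: "('o, 'a) cat \<Rightarrow> 'o \<Rightarrow> 'o \<Rightarrow> 'a set" where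
  "Hom C x y = {f \<in> Arr C. Dom C f = x \<and> Cod C f = y}"

definition composable :: "('o, 'a) cat \<Rightarrow> 'a \<Rightarrow> 'a \<Rightarrow> bool" where
  "composable C g f \<longleftrightarrow> g \<in> Arr C \<and> f \<in> Arr C \<and> Dom C g = Cod C f"

definition category :: "('o, 'a) cat \<Rightarrow> bool" where
  "category C \<longleftrightarrow>
     Dom C \<in> Arr C \<rightarrow>\<^sub>E Obj C \<and> Cod C \<in> Arr C \<rightarrow>\<^sub>E Obj C \<and>
     Ident C \<in> extensional (Obj C) \<and> (\<forall>x \<in> Obj C. Ident C x \<in> Hom C x x) \<and>
     (\<forall>g f. \<not> composable C g f \<longrightarrow> Comp C g f = undefined) \<and>
     (\<forall>g f. composable C g f \<longrightarrow> Comp C g f \<in> Hom C (Dom C f) (Cod C g)) \<and>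
     (\<forall>f \<in> Arr C. Comp C f (Ident C (Dom C f)) = f \<and> Comp C (Ident C (Cod C f)) f = f) \<and>
     (\<forall>h g f. composable C h g \<and> composable C g f \<longrightarrow>
        Comp C h (Comp C g f) = Comp C (Comp C h g) f)"

definition make_cat ::
  "'o set \<Rightarrow> 'a set \<Rightarrow> ('a \<Rightarrow> 'o) \<Rightarrow> ('a \<Rightarrow> 'o) \<Rightarrow> ('o \<Rightarrow> 'a) \<Rightarrow> ('a \<Rightarrow> 'a \<Rightarrow> 'a)
     \<Rightarrow> ('o, 'a) cat" where
  "make_cat X A d c i m =
     \<lparr>Obj = X, Arr = A, Dom = restrict d A, Cod = restrict c A, Ident = restrict i X,
      Comp = (\<lambda>g f. if g \<in> A \<and> f \<in> A \<and> d g = c f then m g f else undefined)\<rparr>"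

definition op_cat :: "('o, 'a) cat \<Rightarrow> ('o, 'a) cat" where
  "op_cat C = \<lparr>Obj = Obj C, Arr = Arr C, Dom = Cod C, Cod = Dom C, Ident = Ident C,
               Comp = (\<lambda>g f. Comp C f g)\<rparr>"

definition prod_cat :: "('o, 'a) cat \<Rightarrow> ('p, 'b) cat \<Rightarrow> ('o \<times> 'p, 'a \<times> 'b) cat" where
  "prod_cat C D = make_cat (Obj C \<times> Obj D) (Arr C \<times> Arr D)
     (map_prod (Dom C) (Dom D)) (map_prod (Cod C) (Cod D)) (map_prod (Ident C) (Ident D))
     (\<lambda>(g, g') (f, f'). (Comp C g f, Comp D g' f'))"

(* The disjoint union of the powers of C: lists of length k form the full subcategory C^k, and
   there are no arrows between lists of different lengths.  A functor out of it is
   a family of functors out of the powers C^k, k \<ge> 0; likewise for transformations. *)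
definition list_cat :: "('o, 'a) cat \<Rightarrow> ('o list, 'a list) cat" where
  "list_cat C = make_cat (lists (Obj C)) (lists (Arr C))
     (map (Dom C)) (map (Cod C)) (map (Ident C)) (map2 (Comp C))"

record ('o, 'a, 'p, 'b) fctr =
  fOb :: "'o \<Rightarrow> 'p"
  fAr :: "'a \<Rightarrow> 'b"

definition is_functor :: "('o, 'a) cat \<Rightarrow> ('p, 'b) cat \<Rightarrow> ('o, 'a, 'p, 'b) fctr \<Rightarrow> bool" where
  "is_functor C D F \<longleftrightarrow> category C \<and> category D \<and>
     fOb F \<in> Obj C \<rightarrow>\<^sub>E Obj D \<and> fAr F \<in> Arr C \<rightarrow>\<^sub>E Arr D \<and>
     (\<forall>f \<in> Arr C. Dom D (fAr F f) = fOb F (Dom C f) \<and> Cod D (fAr F f) = fOb F (Cod C f)) \<and>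
     (\<forall>x \<in> Obj C. fAr F (Ident C x) = Ident D (fOb F x)) \<and>
     (\<forall>g f. composable C g f \<longrightarrow> fAr F (Comp C g f) = Comp D (fAr F g) (fAr F f))"

definition id_fctr :: "('o, 'a) cat \<Rightarrow> ('o, 'a, 'o, 'a) fctr" where
  "id_fctr C = \<lparr>fOb = (\<lambda>x \<in> Obj C. x), fAr = (\<lambda>f \<in> Arr C. f)\<rparr>"

(* The composite "G after F" of functors, where C is the source of F. *)
definition fcomp :: "('o, 'a) cat \<Rightarrow> ('p, 'b, 'q, 'c) fctr \<Rightarrow> ('o, 'a, 'p, 'b) fctr
     \<Rightarrow> ('o, 'a, 'q, 'c) fctr" where
  "fcomp C G F = \<lparr>fOb = compose (Obj C) (fOb G) (fOb F), fAr = compose (Arr C) (fAr G) (fAr F)\<rparr>"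

definition prod_fctr :: "('o, 'a) cat \<Rightarrow> ('p, 'b) cat \<Rightarrow> ('o, 'a, 'q, 'c) fctr
     \<Rightarrow> ('p, 'b, 'r, 'd) fctr \<Rightarrow> ('o \<times> 'p, 'a \<times> 'b, 'q \<times> 'r, 'c \<times> 'd) fctr" where
  "prod_fctr C D F G =
     \<lparr>fOb = restrict (map_prod (fOb F) (fOb G)) (Obj C \<times> Obj D),
      fAr = restrict (map_prod (fAr F) (fAr G)) (Arr C \<times> Arr D)\<rparr>"

definition list_fctr :: "('o, 'a) cat \<Rightarrow> ('o, 'a, 'p, 'b) fctr
     \<Rightarrow> ('o list, 'a list, 'p list, 'b list) fctr" where
  "list_fctr C F = \<lparr>fOb = restrict (map (fOb F)) (lists (Obj C)),
                    fAr = restrict (map (fAr F)) (lists (Arr C))\<rparr>"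

definition is_nat :: "('o, 'a) cat \<Rightarrow> ('p, 'b) cat \<Rightarrow> ('o, 'a, 'p, 'b) fctr
     \<Rightarrow> ('o, 'a, 'p, 'b) fctr \<Rightarrow> ('o \<Rightarrow> 'b) \<Rightarrow> bool" where
  "is_nat C D F G t \<longleftrightarrow> is_functor C D F \<and> is_functor C D G \<and>
     t \<in> extensional (Obj C) \<and> (\<forall>x \<in> Obj C. t x \<in> Hom D (fOb F x) (fOb G x)) \<and>
     (\<forall>f \<in> Arr C. Comp D (t (Cod C f)) (fAr F f) = Comp D (fAr G f) (t (Dom C f)))"

definition nt_id :: "('o, 'a) cat \<Rightarrow> ('p, 'b) cat \<Rightarrow> ('o, 'a, 'p, 'b) fctr \<Rightarrow> 'o \<Rightarrow> 'b" where
  "nt_id C D F = (\<lambda>x \<in> Obj C. Ident D (fOb F x))"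

(* For t : F \<Rightarrow> G, s : G \<Rightarrow> H with F, G, H : C \<rightarrow> D. *)
definition nt_vcomp :: "('o, 'a) cat \<Rightarrow> ('p, 'b) cat \<Rightarrow> ('o \<Rightarrow> 'b) \<Rightarrow> ('o \<Rightarrow> 'b) \<Rightarrow> 'o \<Rightarrow> 'b" where
  "nt_vcomp C D s t = (\<lambda>x \<in> Obj C. Comp D (s x) (t x))"

(* For t : F \<Rightarrow> F' with F, F' : C \<rightarrow> D and s : G \<Rightarrow> G' with G, G' : D \<rightarrow> E. *)
definition nt_hcomp :: "('o, 'a) cat \<Rightarrow> ('q, 'c) cat \<Rightarrow> ('p, 'b, 'q, 'c) fctr \<Rightarrow> ('p \<Rightarrow> 'c)
     \<Rightarrow> ('o, 'a, 'p, 'b) fctr \<Rightarrow> ('o \<Rightarrow> 'b) \<Rightarrow> 'o \<Rightarrow> 'c" where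
  "nt_hcomp C E G s F' t = (\<lambda>x \<in> Obj C. Comp E (s (fOb F' x)) (fAr G (t x)))"


section \<open>Strict 2-categories\<close>

record ('o, 'f, 't) cat2 =
  C1 :: "('o, 'f) cat"  \<comment> \<open>0-cells and 1-cells\<close>
  C2 :: "('f, 't) cat"  \<comment> \<open>1-cells and 2-cells under vertical composition\<close>
  HComp :: "'t \<Rightarrow> 't \<Rightarrow> 't"

definition horiz :: "('o, 'f, 't) cat2 \<Rightarrow> ('o, 't) cat" where
  "horiz S = \<lparr>Obj = Obj (C1 S), Arr = Arr (C2 S),
     Dom = (\<lambda>a \<in> Arr (C2 S). Dom (C1 S) (Dom (C2 S) a)),
     Cod = (\<lambda>a \<in> Arr (C2 S). Cod (C1 S) (Cod (C2 S) a)),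
     Ident = (\<lambda>x \<in> Obj (C1 S). Ident (C2 S) (Ident (C1 S) x)),
     Comp = HComp S\<rparr>"

definition two_category :: "('o, 'f, 't) cat2 \<Rightarrow> bool" where
  "two_category S \<longleftrightarrow> category (C1 S) \<and> category (C2 S) \<and> category (horiz S) \<and>
     Obj (C2 S) = Arr (C1 S) \<and>
     (\<forall>a \<in> Arr (C2 S). Dom (C1 S) (Dom (C2 S) a) = Dom (C1 S) (Cod (C2 S) a) \<and>
                         Cod (C1 S) (Dom (C2 S) a) = Cod (C1 S) (Cod (C2 S) a)) \<and>
     (\<forall>b a. composable (horiz S) b a \<longrightarrow>
        Dom (C2 S) (HComp S b a) = Comp (C1 S) (Dom (C2 S) b) (Dom (C2 S) a) \<and>
        Cod (C2 S) (HComp S b a) = Comp (C1 S) (Cod (C2 S) b) (Cod (C2 S) a)) \<and>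
     (\<forall>g f. composable (C1 S) g f \<longrightarrow>
        HComp S (Ident (C2 S) g) (Ident (C2 S) f) = Ident (C2 S) (Comp (C1 S) g f)) \<and>
     (\<forall>b' b a' a. composable (C2 S) b' b \<and> composable (C2 S) a' a \<and> composable (horiz S) b a \<longrightarrow>
        HComp S (Comp (C2 S) b' b) (Comp (C2 S) a' a) =
        Comp (C2 S) (HComp S b' a') (HComp S b a))"

record ('o, 'f, 't, 'p, 'g, 'u) fctr2 =
  F0 :: "'o \<Rightarrow> 'p"
  F1 :: "'f \<Rightarrow> 'g"
  F2 :: "'t \<Rightarrow> 'u"

definition F01 :: "('o, 'f, 't, 'p, 'g, 'u) fctr2 \<Rightarrow> ('o, 'f, 'p, 'g) fctr" where
  "F01 F = \<lparr>fOb = F0 F, fAr = F1 F\<rparr>"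

definition is_2functor :: "('o, 'f, 't) cat2 \<Rightarrow> ('p, 'g, 'u) cat2
     \<Rightarrow> ('o, 'f, 't, 'p, 'g, 'u) fctr2 \<Rightarrow> bool" where
  "is_2functor S T F \<longleftrightarrow> two_category S \<and> two_category T \<and>
     is_functor (C1 S) (C1 T) (F01 F) \<and>
     is_functor (C2 S) (C2 T) \<lparr>fOb = F1 F, fAr = F2 F\<rparr> \<and>
     is_functor (horiz S) (horiz T) \<lparr>fOb = F0 F, fAr = F2 F\<rparr>"

definition is_2nat :: "('o, 'f, 't) cat2 \<Rightarrow> ('p, 'g, 'u) cat2 \<Rightarrow> ('o, 'f, 't, 'p, 'g, 'u) fctr2
     \<Rightarrow> ('o, 'f, 't, 'p, 'g, 'u) fctr2 \<Rightarrow> ('o \<Rightarrow> 'g) \<Rightarrow> bool" where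
  "is_2nat S T F G t \<longleftrightarrow> is_2functor S T F \<and> is_2functor S T G \<and>
     is_nat (C1 S) (C1 T) (F01 F) (F01 G) t \<and>
     (\<forall>a \<in> Arr (C2 S).
        HComp T (Ident (C2 T) (t (Cod (horiz S) a))) (F2 F a) =
        HComp T (F2 G a) (Ident (C2 T) (t (Dom (horiz S) a))))"

(* A 1-cell or 2-cell together with its source and target. *)
datatype ('x, 'd) cell = Cell (src: 'x) (trg: 'x) (dat: 'd)

definition cell_cat :: "'x set \<Rightarrow> ('x, 'd) cell set \<Rightarrow> ('x \<Rightarrow> 'd)
     \<Rightarrow> (('x, 'd) cell \<Rightarrow> ('x, 'd) cell \<Rightarrow> 'd) \<Rightarrow> ('x, ('x, 'd) cell) cat" where
  "cell_cat X A i m =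
     make_cat X A src trg (\<lambda>x. Cell x x (i x)) (\<lambda>g f. Cell (src f) (trg g) (m g f))"

(* i1, i2 give the data of the identity 1- and 2-cells; m1, mv, mh those of
   the composites of 1-cells and of the vertical and horizontal composites of 2-cells. *)
definition cell_cat2 ::
  "'x set
   \<Rightarrow> ('x, 'd) cell set \<Rightarrow> ('x \<Rightarrow> 'd) \<Rightarrow> (('x, 'd) cell \<Rightarrow> ('x, 'd) cell \<Rightarrow> 'd)
   \<Rightarrow> (('x, 'd) cell, 'e) cell set \<Rightarrow> (('x, 'd) cell \<Rightarrow> 'e)
   \<Rightarrow> ((('x, 'd) cell, 'e) cell \<Rightarrow> (('x, 'd) cell, 'e) cell \<Rightarrow> 'e)
   \<Rightarrow> ((('x, 'd) cell, 'e) cell \<Rightarrow> (('x, 'd) cell, 'e) cell \<Rightarrow> 'e)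
   \<Rightarrow> ('x, ('x, 'd) cell, (('x, 'd) cell, 'e) cell) cat2" where
  "cell_cat2 X A1 i1 m1 A2 i2 mv mh =
     \<lparr>C1 = cell_cat X A1 i1 m1,
      C2 = cell_cat A1 A2 i2 mv,
      HComp = (\<lambda>b a. if b \<in> A2 \<and> a \<in> A2 \<and> src (src b) = trg (trg a)
                 then Cell (Comp (cell_cat X A1 i1 m1) (src b) (src a))
                           (Comp (cell_cat X A1 i1 m1) (trg b) (trg a)) (mh b a)
                 else undefined)\<rparr>"


section \<open>The 2-category of 2-categories\<close>

type_synonym ('o, 'f, 't) fun2 = "(('o, 'f, 't) cat2, ('o, 'f, 't, 'o, 'f, 't) fctr2) cell"
type_synonym ('o, 'f, 't) nat2 = "(('o, 'f, 't) fun2, 'o \<Rightarrow> 'f) cell"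

definition id_2fctr :: "('o, 'f, 't) cat2 \<Rightarrow> ('o, 'f, 't, 'o, 'f, 't) fctr2" where
  "id_2fctr S = \<lparr>F0 = (\<lambda>x \<in> Obj (C1 S). x), F1 = (\<lambda>f \<in> Arr (C1 S). f), F2 = (\<lambda>a \<in> Arr (C2 S). a)\<rparr>"

definition comp_2fctr :: "('o, 'f, 't) cat2 \<Rightarrow> ('p, 'g, 'u, 'q, 'h, 'v) fctr2
     \<Rightarrow> ('o, 'f, 't, 'p, 'g, 'u) fctr2 \<Rightarrow> ('o, 'f, 't, 'q, 'h, 'v) fctr2" where
  "comp_2fctr S G F =
     \<lparr>F0 = compose (Obj (C1 S)) (F0 G) (F0 F),
      F1 = compose (Arr (C1 S)) (F1 G) (F1 F),
      F2 = compose (Arr (C2 S)) (F2 G) (F2 F)\<rparr>"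

definition Two_Cat ::
  "(('o, 'f, 't) cat2, ('o, 'f, 't) fun2, ('o, 'f, 't) nat2) cat2" where
  "Two_Cat = cell_cat2
     {S. two_category S}
     {F. is_2functor (src F) (trg F) (dat F)}
     id_2fctr
     (\<lambda>G F. comp_2fctr (src F) (dat G) (dat F))
     {t. src (src t) = src (trg t) \<and> trg (src t) = trg (trg t) \<and>
         is_2nat (src (src t)) (trg (src t)) (dat (src t)) (dat (trg t)) (dat t)}
     (\<lambda>F. nt_id (C1 (src F)) (C1 (trg F)) (F01 (dat F)))
     (\<lambda>s t. nt_vcomp (C1 (src (src t))) (C1 (trg (src t))) (dat s) (dat t))
     (\<lambda>s t. nt_hcomp (C1 (src (src t))) (C1 (trg (src s)))
               (F01 (dat (src s))) (dat s) (F01 (dat (trg t))) (dat t))"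


section \<open>Oplax monoidal categories\<close>

(* tens V restricted to lists of length n + 1 is the functor \<omega>^n (n \<ge> -1).
   splt V (xs, ys, zs), with length ys = q + 1 and length xs + length zs = p, is the component of
   \<omega>^(p+q) \<rightarrow> \<omega>^p(-, \<omega>^q, -) for the insertion position length xs. *)
record ('o, 'a) oplax =
  ucat :: "('o, 'a) cat"
  tens :: "('o list, 'a list, 'o, 'a) fctr"
  splt :: "'o list \<times> 'o list \<times> 'o list \<Rightarrow> 'a"
  counit :: "'o \<Rightarrow> 'a"

definition list3_cat ::
  "('o, 'a) cat \<Rightarrow> ('o list \<times> 'o list \<times> 'o list, 'a list \<times> 'a list \<times> 'a list) cat" where
  "list3_cat C = prod_cat (list_cat C) (prod_cat (list_cat C) (list_cat C))"

definition flat_fctr :: "('o, 'a) oplax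
     \<Rightarrow> ('o list \<times> 'o list \<times> 'o list, 'a list \<times> 'a list \<times> 'a list, 'o, 'a) fctr" where
  "flat_fctr V =
     \<lparr>fOb = (\<lambda>(xs, ys, zs) \<in> Obj (list3_cat (ucat V)). fOb (tens V) (xs @ ys @ zs)),
      fAr = (\<lambda>(fs, gs, hs) \<in> Arr (list3_cat (ucat V)). fAr (tens V) (fs @ gs @ hs))\<rparr>"

definition nested_fctr :: "('o, 'a) oplax
     \<Rightarrow> ('o list \<times> 'o list \<times> 'o list, 'a list \<times> 'a list \<times> 'a list, 'o, 'a) fctr" where
  "nested_fctr V =
     \<lparr>fOb = (\<lambda>(xs, ys, zs) \<in> Obj (list3_cat (ucat V)).
               fOb (tens V) (xs @ [fOb (tens V) ys] @ zs)),
      fAr = (\<lambda>(fs, gs, hs) \<in> Arr (list3_cat (ucat V)).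
               fAr (tens V) (fs @ [fAr (tens V) gs] @ hs))\<rparr>"

definition tens0 :: "('o, 'a) oplax \<Rightarrow> ('o, 'a, 'o, 'a) fctr" where
  "tens0 V = \<lparr>fOb = (\<lambda>x \<in> Obj (ucat V). fOb (tens V) [x]),
              fAr = (\<lambda>f \<in> Arr (ucat V). fAr (tens V) [f])\<rparr>"

(* The arrow \<omega>(xs, f, zs), i.e. f tensored with identities on both sides. *)
definition whisk :: "('o, 'a) oplax \<Rightarrow> 'o list \<Rightarrow> 'a \<Rightarrow> 'o list \<Rightarrow> 'a" where
  "whisk V xs f zs = fAr (tens V) (map (Ident (ucat V)) xs @ [f] @ map (Ident (ucat V)) zs)"

definition is_oplax :: "('o, 'a) oplax \<Rightarrow> bool" where
  "is_oplax V \<longleftrightarrow>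
     (let C = ucat V; T = fOb (tens V); L = lists (Obj C) in
     category C \<and>
     is_functor (list_cat C) C (tens V) \<and>
     is_nat (list3_cat C) C (flat_fctr V) (nested_fctr V) (splt V) \<and>
     is_nat C C (tens0 V) (id_fctr C) (counit V) \<and>
     (\<forall>ys \<in> L. Comp C (counit V (T ys)) (splt V ([], ys, [])) = Ident C (T ys)) \<and>
     (\<forall>xs \<in> L. \<forall>y \<in> Obj C. \<forall>zs \<in> L.
        Comp C (whisk V xs (counit V y) zs) (splt V (xs, [y], zs)) = Ident C (T (xs @ [y] @ zs))) \<and>
     (\<forall>xs \<in> L. \<forall>ys \<in> L. \<forall>zs \<in> L. \<forall>us \<in> L. \<forall>vs \<in> L.
        Comp C (splt V (xs @ [T ys] @ zs, us, vs)) (splt V (xs, ys, zs @ us @ vs)) =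
        Comp C (splt V (xs, ys, zs @ [T us] @ vs)) (splt V (xs @ ys @ zs, us, vs))) \<and>
     (\<forall>xs \<in> L. \<forall>ys \<in> L. \<forall>zs \<in> L. \<forall>us \<in> L. \<forall>vs \<in> L.
        Comp C (whisk V xs (splt V (ys, zs, us)) vs) (splt V (xs, ys @ zs @ us, vs)) =
        Comp C (splt V (xs, ys @ [T zs] @ us, vs)) (splt V (xs @ ys, zs, us @ vs))))"

record ('o, 'a, 'p, 'b) laxdata =
  lfun :: "('o, 'a, 'p, 'b) fctr"
  lstr :: "'o list \<Rightarrow> 'b"  \<comment> \<open>the components of all the \<open>l\<^sup>n\<close>\<close>

definition is_lax :: "('o, 'a) oplax \<Rightarrow> ('p, 'b) oplax \<Rightarrow> ('o, 'a, 'p, 'b) laxdata \<Rightarrow> bool" where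
  "is_lax U V f \<longleftrightarrow>
     (let C = ucat U; D = ucat V; F = lfun f; l = lstr f; m = map (fOb (lfun f));
          L = lists (Obj (ucat U)) in
     is_oplax U \<and> is_oplax V \<and>
     is_functor C D F \<and>
     is_nat (list_cat C) D (fcomp (list_cat C) (tens V) (list_fctr C F))
       (fcomp (list_cat C) F (tens U)) l \<and>
     (\<forall>x \<in> Obj C. Comp D (fAr F (counit U x)) (l [x]) = counit V (fOb F x)) \<and>
     (\<forall>xs \<in> L. \<forall>ys \<in> L. \<forall>zs \<in> L.
        Comp D (fAr F (splt U (xs, ys, zs))) (l (xs @ ys @ zs)) =
        Comp D (l (xs @ [fOb (tens U) ys] @ zs))
          (Comp D (whisk V (m xs) (l ys) (m zs)) (splt V (m xs, m ys, m zs)))))"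

definition lax_id :: "('o, 'a) oplax \<Rightarrow> ('o, 'a, 'o, 'a) laxdata" where
  "lax_id V = \<lparr>lfun = id_fctr (ucat V), lstr = nt_id (list_cat (ucat V)) (ucat V) (tens V)\<rparr>"

(* For f : U \<rightarrow> V and g : V \<rightarrow> W. *)
definition lax_comp :: "('o, 'a) oplax \<Rightarrow> ('q, 'c) oplax \<Rightarrow> ('p, 'b, 'q, 'c) laxdata
     \<Rightarrow> ('o, 'a, 'p, 'b) laxdata \<Rightarrow> ('o, 'a, 'q, 'c) laxdata" where
  "lax_comp U W g f =
     \<lparr>lfun = fcomp (ucat U) (lfun g) (lfun f),
      lstr = (\<lambda>xs \<in> lists (Obj (ucat U)).
        Comp (ucat W) (fAr (lfun g) (lstr f xs)) (lstr g (map (fOb (lfun f)) xs)))\<rparr>"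

definition is_monoidal_nat :: "('o, 'a) oplax \<Rightarrow> ('p, 'b) oplax \<Rightarrow> ('o, 'a, 'p, 'b) laxdata
     \<Rightarrow> ('o, 'a, 'p, 'b) laxdata \<Rightarrow> ('o \<Rightarrow> 'b) \<Rightarrow> bool" where
  "is_monoidal_nat U V f g t \<longleftrightarrow> is_lax U V f \<and> is_lax U V g \<and>
     is_nat (ucat U) (ucat V) (lfun f) (lfun g) t \<and>
     (\<forall>xs \<in> lists (Obj (ucat U)).
        Comp (ucat V) (lstr g xs) (fAr (tens V) (map t xs)) =
        Comp (ucat V) (t (fOb (tens U) xs)) (lstr f xs))"

type_synonym ('o, 'a) lax_fun = "(('o, 'a) oplax, ('o, 'a, 'o, 'a) laxdata) cell"
type_synonym ('o, 'a) mon_nat = "(('o, 'a) lax_fun, 'o \<Rightarrow> 'a) cell"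

definition Oplax_lax ::
  "(('o, 'a) oplax, ('o, 'a) lax_fun, ('o, 'a) mon_nat) cat2" where
  "Oplax_lax = cell_cat2
     {V. is_oplax V}
     {f. is_lax (src f) (trg f) (dat f)}
     lax_id
     (\<lambda>g f. lax_comp (src f) (trg g) (dat g) (dat f))
     {t. src (src t) = src (trg t) \<and> trg (src t) = trg (trg t) \<and>
         is_monoidal_nat (src (src t)) (trg (src t)) (dat (src t)) (dat (trg t)) (dat t)}
     (\<lambda>f. nt_id (ucat (src f)) (ucat (trg f)) (lfun (dat f)))
     (\<lambda>s t. nt_vcomp (ucat (src (src t))) (ucat (trg (src t))) (dat s) (dat t))
     (\<lambda>s t. nt_hcomp (ucat (src (src t))) (ucat (trg (src s)))
               (lfun (dat (src s))) (dat s) (lfun (dat (trg t))) (dat t))"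


section \<open>Categories enriched over an oplax monoidal category\<close>

(* ehom C is the functor [-,-]; ecomp C (x, y, z) : [y,z] \<otimes> [x,y] \<rightarrow> [x,z]. *)
record ('c, 'm, 'o, 'a) ecat =
  ecat :: "('c, 'm) cat"
  ehom :: "('c \<times> 'c, 'm \<times> 'm, 'o, 'a) fctr"
  eunit :: "'c \<Rightarrow> 'a"
  ecomp :: "'c \<times> 'c \<times> 'c \<Rightarrow> 'a"

definition is_ecat :: "('o, 'a) oplax \<Rightarrow> ('c, 'm, 'o, 'a) ecat \<Rightarrow> bool" where
  "is_ecat V C \<longleftrightarrow>
     (let B = ecat C; X = Obj (ecat C); D = ucat V; T = fOb (tens V);
          h = (\<lambda>x y. fOb (ehom C) (x, y)); H = (\<lambda>f g. fAr (ehom C) (f, g));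
          i = Ident (ecat C); u = eunit C; m = (\<lambda>x y z. ecomp C (x, y, z));
          tens2 = (\<lambda>f g. fAr (tens V) [f, g]) in
     is_oplax V \<and> category B \<and>
     is_functor (prod_cat (op_cat B) B) D (ehom C) \<and>
     u \<in> extensional X \<and> (\<forall>x \<in> X. u x \<in> Hom D (T []) (h x x)) \<and>
     (\<forall>x \<in> X. \<forall>y \<in> X. \<forall>f \<in> Hom B x y. Comp D (H (i x) f) (u x) = Comp D (H f (i y)) (u y)) \<and>
     ecomp C \<in> extensional (X \<times> X \<times> X) \<and>
     (\<forall>x \<in> X. \<forall>y \<in> X. \<forall>z \<in> X. m x y z \<in> Hom D (T [h y z, h x y]) (h x z)) \<and>
     (\<forall>x \<in> X. \<forall>x' \<in> X. \<forall>y \<in> X. \<forall>z \<in> X. \<forall>f \<in> Hom B x' x.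
        Comp D (H f (i z)) (m x y z) = Comp D (m x' y z) (tens2 (Ident D (h y z)) (H f (i y)))) \<and>
     (\<forall>x \<in> X. \<forall>y \<in> X. \<forall>z \<in> X. \<forall>z' \<in> X. \<forall>f \<in> Hom B z z'.
        Comp D (H (i x) f) (m x y z) = Comp D (m x y z') (tens2 (H (i y) f) (Ident D (h x y)))) \<and>
     (\<forall>x \<in> X. \<forall>y \<in> X. \<forall>y' \<in> X. \<forall>z \<in> X. \<forall>f \<in> Hom B y y'.
        Comp D (m x y z) (tens2 (H f (i z)) (Ident D (h x y))) =
        Comp D (m x y' z) (tens2 (Ident D (h y' z)) (H (i x) f))) \<and>
     (\<forall>w \<in> X. \<forall>x \<in> X. \<forall>y \<in> X. \<forall>z \<in> X.
        Comp D (m w x z)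
          (Comp D (tens2 (m x y z) (Ident D (h w x))) (splt V ([], [h y z, h x y], [h w x]))) =
        Comp D (m w y z)
          (Comp D (tens2 (Ident D (h y z)) (m w x y)) (splt V ([h y z], [h x y, h w x], [])))) \<and>
     (\<forall>x \<in> X. \<forall>y \<in> X.
        Comp D (m x y y)
          (Comp D (tens2 (u y) (Ident D (h x y))) (splt V ([], [], [h x y]))) = counit V (h x y)) \<and>
     (\<forall>x \<in> X. \<forall>y \<in> X.
        Comp D (m x x y)
          (Comp D (tens2 (Ident D (h x y)) (u x)) (splt V ([h x y], [], []))) = counit V (h x y)))"

record ('c, 'm, 'd, 'n, 'a) efun_data =
  efun :: "('c, 'm, 'd, 'n) fctr"
  estr :: "'c \<times> 'c \<Rightarrow> 'a"

definition is_efun :: "('o, 'a) oplax \<Rightarrow> ('c, 'm, 'o, 'a) ecat \<Rightarrow> ('d, 'n, 'o, 'a) ecat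
     \<Rightarrow> ('c, 'm, 'd, 'n, 'a) efun_data \<Rightarrow> bool" where
  "is_efun V B C f \<longleftrightarrow>
     (let D = ucat V; X = Obj (ecat B); F = fOb (efun f);
          P = prod_cat (op_cat (ecat B)) (ecat B) in
     is_ecat V B \<and> is_ecat V C \<and>
     is_functor (ecat B) (ecat C) (efun f) \<and>
     is_nat P D (ehom B)
       (fcomp P (ehom C) (prod_fctr (op_cat (ecat B)) (ecat B) (efun f) (efun f))) (estr f) \<and>
     (\<forall>x \<in> X. Comp D (estr f (x, x)) (eunit B x) = eunit C (F x)) \<and>
     (\<forall>x \<in> X. \<forall>y \<in> X. \<forall>z \<in> X.
        Comp D (estr f (x, z)) (ecomp B (x, y, z)) =
        Comp D (ecomp C (F x, F y, F z)) (fAr (tens V) [estr f (y, z), estr f (x, y)])))"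

definition is_enat :: "('o, 'a) oplax \<Rightarrow> ('c, 'm, 'o, 'a) ecat \<Rightarrow> ('d, 'n, 'o, 'a) ecat
     \<Rightarrow> ('c, 'm, 'd, 'n, 'a) efun_data \<Rightarrow> ('c, 'm, 'd, 'n, 'a) efun_data \<Rightarrow> ('c \<Rightarrow> 'n) \<Rightarrow> bool" where
  "is_enat V B C f g t \<longleftrightarrow> is_efun V B C f \<and> is_efun V B C g \<and>
     is_nat (ecat B) (ecat C) (efun f) (efun g) t \<and>
     (\<forall>x \<in> Obj (ecat B). \<forall>y \<in> Obj (ecat B).
        Comp (ucat V) (fAr (ehom C) (Ident (ecat C) (fOb (efun f) x), t y)) (estr f (x, y)) =
        Comp (ucat V) (fAr (ehom C) (t x, Ident (ecat C) (fOb (efun g) y))) (estr g (x, y)))"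

definition efun_id :: "('o, 'a) oplax \<Rightarrow> ('c, 'm, 'o, 'a) ecat \<Rightarrow> ('c, 'm, 'c, 'm, 'a) efun_data" where
  "efun_id V C = \<lparr>efun = id_fctr (ecat C),
     estr = nt_id (prod_cat (op_cat (ecat C)) (ecat C)) (ucat V) (ehom C)\<rparr>"

(* For f : A \<rightarrow> B and g : B \<rightarrow> C. *)
definition efun_comp :: "('o, 'a) oplax \<Rightarrow> ('c, 'm, 'o, 'a) ecat \<Rightarrow> ('d, 'n, 'e, 'k, 'a) efun_data
     \<Rightarrow> ('c, 'm, 'd, 'n, 'a) efun_data \<Rightarrow> ('c, 'm, 'e, 'k, 'a) efun_data" where
  "efun_comp V A g f = \<lparr>efun = fcomp (ecat A) (efun g) (efun f),
     estr = (\<lambda>(x, y) \<in> Obj (ecat A) \<times> Obj (ecat A).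
       Comp (ucat V) (estr g (fOb (efun f) x, fOb (efun f) y)) (estr f (x, y)))\<rparr>"

type_synonym ('c, 'm, 'o, 'a) enr_fun =
  "(('c, 'm, 'o, 'a) ecat, ('c, 'm, 'c, 'm, 'a) efun_data) cell"
type_synonym ('c, 'm, 'o, 'a) enr_nat = "(('c, 'm, 'o, 'a) enr_fun, 'c \<Rightarrow> 'm) cell"
type_synonym ('c, 'm, 'o, 'a) enr_cat2 =
  "(('c, 'm, 'o, 'a) ecat, ('c, 'm, 'o, 'a) enr_fun, ('c, 'm, 'o, 'a) enr_nat) cat2"

definition Cat_over :: "('o, 'a) oplax \<Rightarrow> ('c, 'm, 'o, 'a) enr_cat2" where
  "Cat_over V = cell_cat2
     {C. is_ecat V C}
     {F. is_efun V (src F) (trg F) (dat F)}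
     (efun_id V)
     (\<lambda>G F. efun_comp V (src F) (dat G) (dat F))
     {t. src (src t) = src (trg t) \<and> trg (src t) = trg (trg t) \<and>
         is_enat V (src (src t)) (trg (src t)) (dat (src t)) (dat (trg t)) (dat t)}
     (\<lambda>F. nt_id (ecat (src F)) (ecat (trg F)) (efun (dat F)))
     (\<lambda>s t. nt_vcomp (ecat (src (src t))) (ecat (trg (src t))) (dat s) (dat t))
     (\<lambda>s t. nt_hcomp (ecat (src (src t))) (ecat (trg (src s)))
               (efun (dat (src s))) (dat s) (efun (dat (trg t))) (dat t))"


section \<open>Pushforwards\<close>

definition push_ecat :: "('o, 'a) lax_fun \<Rightarrow> ('c, 'm, 'o, 'a) ecat \<Rightarrow> ('c, 'm, 'o, 'a) ecat" where
  "push_ecat f C =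
     (let X = Obj (ecat C); D = ucat (trg f); h = (\<lambda>x y. fOb (ehom C) (x, y)) in
     \<lparr>ecat = ecat C,
      ehom = fcomp (prod_cat (op_cat (ecat C)) (ecat C)) (lfun (dat f)) (ehom C),
      eunit = (\<lambda>x \<in> X. Comp D (fAr (lfun (dat f)) (eunit C x)) (lstr (dat f) [])),
      ecomp = (\<lambda>(x, y, z) \<in> X \<times> X \<times> X.
        Comp D (fAr (lfun (dat f)) (ecomp C (x, y, z))) (lstr (dat f) [h y z, h x y]))\<rparr>)"

definition push_efun :: "('o, 'a) lax_fun \<Rightarrow> ('c, 'm, 'o, 'a) enr_fun \<Rightarrow> ('c, 'm, 'o, 'a) enr_fun" where
  "push_efun f F = Cell (push_ecat f (src F)) (push_ecat f (trg F))
     \<lparr>efun = efun (dat F),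
      estr = compose (Obj (ecat (src F)) \<times> Obj (ecat (src F))) (fAr (lfun (dat f))) (estr (dat F))\<rparr>"

definition push_enat :: "('o, 'a) lax_fun \<Rightarrow> ('c, 'm, 'o, 'a) enr_nat \<Rightarrow> ('c, 'm, 'o, 'a) enr_nat" where
  "push_enat f t = Cell (push_efun f (src t)) (push_efun f (trg t)) (dat t)"

definition push_lax :: "('o, 'a) lax_fun \<Rightarrow>
     (('c, 'm, 'o, 'a) ecat, ('c, 'm, 'o, 'a) enr_fun, ('c, 'm, 'o, 'a) enr_nat) fun2" where
  "push_lax f = Cell (Cat_over (src f)) (Cat_over (trg f))
     \<lparr>F0 = restrict (push_ecat f) (Obj (C1 (Cat_over (src f)))),
      F1 = restrict (push_efun f) (Arr (C1 (Cat_over (src f)))),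
      F2 = restrict (push_enat f) (Arr (C2 (Cat_over (src f))))\<rparr>"

definition push_component :: "('o, 'a) mon_nat \<Rightarrow> ('c, 'm, 'o, 'a) ecat \<Rightarrow> ('c, 'm, 'o, 'a) enr_fun" where
  "push_component t C = Cell (push_ecat (src t) C) (push_ecat (trg t) C)
     \<lparr>efun = id_fctr (ecat C),
      estr = compose (Obj (ecat C) \<times> Obj (ecat C)) (dat t) (fOb (ehom C))\<rparr>"

definition push_nat :: "('o, 'a) mon_nat \<Rightarrow>
     (('c, 'm, 'o, 'a) ecat, ('c, 'm, 'o, 'a) enr_fun, ('c, 'm, 'o, 'a) enr_nat) nat2" where
  "push_nat t = Cell (push_lax (src t)) (push_lax (trg t))
     (restrict (push_component t) (Obj (C1 (Cat_over (src (src t))))))"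

definition enrichment ::
  "(('o, 'a) oplax, ('o, 'a) lax_fun, ('o, 'a) mon_nat,
    ('c, 'm, 'o, 'a) enr_cat2,
    (('c, 'm, 'o, 'a) ecat, ('c, 'm, 'o, 'a) enr_fun, ('c, 'm, 'o, 'a) enr_nat) fun2,
    (('c, 'm, 'o, 'a) ecat, ('c, 'm, 'o, 'a) enr_fun, ('c, 'm, 'o, 'a) enr_nat) nat2) fctr2" where
  "enrichment =
     \<lparr>F0 = restrict Cat_over (Obj (C1 Oplax_lax)),
      F1 = restrict push_lax (Arr (C1 Oplax_lax)),
      F2 = restrict push_nat (Arr (C2 Oplax_lax))\<rparr>"

end

(* A lax functor f pushes an enriched category forward by applying f to the homs and precomposing
   units and compositions with the structure maps of f.  Since the splittings of an oplax structure
   point from the flat to the nested tensor, each enrichment axiom only ever uses a composite of a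
   splitting, a tensored arrow and an arrow; naturality and the coherence of f move such a composite
   as a whole past the structure maps (lstr_whisk_splt), which reduces every axiom of the pushed
   forward structure to f applied to the same axiom upstairs.

   In all three kinds of 2-categories involved, the 2-cells are families of arrows indexed by the
   objects of an underlying category, with the vertical and horizontal composition of natural
   transformations.  The 2-category axioms and the functoriality of a 2-functor are therefore
   reduced, once and for all, to closure of 1-cells and 2-cells under these operations. *)

theory Submission imports Defs begin

section \<open>Categories, functors and transformations\<close>

text \<open>The obstacle is strictness. The functor laws assert equality of whole records, such as
  \<open>push_ecat\<close> along a composite against the iterated \<open>push_ecat\<close>, and
  equality of cells includes equality of their endpoints. Since the functions compared are
  \<open>undefined\<close> off their carriers, each such equality reduces to values on the carrier,
  where it follows from functoriality and the category laws in \<open>ucat\<close>.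

  That the 2-category of 2-categories fits the common pattern is less evident. The underlying
  category of \<open>S\<close> is \<open>C1 S\<close>, the underlying functor of \<open>F\<close> is
  \<open>F01 F\<close>, and a 2-natural transformation is a family of 1-cells. Its extra condition
  on 2-cells is once more a naturality square, now in \<open>horiz T\<close> with the identity
  2-cells on the components as sides, so composites inherit it for the same reason as ordinary
  naturality.

  The general result on 2-functors is used on two levels: for each pushforward
  \<open>push_lax f\<close>, which keeps underlying functors and families, and for
  \<open>enrichment\<close> itself, whose values on 1-cells are those pushforwards.\<close>

lemma category_simps [simp]:
  assumes "category C"
  shows "f \<in> Arr C \<Longrightarrow> Dom C f \<in> Obj C"
    and "f \<in> Arr C \<Longrightarrow> Cod C f \<in> Obj C"
    and "x \<in> Obj C \<Longrightarrow> Ident C x \<in> Arr C"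
    and "x \<in> Obj C \<Longrightarrow> Dom C (Ident C x) = x"
    and "x \<in> Obj C \<Longrightarrow> Cod C (Ident C x) = x"
    and "\<lbrakk>g \<in> Arr C; f \<in> Arr C; Dom C g = Cod C f\<rbrakk> \<Longrightarrow> Comp C g f \<in> Arr C"
    and "\<lbrakk>g \<in> Arr C; f \<in> Arr C; Dom C g = Cod C f\<rbrakk> \<Longrightarrow> Dom C (Comp C g f) = Dom C f"
    and "\<lbrakk>g \<in> Arr C; f \<in> Arr C; Dom C g = Cod C f\<rbrakk> \<Longrightarrow> Cod C (Comp C g f) = Cod C g"
    and "\<lbrakk>f \<in> Arr C; Dom C f = x\<rbrakk> \<Longrightarrow> Comp C f (Ident C x) = f"
    and "\<lbrakk>f \<in> Arr C; Cod C f = x\<rbrakk> \<Longrightarrow> Comp C (Ident C x) f = f"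
    and "\<lbrakk>h \<in> Arr C; g \<in> Arr C; f \<in> Arr C; Dom C h = Cod C g; Dom C g = Cod C f\<rbrakk>
          \<Longrightarrow> Comp C (Comp C h g) f = Comp C h (Comp C g f)"
  using assms unfolding category_def by (auto simp: composable_def Hom_def PiE_iff Pi_iff)

lemma category_extensional:
  assumes "category C"
  shows "Dom C \<in> extensional (Arr C)" "Cod C \<in> extensional (Arr C)"
    "Ident C \<in> extensional (Obj C)" "\<not> composable C g f \<Longrightarrow> Comp C g f = undefined"
  using assms unfolding category_def by (auto simp: PiE_iff)

lemma categoryI:
  assumes "Dom C \<in> extensional (Arr C)" "Cod C \<in> extensional (Arr C)"
    "Ident C \<in> extensional (Obj C)" "\<And>g f. \<not> composable C g f \<Longrightarrow> Comp C g f = undefined"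
    and "\<And>f. f \<in> Arr C \<Longrightarrow> Dom C f \<in> Obj C"
    and "\<And>f. f \<in> Arr C \<Longrightarrow> Cod C f \<in> Obj C"
    and "\<And>x. x \<in> Obj C \<Longrightarrow> Ident C x \<in> Arr C \<and> Dom C (Ident C x) = x \<and> Cod C (Ident C x) = x"
    and "\<And>g f. \<lbrakk>g \<in> Arr C; f \<in> Arr C; Dom C g = Cod C f\<rbrakk>
          \<Longrightarrow> Comp C g f \<in> Arr C \<and> Dom C (Comp C g f) = Dom C f \<and> Cod C (Comp C g f) = Cod C g"
    and "\<And>f. f \<in> Arr C \<Longrightarrow> Comp C f (Ident C (Dom C f)) = f \<and> Comp C (Ident C (Cod C f)) f = f"
    and "\<And>h g f. \<lbrakk>h \<in> Arr C; g \<in> Arr C; f \<in> Arr C; Dom C h = Cod C g; Dom C g = Cod C f\<rbrakk>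
          \<Longrightarrow> Comp C h (Comp C g f) = Comp C (Comp C h g) f"
  shows "category C"
  using assms unfolding category_def by (simp add: composable_def Hom_def PiE_iff Pi_iff)

lemma category_make_cat:
  assumes "\<And>f. f \<in> A \<Longrightarrow> d f \<in> X" "\<And>f. f \<in> A \<Longrightarrow> c f \<in> X"
    and "\<And>x. x \<in> X \<Longrightarrow> i x \<in> A" "\<And>x. x \<in> X \<Longrightarrow> d (i x) = x" "\<And>x. x \<in> X \<Longrightarrow> c (i x) = x"
    and "\<And>g f. \<lbrakk>g \<in> A; f \<in> A; d g = c f\<rbrakk> \<Longrightarrow> m g f \<in> A \<and> d (m g f) = d f \<and> c (m g f) = c g"
    and "\<And>f. f \<in> A \<Longrightarrow> m f (i (d f)) = f" "\<And>f. f \<in> A \<Longrightarrow> m (i (c f)) f = f"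
    and "\<And>h g f. \<lbrakk>h \<in> A; g \<in> A; f \<in> A; d h = c g; d g = c f\<rbrakk> \<Longrightarrow> m h (m g f) = m (m h g) f"
  shows "category (make_cat X A d c i m)"
  by (rule categoryI) (use assms in \<open>auto simp: make_cat_def composable_def\<close>)

lemma make_cat_simps [simp]:
  "Obj (make_cat X A d c i m) = X" "Arr (make_cat X A d c i m) = A"
  "f \<in> A \<Longrightarrow> Dom (make_cat X A d c i m) f = d f"
  "f \<in> A \<Longrightarrow> Cod (make_cat X A d c i m) f = c f"
  "x \<in> X \<Longrightarrow> Ident (make_cat X A d c i m) x = i x"
  "\<lbrakk>g \<in> A; f \<in> A; d g = c f\<rbrakk> \<Longrightarrow> Comp (make_cat X A d c i m) g f = m g f"
  by (auto simp: make_cat_def)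

lemma make_cat_extensional:
  "Dom (make_cat X A d c i m) \<in> extensional A" "Cod (make_cat X A d c i m) \<in> extensional A"
  "Ident (make_cat X A d c i m) \<in> extensional X"
  "\<not> composable (make_cat X A d c i m) g f \<Longrightarrow> Comp (make_cat X A d c i m) g f = undefined"
  by (auto simp: make_cat_def composable_def)

lemma op_cat_simps [simp]:
  "Obj (op_cat C) = Obj C" "Arr (op_cat C) = Arr C" "Dom (op_cat C) = Cod C"
  "Cod (op_cat C) = Dom C" "Ident (op_cat C) = Ident C" "Comp (op_cat C) g f = Comp C f g"
  by (auto simp: op_cat_def)

lemma category_op_cat: "category C \<Longrightarrow> category (op_cat C)"
  by (rule categoryI) (auto simp: category_extensional composable_def)

lemma prod_cat_simps [simp]:
  "Obj (prod_cat C D) = Obj C \<times> Obj D" "Arr (prod_cat C D) = Arr C \<times> Arr D"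
  "\<lbrakk>f \<in> Arr C; f' \<in> Arr D\<rbrakk> \<Longrightarrow> Dom (prod_cat C D) (f, f') = (Dom C f, Dom D f')"
  "\<lbrakk>f \<in> Arr C; f' \<in> Arr D\<rbrakk> \<Longrightarrow> Cod (prod_cat C D) (f, f') = (Cod C f, Cod D f')"
  "\<lbrakk>x \<in> Obj C; y \<in> Obj D\<rbrakk> \<Longrightarrow> Ident (prod_cat C D) (x, y) = (Ident C x, Ident D y)"
  "\<lbrakk>g \<in> Arr C; f \<in> Arr C; Dom C g = Cod C f; g' \<in> Arr D; f' \<in> Arr D; Dom D g' = Cod D f'\<rbrakk>
     \<Longrightarrow> Comp (prod_cat C D) (g, g') (f, f') = (Comp C g f, Comp D g' f')"
  by (auto simp: prod_cat_def)

lemma category_prod_cat: "category C \<Longrightarrow> category D \<Longrightarrow> category (prod_cat C D)"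
  unfolding prod_cat_def by (rule category_make_cat) auto

lemma list_cat_simps [simp]:
  "Obj (list_cat C) = lists (Obj C)" "Arr (list_cat C) = lists (Arr C)"
  "fs \<in> lists (Arr C) \<Longrightarrow> Dom (list_cat C) fs = map (Dom C) fs"
  "fs \<in> lists (Arr C) \<Longrightarrow> Cod (list_cat C) fs = map (Cod C) fs"
  "xs \<in> lists (Obj C) \<Longrightarrow> Ident (list_cat C) xs = map (Ident C) xs"
  "\<lbrakk>gs \<in> lists (Arr C); fs \<in> lists (Arr C); map (Dom C) gs = map (Cod C) fs\<rbrakk>
     \<Longrightarrow> Comp (list_cat C) gs fs = map2 (Comp C) gs fs"
  by (auto simp: list_cat_def)

lemma category_list_cat:
  assumes [simp]: "category C"
  shows "category (list_cat C)"
  unfolding list_cat_def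
proof (rule category_make_cat)
  fix gs fs
  assume gf: "gs \<in> lists (Arr C)" "fs \<in> lists (Arr C)" "map (Dom C) gs = map (Cod C) fs"
  \<comment> \<open>Composable lists have equal length, since their lists of endpoints agree; so
    \<open>map2\<close> loses no entry and the claim is an entrywise induction.\<close>
  from gf(3) have "length gs = length fs" by (rule map_eq_imp_length_eq)
  then show "map2 (Comp C) gs fs \<in> lists (Arr C) \<and>
      map (Dom C) (map2 (Comp C) gs fs) = map (Dom C) fs \<and>
      map (Cod C) (map2 (Comp C) gs fs) = map (Cod C) gs"
    using gf by (induction rule: list_induct2) auto
next
  fix fs assume "fs \<in> lists (Arr C)"
  then show "map2 (Comp C) fs (map (Ident C) (map (Dom C) fs)) = fs"
    "map2 (Comp C) (map (Ident C) (map (Cod C) fs)) fs = fs"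
    by (induction fs) auto
next
  fix hs gs fs
  assume hgf: "hs \<in> lists (Arr C)" "gs \<in> lists (Arr C)" "fs \<in> lists (Arr C)"
    "map (Dom C) hs = map (Cod C) gs" "map (Dom C) gs = map (Cod C) fs"
  from hgf(4,5) have "length hs = length gs" "length gs = length fs"
    by (auto dest: map_eq_imp_length_eq)
  then show "map2 (Comp C) hs (map2 (Comp C) gs fs) = map2 (Comp C) (map2 (Comp C) hs gs) fs"
    using hgf by (induction rule: list_induct3) auto
qed (auto simp: lists_eq_set intro!: map_idI)

section \<open>Functors, their products and their powers\<close>

lemma is_functorD:
  assumes "is_functor C D F"
  shows "category C" "category D"
    and "x \<in> Obj C \<Longrightarrow> fOb F x \<in> Obj D"
    and "f \<in> Arr C \<Longrightarrow> fAr F f \<in> Arr D"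
    and "f \<in> Arr C \<Longrightarrow> Dom D (fAr F f) = fOb F (Dom C f)"
    and "f \<in> Arr C \<Longrightarrow> Cod D (fAr F f) = fOb F (Cod C f)"
    and "x \<in> Obj C \<Longrightarrow> fAr F (Ident C x) = Ident D (fOb F x)"
    and "\<lbrakk>g \<in> Arr C; f \<in> Arr C; Dom C g = Cod C f\<rbrakk>
          \<Longrightarrow> fAr F (Comp C g f) = Comp D (fAr F g) (fAr F f)"
  using assms unfolding is_functor_def by (auto simp: composable_def PiE_iff Pi_iff)

lemma is_functor_extensional:
  assumes "is_functor C D F"
  shows "fOb F \<in> extensional (Obj C)" "fAr F \<in> extensional (Arr C)"
  using assms unfolding is_functor_def by (auto simp: PiE_iff)

lemma is_functorI:
  assumes "category C" "category D"
    and "fOb F \<in> extensional (Obj C)" "fAr F \<in> extensional (Arr C)"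
    and "\<And>x. x \<in> Obj C \<Longrightarrow> fOb F x \<in> Obj D"
    and "\<And>f. f \<in> Arr C
          \<Longrightarrow> fAr F f \<in> Arr D \<and> Dom D (fAr F f) = fOb F (Dom C f) \<and> Cod D (fAr F f) = fOb F (Cod C f)"
    and "\<And>x. x \<in> Obj C \<Longrightarrow> fAr F (Ident C x) = Ident D (fOb F x)"
    and "\<And>g f. \<lbrakk>g \<in> Arr C; f \<in> Arr C; Dom C g = Cod C f\<rbrakk>
          \<Longrightarrow> fAr F (Comp C g f) = Comp D (fAr F g) (fAr F f)"
  shows "is_functor C D F"
  using assms unfolding is_functor_def by (auto simp: composable_def PiE_iff Pi_iff)

lemma functor_eqI:
  assumes "is_functor C D F" "is_functor C' D' G" "Obj C = Obj C'" "Arr C = Arr C'"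
    and "\<And>x. x \<in> Obj C \<Longrightarrow> fOb F x = fOb G x" "\<And>f. f \<in> Arr C \<Longrightarrow> fAr F f = fAr G f"
  shows "F = G"
proof (rule fctr.equality)
  show "fOb F = fOb G"
    using assms by (intro extensionalityI[of _ "Obj C"]) (auto dest: is_functor_extensional)
  show "fAr F = fAr G"
    using assms by (intro extensionalityI[of _ "Arr C"]) (auto dest: is_functor_extensional)
qed simp

lemma id_fctr_simps [simp]:
  "x \<in> Obj C \<Longrightarrow> fOb (id_fctr C) x = x" "f \<in> Arr C \<Longrightarrow> fAr (id_fctr C) f = f"
  by (auto simp: id_fctr_def)

lemma fcomp_simps [simp]:
  "x \<in> Obj C \<Longrightarrow> fOb (fcomp C G F) x = fOb G (fOb F x)"
  "f \<in> Arr C \<Longrightarrow> fAr (fcomp C G F) f = fAr G (fAr F f)"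
  by (auto simp: fcomp_def compose_def)

lemma is_functor_id: "category C \<Longrightarrow> is_functor C C (id_fctr C)"
  by (rule is_functorI) (auto simp: id_fctr_def)

lemma is_functor_fcomp:
  assumes F: "is_functor C D F" and G: "is_functor D E G"
  shows "is_functor C E (fcomp C G F)"
  using is_functorD[OF F] is_functorD[OF G]
  by (intro is_functorI) (auto simp: fcomp_def compose_def)

lemma fcomp_id_left: "is_functor C D F \<Longrightarrow> fcomp C (id_fctr D) F = F"
  by (rule functor_eqI[OF is_functor_fcomp[OF _ is_functor_id]]) (auto dest: is_functorD)

lemma fcomp_id_right: "is_functor C D F \<Longrightarrow> fcomp C F (id_fctr C) = F"
  by (rule functor_eqI[OF is_functor_fcomp[OF is_functor_id]]) (auto dest: is_functorD)

text \<open>The truncations introduced by \<open>compose\<close> agree because \<open>F\<close>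
  sends the carrier of \<open>B\<close> into that of \<open>C\<close>, where
  \<open>fcomp C H G\<close> is defined.\<close>

lemma fcomp_assoc:
  assumes "is_functor B C F"
  shows "fcomp B H (fcomp B G F) = fcomp B (fcomp C H G) F"
  using is_functorD[OF assms]
  by (intro fctr.equality) (auto simp: fcomp_def compose_def fun_eq_iff)

lemma is_functor_prod_fctr:
  assumes F: "is_functor C D F" and G: "is_functor C' D' G"
  shows "is_functor (prod_cat C C') (prod_cat D D') (prod_fctr C C' F G)"
  using is_functorD[OF F] is_functorD[OF G]
  by (intro is_functorI category_prod_cat) (auto simp: prod_fctr_def)

lemma prod_fctr_simps [simp]:
  "x \<in> Obj C \<Longrightarrow> y \<in> Obj D \<Longrightarrow> fOb (prod_fctr C D F G) (x, y) = (fOb F x, fOb G y)"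
  "f \<in> Arr C \<Longrightarrow> g \<in> Arr D \<Longrightarrow> fAr (prod_fctr C D F G) (f, g) = (fAr F f, fAr G g)"
  by (auto simp: prod_fctr_def)

lemma is_functor_op_cat: "is_functor C D F \<Longrightarrow> is_functor (op_cat C) (op_cat D) F"
  by (rule is_functorI) (auto simp: is_functorD category_op_cat is_functor_extensional)

lemma list_fctr_simps [simp]:
  "xs \<in> lists (Obj C) \<Longrightarrow> fOb (list_fctr C F) xs = map (fOb F) xs"
  "fs \<in> lists (Arr C) \<Longrightarrow> fAr (list_fctr C F) fs = map (fAr F) fs"
  by (auto simp: list_fctr_def)

lemma map_in_listsI: "xs \<in> lists A \<Longrightarrow> (\<And>x. x \<in> A \<Longrightarrow> f x \<in> B) \<Longrightarrow> map f xs \<in> lists B"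
  by (auto simp: lists_eq_set)

lemma is_functor_list_fctr:
  assumes F: "is_functor C D F"
  shows "is_functor (list_cat C) (list_cat D) (list_fctr C F)"
proof (rule is_functorI)
  note [simp] = is_functorD[OF F]
  show "category (list_cat C)" "category (list_cat D)" by (auto intro: category_list_cat)
  show "fOb (list_fctr C F) \<in> extensional (Obj (list_cat C))"
    "fAr (list_fctr C F) \<in> extensional (Arr (list_cat C))"
    by (auto simp: list_fctr_def)
  show "fOb (list_fctr C F) xs \<in> Obj (list_cat D)" if "xs \<in> Obj (list_cat C)" for xs
    using that by (auto simp: lists_eq_set)
  show "fAr (list_fctr C F) fs \<in> Arr (list_cat D) \<and>
      Dom (list_cat D) (fAr (list_fctr C F) fs) = fOb (list_fctr C F) (Dom (list_cat C) fs) \<and>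
      Cod (list_cat D) (fAr (list_fctr C F) fs) = fOb (list_fctr C F) (Cod (list_cat C) fs)"
    if "fs \<in> Arr (list_cat C)" for fs
    using that by (auto simp: map_in_listsI)
  show "fAr (list_fctr C F) (Ident (list_cat C) xs) = Ident (list_cat D) (fOb (list_fctr C F) xs)"
    if "xs \<in> Obj (list_cat C)" for xs
    using that by (auto simp: map_in_listsI)
  fix gs fs assume "gs \<in> Arr (list_cat C)" "fs \<in> Arr (list_cat C)"
    "Dom (list_cat C) gs = Cod (list_cat C) fs"
  then have gf: "gs \<in> lists (Arr C)" "fs \<in> lists (Arr C)" "map (Dom C) gs = map (Cod C) fs"
    by auto
  from gf(3) have "length gs = length fs" by (rule map_eq_imp_length_eq)
  then have "map2 (Comp C) gs fs \<in> lists (Arr C) \<and>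
      map (fAr F) (map2 (Comp C) gs fs) = map2 (Comp D) (map (fAr F) gs) (map (fAr F) fs) \<and>
      map (Dom D) (map (fAr F) gs) = map (Cod D) (map (fAr F) fs)"
    using gf by (induction rule: list_induct2) auto
  moreover have "map (fAr F) gs \<in> lists (Arr D)" "map (fAr F) fs \<in> lists (Arr D)"
    using gf by (auto simp: lists_eq_set)
  ultimately show "fAr (list_fctr C F) (Comp (list_cat C) gs fs) =
      Comp (list_cat D) (fAr (list_fctr C F) gs) (fAr (list_fctr C F) fs)"
    using gf by (simp del: map_map)
qed

section \<open>Natural transformations and their vertical and horizontal composites\<close>

lemma is_natD:
  assumes "is_nat C D F G t"
  shows "is_functor C D F" "is_functor C D G" "t \<in> extensional (Obj C)"
    and "x \<in> Obj C \<Longrightarrow> t x \<in> Arr D"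
    and "x \<in> Obj C \<Longrightarrow> Dom D (t x) = fOb F x"
    and "x \<in> Obj C \<Longrightarrow> Cod D (t x) = fOb G x"
  using assms unfolding is_nat_def by (auto simp: Hom_def)

text \<open>The endpoints enter through equations, so that the rule still applies after
  simplification has replaced \<open>Dom C f\<close> and \<open>Cod C f\<close> by their
  values.\<close>

lemma naturality:
  assumes "is_nat C D F G t" "f \<in> Arr C" "Dom C f = x" "Cod C f = y"
  shows "Comp D (t y) (fAr F f) = Comp D (fAr G f) (t x)"
  using assms unfolding is_nat_def by auto

lemma is_natI:
  assumes "is_functor C D F" "is_functor C D G" "t \<in> extensional (Obj C)"
    and "\<And>x. x \<in> Obj C \<Longrightarrow> t x \<in> Arr D \<and> Dom D (t x) = fOb F x \<and> Cod D (t x) = fOb G x"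
    and "\<And>f. f \<in> Arr C \<Longrightarrow> Comp D (t (Cod C f)) (fAr F f) = Comp D (fAr G f) (t (Dom C f))"
  shows "is_nat C D F G t"
  using assms unfolding is_nat_def by (auto simp: Hom_def)

lemma nt_id_simps [simp]:
  "x \<in> Obj C \<Longrightarrow> nt_id C D F x = Ident D (fOb F x)" "nt_id C D F \<in> extensional (Obj C)"
  by (auto simp: nt_id_def)

lemma nt_vcomp_simps [simp]:
  "x \<in> Obj C \<Longrightarrow> nt_vcomp C D s t x = Comp D (s x) (t x)"
  "nt_vcomp C D s t \<in> extensional (Obj C)"
  by (auto simp: nt_vcomp_def)

lemma nt_hcomp_simps [simp]:
  "x \<in> Obj C \<Longrightarrow> nt_hcomp C E G s F' t x = Comp E (s (fOb F' x)) (fAr G (t x))"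
  "nt_hcomp C E G s F' t \<in> extensional (Obj C)"
  by (auto simp: nt_hcomp_def)

lemma is_nat_nt_id: "is_functor C D F \<Longrightarrow> is_nat C D F F (nt_id C D F)"
  by (rule is_natI) (auto simp: is_functorD)

text \<open>Simplification associates all composites to the right, so inside a longer composite the
  two arrows on one side of a commuting square no longer form a subterm. This form replaces a square
  at the front of a composite that ends in \<open>k\<close>; most diagram chases below are chains of
  such replacements.\<close>

lemma comp_square:
  assumes "Comp C g f = Comp C g' f'" "category C"
    "g \<in> Arr C" "f \<in> Arr C" "g' \<in> Arr C" "f' \<in> Arr C" "k \<in> Arr C"
    "Dom C g = Cod C f" "Dom C g' = Cod C f'" "Dom C f = Cod C k" "Dom C f' = Cod C k"
  shows "Comp C g (Comp C f k) = Comp C g' (Comp C f' k)"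
  using assms by (metis category_simps(11))

lemma is_nat_nt_vcomp:
  assumes t: "is_nat C D F G t" and s: "is_nat C D G H s"
  shows "is_nat C D F H (nt_vcomp C D s t)"
proof (rule is_natI)
  note [simp] = is_natD[OF t] is_natD[OF s] is_functorD[OF is_natD(1)[OF t]]
    is_functorD[OF is_natD(1)[OF s]] is_functorD[OF is_natD(2)[OF s]]
  fix f assume f[simp]: "f \<in> Arr C"
  show "Comp D (nt_vcomp C D s t (Cod C f)) (fAr F f) = Comp D (fAr H f) (nt_vcomp C D s t (Dom C f))"
    using naturality[OF t f refl refl]
      comp_square[OF naturality[OF s f refl refl], of "t (Dom C f)"] by simp
qed (use is_natD[OF t] is_natD[OF s] in \<open>auto simp: is_functorD\<close>)

lemma is_nat_nt_hcomp:
  assumes t: "is_nat C D F F' t" and s: "is_nat D E G G' s"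
  shows "is_nat C E (fcomp C G F) (fcomp C G' F') (nt_hcomp C E G s F' t)"
proof (rule is_natI)
  note tD = is_natD[OF t] note sD = is_natD[OF s]
  note [simp] = tD sD is_functorD[OF tD(1)] is_functorD[OF tD(2)]
    is_functorD[OF sD(1)] is_functorD[OF sD(2)]
  show "is_functor C E (fcomp C G F)" "is_functor C E (fcomp C G' F')"
    by (fact is_functor_fcomp[OF tD(1) sD(1)] is_functor_fcomp[OF tD(2) sD(2)])+
  fix f assume f[simp]: "f \<in> Arr C"
  \<comment> \<open>\<open>G\<close> applied to naturality of \<open>t\<close>, to be followed by
    naturality of \<open>s\<close> at the arrow \<open>fAr F' f\<close>.\<close>
  have 1: "Comp E (fAr G (t (Cod C f))) (fAr G (fAr F f)) =
      Comp E (fAr G (fAr F' f)) (fAr G (t (Dom C f)))"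
    using arg_cong[OF naturality[OF t f refl refl], of "fAr G"] by simp
  have 2: "Comp E (s (fOb F' (Cod C f))) (Comp E (fAr G (fAr F' f)) (fAr G (t (Dom C f)))) =
      Comp E (fAr G' (fAr F' f)) (Comp E (s (fOb F' (Dom C f))) (fAr G (t (Dom C f))))"
    by (rule comp_square[OF naturality[OF s]]) auto
  show "Comp E (nt_hcomp C E G s F' t (Cod C f)) (fAr (fcomp C G F) f) =
        Comp E (fAr (fcomp C G' F') f) (nt_hcomp C E G s F' t (Dom C f))"
    using 1 2 by simp
qed (use is_natD[OF t] is_natD[OF s] in \<open>auto simp: is_functorD\<close>)

lemma nt_eqI:
  assumes "s \<in> extensional (Obj C)" "t \<in> extensional (Obj C)" "\<And>x. x \<in> Obj C \<Longrightarrow> s x = t x"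
  shows "s = t"
  using assms by (rule extensionalityI)

lemma nt_vcomp_id:
  assumes t: "is_nat C D F G t"
  shows "nt_vcomp C D t (nt_id C D F) = t" "nt_vcomp C D (nt_id C D G) t = t"
  using is_natD[OF t] by (auto intro!: nt_eqI[of _ C] simp: is_functorD)

lemma nt_vcomp_assoc:
  assumes r: "is_nat C D F G r" and s: "is_nat C D G H s" and t: "is_nat C D H K t"
  shows "nt_vcomp C D t (nt_vcomp C D s r) = nt_vcomp C D (nt_vcomp C D t s) r"
  using is_natD[OF r] is_natD[OF s] is_natD[OF t] by (auto intro!: nt_eqI[of _ C] simp: is_functorD)

lemma nt_hcomp_id:
  assumes t: "is_nat C D F F' t"
  shows "nt_hcomp C D F t (id_fctr C) (nt_id C C (id_fctr C)) = t"
    "nt_hcomp C D (id_fctr D) (nt_id D D (id_fctr D)) F' t = t"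
  using is_natD[OF t] by (auto intro!: nt_eqI[of _ C] simp: is_functorD)

lemma nt_hcomp_nt_id:
  assumes F: "is_functor C D F" and G: "is_functor D E G"
  shows "nt_hcomp C E G (nt_id D E G) F (nt_id C D F) = nt_id C E (fcomp C G F)"
  using is_functorD[OF F] is_functorD[OF G] by (auto intro!: nt_eqI[of _ C])

lemma nt_hcomp_assoc:
  assumes r: "is_nat B C F F' r" and s: "is_nat C D G G' s" and t: "is_nat D E H H' t"
  shows "nt_hcomp B E H t (fcomp B G' F') (nt_hcomp B D G s F' r) =
    nt_hcomp B E (fcomp C H G) (nt_hcomp C E H t G' s) F' r"
  using is_natD[OF r] is_natD[OF s] is_natD[OF t]
  by (auto intro!: nt_eqI[of _ B] simp: is_functorD)

lemma nt_interchange: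
  assumes t: "is_nat C D F F' t" and t': "is_nat C D F' F'' t'"
    and s: "is_nat D E G G' s" and s': "is_nat D E G' G'' s'"
  shows "nt_hcomp C E G (nt_vcomp D E s' s) F'' (nt_vcomp C D t' t) =
    nt_vcomp C E (nt_hcomp C E G' s' F'' t') (nt_hcomp C E G s F' t)"
proof (rule nt_eqI[of _ C])
  note tD = is_natD[OF t] is_natD[OF t'] note sD = is_natD[OF s] is_natD[OF s']
  note [simp] = tD sD is_functorD[OF tD(1)] is_functorD[OF tD(2)] is_functorD[OF is_natD(2)[OF t']]
    is_functorD[OF sD(1)] is_functorD[OF sD(2)] is_functorD[OF is_natD(2)[OF s']]
  fix x assume x[simp]: "x \<in> Obj C"
  \<comment> \<open>The two sides of the interchange law differ only in the middle factors, and
    naturality of \<open>s\<close> at the arrow \<open>t' x\<close> exchanges these.\<close>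
  have "Comp E (s (fOb F'' x)) (Comp E (fAr G (t' x)) (fAr G (t x))) =
      Comp E (fAr G' (t' x)) (Comp E (s (fOb F' x)) (fAr G (t x)))"
    by (rule comp_square[OF naturality[OF s]]) auto
  then show "nt_hcomp C E G (nt_vcomp D E s' s) F'' (nt_vcomp C D t' t) x =
    nt_vcomp C E (nt_hcomp C E G' s' F'' t') (nt_hcomp C E G s F' t) x" by simp
qed auto

section \<open>2-categories whose 2-cells are transformations of underlying functors\<close>

text \<open>\<open>m1\<close> receives the endpoints of the composite because the composed data
  depend on them, through truncation to the carrier of the source and through composition in the
  target. Equations are assumed for 1-cells only: a 2-cell is a bare family, and its unit,
  associativity and interchange laws are those of natural transformations, once \<open>P2D\<close>
  supplies naturality and \<open>P1_id\<close> and \<open>P1_comp\<close> identify the underlying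
  functors.\<close>

locale concrete_2cat =
  fixes X :: "'x set"
    and P1 :: "'x \<Rightarrow> 'x \<Rightarrow> 'd \<Rightarrow> bool"
    and i1 :: "'x \<Rightarrow> 'd"
    and m1 :: "'x \<Rightarrow> 'x \<Rightarrow> 'd \<Rightarrow> 'd \<Rightarrow> 'd"
    and P2 :: "'x \<Rightarrow> 'x \<Rightarrow> 'd \<Rightarrow> 'd \<Rightarrow> ('o \<Rightarrow> 'a) \<Rightarrow> bool"
    and und :: "'x \<Rightarrow> ('o, 'a) cat"
    and uf :: "'d \<Rightarrow> ('o, 'a, 'o, 'a) fctr"
  assumes P1D: "P1 A B f \<Longrightarrow> A \<in> X \<and> B \<in> X \<and> is_functor (und A) (und B) (uf f)"
    and P1_id: "A \<in> X \<Longrightarrow> P1 A A (i1 A) \<and> uf (i1 A) = id_fctr (und A)"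
    and P1_comp: "\<lbrakk>P1 A B f; P1 B C g\<rbrakk>
          \<Longrightarrow> P1 A C (m1 A C g f) \<and> uf (m1 A C g f) = fcomp (und A) (uf g) (uf f)"
    and m1_id_right: "P1 A B f \<Longrightarrow> m1 A B f (i1 A) = f"
    and m1_id_left: "P1 A B f \<Longrightarrow> m1 A B (i1 B) f = f"
    and m1_assoc: "\<lbrakk>P1 A B f; P1 B C g; P1 C D h\<rbrakk>
          \<Longrightarrow> m1 A D h (m1 A C g f) = m1 A D (m1 B D h g) f"
    and P2D: "P2 A B f g t
          \<Longrightarrow> P1 A B f \<and> P1 A B g \<and> is_nat (und A) (und B) (uf f) (uf g) t"
    and P2_id: "P1 A B f \<Longrightarrow> P2 A B f f (nt_id (und A) (und B) (uf f))"
    and P2_vcomp: "\<lbrakk>P2 A B f g t; P2 A B g h s\<rbrakk> \<Longrightarrow> P2 A B f h (nt_vcomp (und A) (und B) s t)"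
    and P2_hcomp: "\<lbrakk>P2 A B f f' t; P2 B C g g' s\<rbrakk>
          \<Longrightarrow> P2 A C (m1 A C g f) (m1 A C g' f') (nt_hcomp (und A) (und C) (uf g) s (uf f') t)"
begin

text \<open>Shaped exactly like \<open>Two_Cat\<close>, \<open>Oplax_lax\<close> and
  \<open>Cat_over\<close>, which thereby become instances by mere unfolding.\<close>

definition cells where
  "cells = cell_cat2 X
     {F. P1 (src F) (trg F) (dat F)}
     i1
     (\<lambda>G F. m1 (src F) (trg G) (dat G) (dat F))
     {t. src (src t) = src (trg t) \<and> trg (src t) = trg (trg t) \<and>
         P2 (src (src t)) (trg (src t)) (dat (src t)) (dat (trg t)) (dat t)}
     (\<lambda>F. nt_id (und (src F)) (und (trg F)) (uf (dat F)))
     (\<lambda>s t. nt_vcomp (und (src (src t))) (und (trg (src t))) (dat s) (dat t))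
     (\<lambda>s t. nt_hcomp (und (src (src t))) (und (trg (src s)))
               (uf (dat (src s))) (dat s) (uf (dat (trg t))) (dat t))"

lemma cell1D:
  assumes "P1 A B f"
  shows "A \<in> X" "B \<in> X" "is_functor (und A) (und B) (uf f)"
  using P1D[OF assms] by auto

lemma cell2D:
  assumes "P2 A B f g t"
  shows "P1 A B f" "P1 A B g" "is_nat (und A) (und B) (uf f) (uf g) t" "A \<in> X" "B \<in> X"
  using P2D[OF assms] P1D by auto

lemma Obj_cells [simp]: "Obj (C1 cells) = X" "Obj (C2 cells) = Arr (C1 cells)"
  by (simp_all add: cells_def cell_cat2_def cell_cat_def)

lemma Arr1_cells [simp]: "Cell A B f \<in> Arr (C1 cells) \<longleftrightarrow> P1 A B f"
  by (simp add: cells_def cell_cat2_def cell_cat_def)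

lemma Arr1_cellsE:
  assumes "F \<in> Arr (C1 cells)"
  obtains A B f where "F = Cell A B f" "P1 A B f"
  using assms by (cases F) auto

lemma Arr2_cells [simp]: "Cell (Cell A B f) (Cell A' B' g) t \<in> Arr (C2 cells) \<longleftrightarrow>
    A' = A \<and> B' = B \<and> P2 A B f g t"
  by (auto simp add: cells_def cell_cat2_def cell_cat_def)

lemma Arr2_cellsE:
  assumes "a \<in> Arr (C2 cells)"
  obtains A B f g t where "a = Cell (Cell A B f) (Cell A B g) t" "P2 A B f g t"
proof (cases a)
  case (Cell F G t)
  then show thesis
    using assms that by (cases F; cases G) auto
qed

lemma cells1_simps [simp]:
  "P1 A B f \<Longrightarrow> Dom (C1 cells) (Cell A B f) = A"
  "P1 A B f \<Longrightarrow> Cod (C1 cells) (Cell A B f) = B"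
  "A \<in> X \<Longrightarrow> Ident (C1 cells) A = Cell A A (i1 A)"
  "\<lbrakk>P1 A B f; P1 B C g\<rbrakk> \<Longrightarrow> Comp (C1 cells) (Cell B C g) (Cell A B f) = Cell A C (m1 A C g f)"
  by (simp_all add: cells_def cell_cat2_def cell_cat_def)

lemma cells2_simps [simp]:
  "P2 A B f g t \<Longrightarrow> Dom (C2 cells) (Cell (Cell A B f) (Cell A B g) t) = Cell A B f"
  "P2 A B f g t \<Longrightarrow> Cod (C2 cells) (Cell (Cell A B f) (Cell A B g) t) = Cell A B g"
  "P1 A B f \<Longrightarrow> Ident (C2 cells) (Cell A B f) =
     Cell (Cell A B f) (Cell A B f) (nt_id (und A) (und B) (uf f))"
  "\<lbrakk>P2 A B f g t; P2 A B g h s\<rbrakk> \<Longrightarrow>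
     Comp (C2 cells) (Cell (Cell A B g) (Cell A B h) s) (Cell (Cell A B f) (Cell A B g) t) =
     Cell (Cell A B f) (Cell A B h) (nt_vcomp (und A) (und B) s t)"
  by (simp_all add: cells_def cell_cat2_def cell_cat_def)

lemma HComp_cells [simp]:
  assumes "P2 A B f f' t" "P2 B C g g' s"
  shows "HComp cells (Cell (Cell B C g) (Cell B C g') s) (Cell (Cell A B f) (Cell A B f') t) =
     Cell (Cell A C (m1 A C g f)) (Cell A C (m1 A C g' f'))
       (nt_hcomp (und A) (und C) (uf g) s (uf f') t)"
  using cell2D[OF assms(1)] cell2D[OF assms(2)] assms
  by (simp add: cells_def cell_cat2_def cell_cat_def)

lemma category_cells1: "category (C1 cells)"
proof (rule categoryI)
  show "Dom (C1 cells) \<in> extensional (Arr (C1 cells))" "Cod (C1 cells) \<in> extensional (Arr (C1 cells))"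
    "Ident (C1 cells) \<in> extensional (Obj (C1 cells))"
    "\<And>g f. \<not> composable (C1 cells) g f \<Longrightarrow> Comp (C1 cells) g f = undefined"
    by (simp_all add: cells_def cell_cat2_def cell_cat_def make_cat_extensional)
  fix F assume "F \<in> Arr (C1 cells)"
  then obtain A B f where F: "F = Cell A B f" "P1 A B f" by (rule Arr1_cellsE)
  then show "Comp (C1 cells) F (Ident (C1 cells) (Dom (C1 cells) F)) = F \<and>
      Comp (C1 cells) (Ident (C1 cells) (Cod (C1 cells) F)) F = F"
    using cell1D[OF F(2)] by (simp add: P1_id m1_id_right m1_id_left)
qed (auto elim!: Arr1_cellsE simp: P1_id P1_comp m1_assoc intro: cell1D)

lemma category_cells2: "category (C2 cells)"
proof (rule categoryI)
  show "Dom (C2 cells) \<in> extensional (Arr (C2 cells))" "Cod (C2 cells) \<in> extensional (Arr (C2 cells))"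
    "Ident (C2 cells) \<in> extensional (Obj (C2 cells))"
    "\<And>g f. \<not> composable (C2 cells) g f \<Longrightarrow> Comp (C2 cells) g f = undefined"
    by (simp_all add: cells_def cell_cat2_def cell_cat_def make_cat_extensional)
  fix a assume "a \<in> Arr (C2 cells)"
  then obtain A B f g t where a: "a = Cell (Cell A B f) (Cell A B g) t" "P2 A B f g t"
    by (rule Arr2_cellsE)
  then show "Comp (C2 cells) a (Ident (C2 cells) (Dom (C2 cells) a)) = a \<and>
      Comp (C2 cells) (Ident (C2 cells) (Cod (C2 cells) a)) a = a"
    using cell2D[OF a(2)] by (simp add: P2_id nt_vcomp_id)
qed (auto elim!: Arr2_cellsE Arr1_cellsE
    simp: P2_id P2_vcomp nt_vcomp_assoc[OF cell2D(3) cell2D(3) cell2D(3)] intro: cell2D)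

lemma HComp_cells_undefined:
  "\<not> (b \<in> Arr (C2 cells) \<and> a \<in> Arr (C2 cells) \<and> src (src b) = trg (trg a)) \<Longrightarrow>
    HComp cells b a = undefined"
  unfolding cells_def cell_cat2_def cell_cat_def by auto

lemma horiz_cells_simps [simp]:
  "Obj (horiz cells) = X" "Arr (horiz cells) = Arr (C2 cells)" "Comp (horiz cells) = HComp cells"
  "P2 A B f g t \<Longrightarrow> Dom (horiz cells) (Cell (Cell A B f) (Cell A B g) t) = A"
  "P2 A B f g t \<Longrightarrow> Cod (horiz cells) (Cell (Cell A B f) (Cell A B g) t) = B"
  "A \<in> X \<Longrightarrow> Ident (horiz cells) A = Cell (Cell A A (i1 A)) (Cell A A (i1 A))
     (nt_id (und A) (und A) (id_fctr (und A)))"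
  by (auto simp: horiz_def P1_id dest: cell2D)

text \<open>In the simplified horizontal identities \<open>id_fctr (und A)\<close> has taken the
  place of the functor underlying \<open>i1 A\<close>, so their typing is required in that form
  too.\<close>

lemma P2_id_id: "A \<in> X \<Longrightarrow> P2 A A (i1 A) (i1 A) (nt_id (und A) (und A) (id_fctr (und A)))"
  using P2_id[of A A "i1 A"] P1_id[of A] by simp

lemma category_horiz_cells: "category (horiz cells)"
proof (rule categoryI)
  show "Dom (horiz cells) \<in> extensional (Arr (horiz cells))"
    "Cod (horiz cells) \<in> extensional (Arr (horiz cells))"
    "Ident (horiz cells) \<in> extensional (Obj (horiz cells))"
    by (simp_all add: horiz_def)
  \<comment> \<open>\<open>HComp\<close> tests the stored fields \<open>src\<close> and
    \<open>trg\<close>, whereas \<open>composable\<close> tests the maps \<open>Dom\<close> and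
    \<open>Cod\<close>; on genuine 2-cells the two tests agree.\<close>
  show "Comp (horiz cells) b a = undefined" if "\<not> composable (horiz cells) b a" for a b
  proof (cases "b \<in> Arr (C2 cells) \<and> a \<in> Arr (C2 cells)")
    case True
    then have "src (src b) \<noteq> trg (trg a)"
      using that by (auto simp: composable_def elim!: Arr2_cellsE)
    then show ?thesis by (simp add: HComp_cells_undefined)
  qed (auto simp: HComp_cells_undefined)
  fix a assume "a \<in> Arr (horiz cells)"
  then show "Comp (horiz cells) a (Ident (horiz cells) (Dom (horiz cells) a)) = a \<and>
    Comp (horiz cells) (Ident (horiz cells) (Cod (horiz cells) a)) a = a"
    by (auto elim!: Arr2_cellsE simp: cell2D P2_id_id P1_id m1_id_right[OF cell2D(1)]
        m1_id_right[OF cell2D(2)] m1_id_left[OF cell2D(1)] m1_id_left[OF cell2D(2)]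
        nt_hcomp_id[OF cell2D(3)])
next
  fix c b a assume "a \<in> Arr (horiz cells)" "b \<in> Arr (horiz cells)" "c \<in> Arr (horiz cells)"
    "Dom (horiz cells) c = Cod (horiz cells) b" "Dom (horiz cells) b = Cod (horiz cells) a"
  then obtain A B C D f f' g g' h h' r s t where
    a: "a = Cell (Cell A B f) (Cell A B f') r" "P2 A B f f' r" and
    b: "b = Cell (Cell B C g) (Cell B C g') s" "P2 B C g g' s" and
    c: "c = Cell (Cell C D h) (Cell C D h') t" "P2 C D h h' t"
    by (auto elim!: Arr2_cellsE)
  note [simp] = cell2D[OF a(2)] cell2D[OF b(2)] cell2D[OF c(2)] a b c
  note P1s = cell2D(1,2)[OF a(2)] cell2D(1,2)[OF b(2)] cell2D(1,2)[OF c(2)]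
  show "Comp (horiz cells) c (Comp (horiz cells) b a) = Comp (horiz cells) (Comp (horiz cells) c b) a"
    using P2_hcomp[OF a(2) b(2)] P2_hcomp[OF b(2) c(2)]
    by (simp add: m1_assoc[OF P1s(1,3,5)] m1_assoc[OF P1s(2,4,6)]
      P1_comp[OF P1s(2,4)] P1_comp[OF P1s(3,5)] nt_hcomp_assoc[OF cell2D(3)[OF a(2)] cell2D(3)[OF b(2)] cell2D(3)[OF c(2)]])
qed (auto elim!: Arr2_cellsE simp: P2_id_id P2_hcomp intro: cell2D)

theorem two_category_cells: "two_category cells"
  unfolding two_category_def
proof (intro conjI ballI allI impI; (elim conjE)?)
  show "category (C1 cells)" "category (C2 cells)" "category (horiz cells)"
    by (rule category_cells1 category_cells2 category_horiz_cells)+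
  show "HComp cells (Ident (C2 cells) g) (Ident (C2 cells) f) = Ident (C2 cells) (Comp (C1 cells) g f)"
    if "composable (C1 cells) g f" for g f
    using that by (auto simp: composable_def P2_id P1_comp cell1D(3) elim!: Arr1_cellsE
      intro!: nt_hcomp_nt_id)
  show "HComp cells (Comp (C2 cells) b' b) (Comp (C2 cells) a' a) =
      Comp (C2 cells) (HComp cells b' a') (HComp cells b a)"
    if "composable (C2 cells) b' b" "composable (C2 cells) a' a" "composable (horiz cells) b a"
    for b' b a' a
    using that
    by (auto simp: composable_def P2_vcomp P2_hcomp elim!: Arr2_cellsE
      intro!: nt_interchange cell2D)
qed (auto elim!: Arr2_cellsE simp: composable_def cell2D P2_hcomp)

end

text \<open>\<open>\<phi>1\<close> and \<open>\<phi>2\<close> act on data only and again see the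
  endpoints, since data are truncated to a carrier that belongs to the source. The passage to actual
  cells, whose endpoints must move as well, is made in \<open>is_2functor_cells\<close>.\<close>

locale concrete_2functor =
  S: concrete_2cat X P1 i1 m1 P2 und uf + T: concrete_2cat Y Q1 j1 n1 Q2 vnd vf
  for X :: "'x set" and P1 :: "'x \<Rightarrow> 'x \<Rightarrow> 'd \<Rightarrow> bool" and i1 m1
    and P2 :: "'x \<Rightarrow> 'x \<Rightarrow> 'd \<Rightarrow> 'd \<Rightarrow> ('o \<Rightarrow> 'a) \<Rightarrow> bool" and und uf
    and Y :: "'y set" and Q1 :: "'y \<Rightarrow> 'y \<Rightarrow> 'e \<Rightarrow> bool" and j1 n1
    and Q2 :: "'y \<Rightarrow> 'y \<Rightarrow> 'e \<Rightarrow> 'e \<Rightarrow> ('p \<Rightarrow> 'b) \<Rightarrow> bool" and vnd vf +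
  fixes \<phi>0 :: "'x \<Rightarrow> 'y"
    and \<phi>1 :: "'x \<Rightarrow> 'x \<Rightarrow> 'd \<Rightarrow> 'e"
    and \<phi>2 :: "'x \<Rightarrow> 'x \<Rightarrow> 'd \<Rightarrow> 'd \<Rightarrow> ('o \<Rightarrow> 'a) \<Rightarrow> 'p \<Rightarrow> 'b"
  assumes \<phi>0: "A \<in> X \<Longrightarrow> \<phi>0 A \<in> Y"
    and \<phi>1: "P1 A B f \<Longrightarrow> Q1 (\<phi>0 A) (\<phi>0 B) (\<phi>1 A B f)"
    and \<phi>1_id: "A \<in> X \<Longrightarrow> \<phi>1 A A (i1 A) = j1 (\<phi>0 A)"
    and \<phi>1_comp: "\<lbrakk>P1 A B f; P1 B C g\<rbrakk>
          \<Longrightarrow> \<phi>1 A C (m1 A C g f) = n1 (\<phi>0 A) (\<phi>0 C) (\<phi>1 B C g) (\<phi>1 A B f)"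
    and \<phi>2: "P2 A B f g t \<Longrightarrow> Q2 (\<phi>0 A) (\<phi>0 B) (\<phi>1 A B f) (\<phi>1 A B g) (\<phi>2 A B f g t)"
    and \<phi>2_id: "P1 A B f \<Longrightarrow> \<phi>2 A B f f (nt_id (und A) (und B) (uf f)) =
          nt_id (vnd (\<phi>0 A)) (vnd (\<phi>0 B)) (vf (\<phi>1 A B f))"
    and \<phi>2_vcomp: "\<lbrakk>P2 A B f g t; P2 A B g h s\<rbrakk> \<Longrightarrow> \<phi>2 A B f h (nt_vcomp (und A) (und B) s t) =
          nt_vcomp (vnd (\<phi>0 A)) (vnd (\<phi>0 B)) (\<phi>2 A B g h s) (\<phi>2 A B f g t)"
    and \<phi>2_hcomp: "\<lbrakk>P2 A B f f' t; P2 B C g g' s\<rbrakk> \<Longrightarrow>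
          \<phi>2 A C (m1 A C g f) (m1 A C g' f') (nt_hcomp (und A) (und C) (uf g) s (uf f') t) =
          nt_hcomp (vnd (\<phi>0 A)) (vnd (\<phi>0 C)) (vf (\<phi>1 B C g)) (\<phi>2 B C g g' s)
            (vf (\<phi>1 A B f')) (\<phi>2 A B f f' t)"
begin

text \<open>\<open>F\<close> is described by its values on cells and by extensionality, which is
  what a record built with \<open>restrict\<close>, such as \<open>push_lax\<close> or
  \<open>enrichment\<close>, provides directly.\<close>

theorem is_2functor_cells:
  assumes ext: "F0 F \<in> extensional X" "F1 F \<in> extensional (Arr (C1 S.cells))"
      "F2 F \<in> extensional (Arr (C2 S.cells))"
    and F0: "\<And>A. A \<in> X \<Longrightarrow> F0 F A = \<phi>0 A"
    and F1: "\<And>A B f. P1 A B f \<Longrightarrow> F1 F (Cell A B f) = Cell (\<phi>0 A) (\<phi>0 B) (\<phi>1 A B f)"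
    and F2: "\<And>A B f g t. P2 A B f g t \<Longrightarrow> F2 F (Cell (Cell A B f) (Cell A B g) t) =
        Cell (Cell (\<phi>0 A) (\<phi>0 B) (\<phi>1 A B f)) (Cell (\<phi>0 A) (\<phi>0 B) (\<phi>1 A B g)) (\<phi>2 A B f g t)"
  shows "is_2functor S.cells T.cells F"
  unfolding is_2functor_def
proof (intro conjI)
  show "two_category S.cells" "two_category T.cells"
    by (rule S.two_category_cells T.two_category_cells)+
  show "is_functor (C1 S.cells) (C1 T.cells) (F01 F)"
    by (rule is_functorI)
      (auto simp: F01_def ext F0 F1 \<phi>0 \<phi>1 \<phi>1_id \<phi>1_comp S.P1_id S.P1_comp S.cell1D
        S.category_cells1 T.category_cells1 elim!: S.Arr1_cellsE)
  show "is_functor (C2 S.cells) (C2 T.cells) \<lparr>fOb = F1 F, fAr = F2 F\<rparr>"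
    by (rule is_functorI)
      (auto simp: ext F1 F2 \<phi>1 \<phi>2 \<phi>2_id \<phi>2_vcomp S.P2_id S.P2_vcomp S.cell2D
        S.category_cells2 T.category_cells2 elim!: S.Arr1_cellsE S.Arr2_cellsE)
  \<comment> \<open>Horizontal identities carry \<open>id_fctr\<close> instead of the functor
    underlying \<open>i1 A\<close>; their preservation is \<open>\<phi>2_id\<close> at
    \<open>i1 A\<close>, rewritten by \<open>P1_id\<close> on both sides and by
    \<open>\<phi>1_id\<close>.\<close>
  have id_id: "\<phi>2 A A (i1 A) (i1 A) (nt_id (und A) (und A) (id_fctr (und A))) =
      nt_id (vnd (\<phi>0 A)) (vnd (\<phi>0 A)) (id_fctr (vnd (\<phi>0 A)))" if "A \<in> X" for A
    using \<phi>2_id[of A A "i1 A"] S.P1_id[OF that] T.P1_id[OF \<phi>0[OF that]] \<phi>1_id[OF that] by simp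
  show "is_functor (horiz S.cells) (horiz T.cells) \<lparr>fOb = F0 F, fAr = F2 F\<rparr>"
    by (rule is_functorI)
      (auto simp: ext F0 F2 \<phi>0 \<phi>2 \<phi>1_id \<phi>1_comp id_id \<phi>2_hcomp S.P2_id_id S.P2_hcomp S.cell2D
        S.cell2D(1,2)[THEN \<phi>1_comp[rotated]]
        S.category_horiz_cells T.category_horiz_cells elim!: S.Arr2_cellsE)
qed

end

section \<open>The 2-category of 2-categories\<close>

lemma two_categoryD:
  assumes "two_category S"
  shows "category (C1 S)" "category (C2 S)" "category (horiz S)" "Obj (C2 S) = Arr (C1 S)"
  using assms unfolding two_category_def by auto

lemma horiz_simps:
  assumes S: "two_category S"
  shows "Obj (horiz S) = Obj (C1 S)" "Arr (horiz S) = Arr (C2 S)"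
    and "f \<in> Arr (C1 S) \<Longrightarrow> Ident (C2 S) f \<in> Arr (C2 S)"
    and "f \<in> Arr (C1 S) \<Longrightarrow> Dom (horiz S) (Ident (C2 S) f) = Dom (C1 S) f"
    and "f \<in> Arr (C1 S) \<Longrightarrow> Cod (horiz S) (Ident (C2 S) f) = Cod (C1 S) f"
    and "x \<in> Obj (C1 S) \<Longrightarrow> Ident (C2 S) (Ident (C1 S) x) = Ident (horiz S) x"
  using two_categoryD[OF S] by (simp_all add: horiz_def)

text \<open>Lets a whiskering by a composite 1-cell be split into two composites in the category
  \<open>horiz S\<close>, where the squares of 2-naturality live.\<close>

lemma horiz_Comp:
  assumes S: "two_category S"
    and "g \<in> Arr (C1 S)" "f \<in> Arr (C1 S)" "Dom (C1 S) g = Cod (C1 S) f"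
  shows "Ident (C2 S) (Comp (C1 S) g f) = Comp (horiz S) (Ident (C2 S) g) (Ident (C2 S) f)"
  using assms unfolding two_category_def by (simp add: composable_def horiz_def)

text \<open>Together with \<open>F01\<close> and \<open>F02\<close> this presents a 2-functor as
  three ordinary functors, so that identities and composites of 2-functors reduce to
  \<open>id_fctr\<close> and \<open>fcomp\<close>.\<close>

definition F12 :: "('o, 'f, 't, 'p, 'g, 'u) fctr2 \<Rightarrow> ('f, 't, 'g, 'u) fctr" where
  "F12 F = \<lparr>fOb = F1 F, fAr = F2 F\<rparr>"

definition F02 :: "('o, 'f, 't, 'p, 'g, 'u) fctr2 \<Rightarrow> ('o, 't, 'p, 'u) fctr" where
  "F02 F = \<lparr>fOb = F0 F, fAr = F2 F\<rparr>"

lemma is_2functor_iff: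
  "is_2functor S T F \<longleftrightarrow> two_category S \<and> two_category T \<and>
    is_functor (C1 S) (C1 T) (F01 F) \<and> is_functor (C2 S) (C2 T) (F12 F) \<and>
    is_functor (horiz S) (horiz T) (F02 F)"
  by (simp add: is_2functor_def F12_def F02_def)

lemma is_2functorD:
  assumes "is_2functor S T F"
  shows "two_category S" "two_category T"
    and "is_functor (C1 S) (C1 T) (F01 F)" "is_functor (C2 S) (C2 T) (F12 F)"
    "is_functor (horiz S) (horiz T) (F02 F)"
  using assms by (auto simp: is_2functor_iff)

lemma fctr2_eqI: "F01 F = F01 G \<Longrightarrow> F12 F = F12 G \<Longrightarrow> F = G"
  by (simp add: F01_def F12_def)

lemma id_2fctr_simps:
  assumes "two_category S"
  shows "F01 (id_2fctr S) = id_fctr (C1 S)" "F12 (id_2fctr S) = id_fctr (C2 S)"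
    "F02 (id_2fctr S) = id_fctr (horiz S)"
  using two_categoryD[OF assms] horiz_simps[OF assms]
  by (simp_all add: id_2fctr_def id_fctr_def F01_def F12_def F02_def)

lemma comp_2fctr_simps:
  assumes "two_category S"
  shows "F01 (comp_2fctr S G F) = fcomp (C1 S) (F01 G) (F01 F)"
    "F12 (comp_2fctr S G F) = fcomp (C2 S) (F12 G) (F12 F)"
    "F02 (comp_2fctr S G F) = fcomp (horiz S) (F02 G) (F02 F)"
  using two_categoryD[OF assms] horiz_simps[OF assms]
  by (simp_all add: comp_2fctr_def fcomp_def F01_def F12_def F02_def)

lemma is_2natD:
  assumes "is_2nat S T F G t"
  shows "is_2functor S T F" "is_2functor S T G" "is_nat (C1 S) (C1 T) (F01 F) (F01 G) t"
    and "\<lbrakk>a \<in> Arr (C2 S); Dom (horiz S) a = x; Cod (horiz S) a = y\<rbrakk> \<Longrightarrow>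
      Comp (horiz T) (Ident (C2 T) (t y)) (fAr (F02 F) a) =
      Comp (horiz T) (fAr (F02 G) a) (Ident (C2 T) (t x))"
  using assms unfolding is_2nat_def by (auto simp: horiz_def F02_def)

lemma is_2natI:
  assumes "is_2functor S T F" "is_2functor S T G" "is_nat (C1 S) (C1 T) (F01 F) (F01 G) t"
    and "\<And>a. a \<in> Arr (C2 S) \<Longrightarrow>
      Comp (horiz T) (Ident (C2 T) (t (Cod (horiz S) a))) (fAr (F02 F) a) =
      Comp (horiz T) (fAr (F02 G) a) (Ident (C2 T) (t (Dom (horiz S) a)))"
  shows "is_2nat S T F G t"
  using assms unfolding is_2nat_def by (auto simp: horiz_def F02_def)

text \<open>The three functors share their component maps. Rewriting to \<open>F01\<close> on
  objects and 1-cells and to \<open>F02\<close> on 2-cells gives facts obtained from different ones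
  a common normal form.\<close>

lemma F_eq [simp]: "fOb (F02 F) = fOb (F01 F)" "fOb (F12 F) = fAr (F01 F)" "fAr (F12 F) = fAr (F02 F)"
  by (auto simp: F01_def F12_def F02_def)

lemma is_2nat_nt_id:
  assumes F: "is_2functor S T F"
  shows "is_2nat S T F F (nt_id (C1 S) (C1 T) (F01 F))"
proof (rule is_2natI)
  note FD = is_2functorD[OF F]
  note [simp] = FD(1,2) two_categoryD[OF FD(1)] two_categoryD[OF FD(2)]
    horiz_simps[OF FD(1)] horiz_simps[OF FD(2)]
    is_functorD[OF FD(3)] is_functorD[OF FD(5), simplified]
  have ob[simp]: "Cod (horiz S) a \<in> Obj (C1 S)" "Dom (horiz S) a \<in> Obj (C1 S)"
    if "a \<in> Arr (C2 S)" for a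
    using that category_simps(1,2)[of "horiz S" a] by simp_all
  show "Comp (horiz T) (Ident (C2 T) (nt_id (C1 S) (C1 T) (F01 F) (Cod (horiz S) a)))
        (fAr (F02 F) a) =
      Comp (horiz T) (fAr (F02 F) a)
        (Ident (C2 T) (nt_id (C1 S) (C1 T) (F01 F) (Dom (horiz S) a)))"
    if "a \<in> Arr (C2 S)" for a
    using that by simp
  show "is_nat (C1 S) (C1 T) (F01 F) (F01 F) (nt_id (C1 S) (C1 T) (F01 F))"
    by (rule is_nat_nt_id[OF FD(3)])
qed (fact F)+

lemma is_2functor_id: "two_category S \<Longrightarrow> is_2functor S S (id_2fctr S)"
  by (simp add: is_2functor_iff id_2fctr_simps is_functor_id two_categoryD)

lemma is_2functor_comp:
  "is_2functor S T F \<Longrightarrow> is_2functor T U G \<Longrightarrow> is_2functor S U (comp_2fctr S G F)"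
  by (auto simp: is_2functor_iff comp_2fctr_simps intro: is_functor_fcomp)

lemma is_2nat_vcomp:
  assumes t: "is_2nat S T F G t" and s: "is_2nat S T G H s"
  shows "is_2nat S T F H (nt_vcomp (C1 S) (C1 T) s t)"
proof (rule is_2natI)
  note tD = is_2natD[OF t] and sD = is_2natD[OF s]
  note F = is_2functorD[OF tD(1)] and G = is_2functorD[OF tD(2)] and H = is_2functorD[OF sD(2)]
  note [simp] = two_categoryD[OF F(1)] two_categoryD[OF F(2)] horiz_simps[OF F(1)]
    horiz_simps[OF F(2)] is_functorD[OF F(3)] is_functorD[OF F(5), simplified]
    is_functorD[OF G(3)] is_functorD[OF G(5), simplified]
    is_functorD[OF H(3)] is_functorD[OF H(5), simplified]
    is_natD[OF tD(3)] is_natD[OF sD(3)]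
  show "is_nat (C1 S) (C1 T) (F01 F) (F01 H) (nt_vcomp (C1 S) (C1 T) s t)"
    by (rule is_nat_nt_vcomp[OF tD(3) sD(3)])
  fix a assume a[simp]: "a \<in> Arr (C2 S)"
  define x y where "x = Dom (horiz S) a" and "y = Cod (horiz S) a"
  have xy[simp]: "x \<in> Obj (C1 S)" "y \<in> Obj (C1 S)" "Dom (horiz S) a = x" "Cod (horiz S) a = y"
    using category_simps(1,2)[of "horiz S" a] by (simp_all add: x_def y_def)
  have "Comp (horiz T) (Ident (C2 T) (s y))
      (Comp (horiz T) (fAr (F02 G) a) (Ident (C2 T) (t x))) =
    Comp (horiz T) (fAr (F02 H) a) (Comp (horiz T) (Ident (C2 T) (s x)) (Ident (C2 T) (t x)))"
    by (rule comp_square[OF sD(4)]) auto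
  then show "Comp (horiz T) (Ident (C2 T) (nt_vcomp (C1 S) (C1 T) s t (Cod (horiz S) a)))
        (fAr (F02 F) a) =
      Comp (horiz T) (fAr (F02 H) a)
        (Ident (C2 T) (nt_vcomp (C1 S) (C1 T) s t (Dom (horiz S) a)))"
    by (simp add: horiz_Comp[OF F(2)] tD(4))
qed (fact is_2natD(1)[OF t] is_2natD(2)[OF s])+

lemma is_2nat_hcomp:
  assumes t: "is_2nat S T F F' t" and s: "is_2nat T U G G' s"
  shows "is_2nat S U (comp_2fctr S G F) (comp_2fctr S G' F')
    (nt_hcomp (C1 S) (C1 U) (F01 G) s (F01 F') t)"
proof (rule is_2natI)
  note tD = is_2natD[OF t] and sD = is_2natD[OF s]
  note F = is_2functorD[OF tD(1)] and F' = is_2functorD[OF tD(2)]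
    and G = is_2functorD[OF sD(1)] and G' = is_2functorD[OF sD(2)]
  note [simp] = two_categoryD[OF F(1)] two_categoryD[OF F(2)] two_categoryD[OF G(2)]
    horiz_simps[OF F(1)] horiz_simps[OF F(2)] horiz_simps[OF G(2)]
    is_functorD[OF F(3)] is_functorD[OF F(5), simplified]
    is_functorD[OF F'(3)] is_functorD[OF F'(5), simplified]
    is_functorD[OF G(3)] is_functorD[OF G(5), simplified]
    is_functorD[OF G'(3)] is_functorD[OF G'(5), simplified]
    is_natD[OF tD(3)] is_natD[OF sD(3)] comp_2fctr_simps[OF F(1)]
  \<comment> \<open>Oriented towards \<open>F02\<close>: the 2-cells used for whiskering then appear
    as images under the functors \<open>F02 G\<close> and \<open>F02 G'\<close>, which also preserve
    the horizontal composites around them.\<close>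
  have Gid[simp]: "Ident (C2 U) (fAr (F01 G) f) = fAr (F02 G) (Ident (C2 T) f)"
     "Ident (C2 U) (fAr (F01 G') f) = fAr (F02 G') (Ident (C2 T) f)" if "f \<in> Arr (C1 T)" for f
    using is_functorD(7)[OF G(4), of f] is_functorD(7)[OF G'(4), of f] that by simp_all
  show "is_2functor S U (comp_2fctr S G F)" "is_2functor S U (comp_2fctr S G' F')"
    using tD(1,2) sD(1,2) by (auto intro: is_2functor_comp)
  show "is_nat (C1 S) (C1 U) (F01 (comp_2fctr S G F)) (F01 (comp_2fctr S G' F'))
    (nt_hcomp (C1 S) (C1 U) (F01 G) s (F01 F') t)"
    using is_nat_nt_hcomp[OF tD(3) sD(3)] by simp
  fix a assume a[simp]: "a \<in> Arr (C2 S)"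
  define x y where "x = Dom (horiz S) a" and "y = Cod (horiz S) a"
  have xy[simp]: "x \<in> Obj (C1 S)" "y \<in> Obj (C1 S)" "Dom (horiz S) a = x" "Cod (horiz S) a = y"
    using category_simps(1,2)[of "horiz S" a] by (simp_all add: x_def y_def)
  let ?st = "nt_hcomp (C1 S) (C1 U) (F01 G) s (F01 F') t"
  have st: "Ident (C2 U) (?st z) = Comp (horiz U) (Ident (C2 U) (s (fOb (F01 F') z)))
      (fAr (F02 G) (Ident (C2 T) (t z)))" if "z \<in> Obj (C1 S)" for z
    using that by (simp add: horiz_Comp[OF G(2)])
  \<comment> \<open>As for natural transformations: \<open>F02 G\<close> applied to 2-naturality of
    \<open>t\<close>, then 2-naturality of \<open>s\<close> at the image of \<open>a\<close> under
    \<open>F'\<close>.\<close>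
  have 1: "Comp (horiz U) (fAr (F02 G) (Ident (C2 T) (t y))) (fAr (F02 G) (fAr (F02 F) a)) =
      Comp (horiz U) (fAr (F02 G) (fAr (F02 F') a)) (fAr (F02 G) (Ident (C2 T) (t x)))"
    using arg_cong[OF tD(4)[OF a, of x y], of "fAr (F02 G)"] by simp
  have 2: "Comp (horiz U) (Ident (C2 U) (s (fOb (F01 F') y)))
      (Comp (horiz U) (fAr (F02 G) (fAr (F02 F') a)) (fAr (F02 G) (Ident (C2 T) (t x)))) =
      Comp (horiz U) (fAr (F02 G') (fAr (F02 F') a))
        (Comp (horiz U) (Ident (C2 U) (s (fOb (F01 F') x))) (fAr (F02 G) (Ident (C2 T) (t x))))"
    by (rule comp_square[OF sD(4)]) auto
  show "Comp (horiz U) (Ident (C2 U) (?st (Cod (horiz S) a))) (fAr (F02 (comp_2fctr S G F)) a) =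
      Comp (horiz U) (fAr (F02 (comp_2fctr S G' F')) a) (Ident (C2 U) (?st (Dom (horiz S) a)))"
    using 1 2 by (simp add: st del: nt_hcomp_simps)
qed

lemma concrete_2cat_Two_Cat:
  "concrete_2cat {S. two_category S} is_2functor id_2fctr (\<lambda>S U G F. comp_2fctr S G F) is_2nat C1 F01"
proof
  show "comp_2fctr S F (id_2fctr S) = F" "comp_2fctr S (id_2fctr T) F = F" if "is_2functor S T F"
    for S T F
    using is_2functorD[OF that]
    by (auto intro!: fctr2_eqI simp: comp_2fctr_simps id_2fctr_simps fcomp_id_left fcomp_id_right)
  show "comp_2fctr A h (comp_2fctr A g f) = comp_2fctr A (comp_2fctr B h g) f"
    if "is_2functor A B f" "is_2functor B C g" "is_2functor C D h" for A B C D f g h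
    using is_2functorD[OF that(1)]
    by (auto intro!: fctr2_eqI simp: comp_2fctr_simps is_2functorD[OF that(2)] fcomp_assoc)
qed (auto simp: is_2functorD is_2natD id_2fctr_simps comp_2fctr_simps is_2nat_nt_id
    intro: is_2functor_id is_2functor_comp is_2nat_vcomp is_2nat_hcomp)

interpretation Two_Cat: concrete_2cat "{S. two_category S}" is_2functor id_2fctr
  "\<lambda>S U G F. comp_2fctr S G F" is_2nat C1 F01
  by (rule concrete_2cat_Two_Cat)

lemma Two_Cat_eq: "Two_Cat = Two_Cat.cells"
  unfolding Two_Cat_def Two_Cat.cells_def by simp

section \<open>The 2-category of oplax monoidal categories\<close>

lemma map_lists [simp]:
  assumes "category C"
  shows "xs \<in> lists (Obj C) \<Longrightarrow> map (Ident C) xs \<in> lists (Arr C)"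
    and "fs \<in> lists (Arr C) \<Longrightarrow> map (Dom C) fs \<in> lists (Obj C)"
    and "fs \<in> lists (Arr C) \<Longrightarrow> map (Cod C) fs \<in> lists (Obj C)"
    and "xs \<in> lists (Obj C) \<Longrightarrow> map (Dom C) (map (Ident C) xs) = xs"
    and "xs \<in> lists (Obj C) \<Longrightarrow> map (Cod C) (map (Ident C) xs) = xs"
    and "xs \<in> lists (Obj C) \<Longrightarrow> map2 (Comp C) (map (Ident C) xs) (map (Ident C) xs) = map (Ident C) xs"
  using assms by (auto simp: in_lists_conv_set map_idI map2_map_map)

text \<open>The rules on endpoints and identities keep iterated maps such as
  \<open>map (Dom D) (map (fAr F) fs)\<close>. Proofs that rely on them take \<open>map_map\<close>
  out of the simpset, because fusing the two maps would destroy the pattern.\<close>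

lemma functor_listD:
  assumes "is_functor C D F"
  shows "xs \<in> lists (Obj C) \<Longrightarrow> map (fOb F) xs \<in> lists (Obj D)"
    and "fs \<in> lists (Arr C) \<Longrightarrow> map (fAr F) fs \<in> lists (Arr D)"
    and "fs \<in> lists (Arr C) \<Longrightarrow> map (Dom D) (map (fAr F) fs) = map (fOb F) (map (Dom C) fs)"
    and "fs \<in> lists (Arr C) \<Longrightarrow> map (Cod D) (map (fAr F) fs) = map (fOb F) (map (Cod C) fs)"
    and "xs \<in> lists (Obj C) \<Longrightarrow> map (fAr F) (map (Ident C) xs) = map (Ident D) (map (fOb F) xs)"
  using is_functorD[OF assms] by (auto simp: in_lists_conv_set)

lemma nat_listD:
  assumes "is_nat C D F G t"
  shows "xs \<in> lists (Obj C) \<Longrightarrow> map t xs \<in> lists (Arr D)"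
    and "xs \<in> lists (Obj C) \<Longrightarrow> map (Dom D) (map t xs) = map (fOb F) xs"
    and "xs \<in> lists (Obj C) \<Longrightarrow> map (Cod D) (map t xs) = map (fOb G) xs"
  using is_natD[OF assms] by (auto simp: in_lists_conv_set)

lemma map_fcomp:
  assumes "is_functor C D F"
  shows "xs \<in> lists (Obj C) \<Longrightarrow> map (fOb (fcomp C G F)) xs = map (fOb G) (map (fOb F) xs)"
    and "fs \<in> lists (Arr C) \<Longrightarrow> map (fAr (fcomp C G F)) fs = map (fAr G) (map (fAr F) fs)"
  using is_functorD[OF assms] by (auto simp: in_lists_conv_set)

lemma map_id_fctr [simp]:
  "xs \<in> lists (Obj C) \<Longrightarrow> map (fOb (id_fctr C)) xs = xs"
  "fs \<in> lists (Arr C) \<Longrightarrow> map (fAr (id_fctr C)) fs = fs"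
  by (auto simp: in_lists_conv_set intro: map_idI)

lemma is_oplaxD:
  assumes "is_oplax V"
  shows "category (ucat V)" "is_functor (list_cat (ucat V)) (ucat V) (tens V)"
    "is_nat (list3_cat (ucat V)) (ucat V) (flat_fctr V) (nested_fctr V) (splt V)"
    "is_nat (ucat V) (ucat V) (tens0 V) (id_fctr (ucat V)) (counit V)"
  using assms unfolding is_oplax_def Let_def by auto

lemma tensD [simp]:
  assumes "is_oplax V"
  shows "xs \<in> lists (Obj (ucat V)) \<Longrightarrow> fOb (tens V) xs \<in> Obj (ucat V)"
    and "fs \<in> lists (Arr (ucat V)) \<Longrightarrow> fAr (tens V) fs \<in> Arr (ucat V)"
    and "fs \<in> lists (Arr (ucat V)) \<Longrightarrow> Dom (ucat V) (fAr (tens V) fs) = fOb (tens V) (map (Dom (ucat V)) fs)"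
    and "fs \<in> lists (Arr (ucat V)) \<Longrightarrow> Cod (ucat V) (fAr (tens V) fs) = fOb (tens V) (map (Cod (ucat V)) fs)"
    and "xs \<in> lists (Obj (ucat V)) \<Longrightarrow>
      fAr (tens V) (map (Ident (ucat V)) xs) = Ident (ucat V) (fOb (tens V) xs)"
  using is_functorD[OF is_oplaxD(2)[OF assms]] by simp_all

lemma tens_Comp:
  assumes "is_oplax V" "gs \<in> lists (Arr (ucat V))" "fs \<in> lists (Arr (ucat V))"
    "map (Dom (ucat V)) gs = map (Cod (ucat V)) fs"
  shows "fAr (tens V) (map2 (Comp (ucat V)) gs fs) =
      Comp (ucat V) (fAr (tens V) gs) (fAr (tens V) fs)"
  using is_functorD(8)[OF is_oplaxD(2)[OF assms(1)], of gs fs] assms(2-) by simp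

lemma spltD [simp]:
  assumes V: "is_oplax V"
    and "xs \<in> lists (Obj (ucat V))" "ys \<in> lists (Obj (ucat V))" "zs \<in> lists (Obj (ucat V))"
  shows "splt V (xs, ys, zs) \<in> Arr (ucat V)"
    "Dom (ucat V) (splt V (xs, ys, zs)) = fOb (tens V) (xs @ ys @ zs)"
    "Cod (ucat V) (splt V (xs, ys, zs)) = fOb (tens V) (xs @ fOb (tens V) ys # zs)"
  using is_natD(4-6)[OF is_oplaxD(3)[OF V], of "(xs, ys, zs)"] assms
  by (simp_all add: list3_cat_def flat_fctr_def nested_fctr_def)

lemma counitD [simp]:
  assumes V: "is_oplax V" and "x \<in> Obj (ucat V)"
  shows "counit V x \<in> Arr (ucat V)" "Dom (ucat V) (counit V x) = fOb (tens V) [x]"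
    "Cod (ucat V) (counit V x) = x"
  using is_natD(4-6)[OF is_oplaxD(4)[OF V], of x] assms by (simp_all add: tens0_def)

lemma whiskD [simp]:
  assumes V: "is_oplax V"
    and "xs \<in> lists (Obj (ucat V))" "f \<in> Arr (ucat V)" "zs \<in> lists (Obj (ucat V))"
  shows "whisk V xs f zs \<in> Arr (ucat V)"
    "Dom (ucat V) (whisk V xs f zs) = fOb (tens V) (xs @ Dom (ucat V) f # zs)"
    "Cod (ucat V) (whisk V xs f zs) = fOb (tens V) (xs @ Cod (ucat V) f # zs)"
  using assms is_oplaxD(1)[OF V] by (simp_all add: whisk_def del: map_map)

lemma whisk_Ident:
  assumes V: "is_oplax V"
    and "xs \<in> lists (Obj (ucat V))" "y \<in> Obj (ucat V)" "zs \<in> lists (Obj (ucat V))"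
  shows "whisk V xs (Ident (ucat V) y) zs = Ident (ucat V) (fOb (tens V) (xs @ y # zs))"
  using assms is_oplaxD(1)[OF V] tensD(5)[OF V, of "xs @ y # zs"] by (simp add: whisk_def)

lemma whisk_Comp:
  assumes V: "is_oplax V"
    and "xs \<in> lists (Obj (ucat V))" "g \<in> Arr (ucat V)" "f \<in> Arr (ucat V)"
     "Dom (ucat V) g = Cod (ucat V) f" "zs \<in> lists (Obj (ucat V))"
  shows "whisk V xs (Comp (ucat V) g f) zs = Comp (ucat V) (whisk V xs g zs) (whisk V xs f zs)"
proof -
  let ?i = "map (Ident (ucat V))"
  show ?thesis
    using assms is_oplaxD(1)[OF V] tens_Comp[OF V, of "?i xs @ g # ?i zs" "?i xs @ f # ?i zs"]
    by (simp add: whisk_def del: map_map)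
qed

section \<open>Lax monoidal functors and their composition\<close>

lemma is_laxD:
  assumes "is_lax U V f"
  shows "is_oplax U" "is_oplax V" "is_functor (ucat U) (ucat V) (lfun f)"
    "is_nat (list_cat (ucat U)) (ucat V) (fcomp (list_cat (ucat U)) (tens V) (list_fctr (ucat U) (lfun f)))
       (fcomp (list_cat (ucat U)) (lfun f) (tens U)) (lstr f)"
    and "x \<in> Obj (ucat U) \<Longrightarrow>
      Comp (ucat V) (fAr (lfun f) (counit U x)) (lstr f [x]) = counit V (fOb (lfun f) x)"
    and "\<lbrakk>xs \<in> lists (Obj (ucat U)); ys \<in> lists (Obj (ucat U)); zs \<in> lists (Obj (ucat U))\<rbrakk> \<Longrightarrow>
      Comp (ucat V) (fAr (lfun f) (splt U (xs, ys, zs))) (lstr f (xs @ ys @ zs)) =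
      Comp (ucat V) (lstr f (xs @ fOb (tens U) ys # zs))
        (Comp (ucat V) (whisk V (map (fOb (lfun f)) xs) (lstr f ys) (map (fOb (lfun f)) zs))
          (splt V (map (fOb (lfun f)) xs, map (fOb (lfun f)) ys, map (fOb (lfun f)) zs)))"
  using assms unfolding is_lax_def Let_def by auto

lemma lstrD:
  assumes f: "is_lax U V f" and "xs \<in> lists (Obj (ucat U))"
  shows "lstr f xs \<in> Arr (ucat V)"
    "Dom (ucat V) (lstr f xs) = fOb (tens V) (map (fOb (lfun f)) xs)"
    "Cod (ucat V) (lstr f xs) = fOb (lfun f) (fOb (tens U) xs)"
  using is_natD(4-6)[OF is_laxD(4)[OF f], of xs] assms by simp_all

lemma lstr_naturality:
  assumes f: "is_lax U V f" and fs: "fs \<in> lists (Arr (ucat U))"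
    and "map (Dom (ucat U)) fs = xs" "map (Cod (ucat U)) fs = ys"
  shows "Comp (ucat V) (lstr f ys) (fAr (tens V) (map (fAr (lfun f)) fs)) =
    Comp (ucat V) (fAr (lfun f) (fAr (tens U) fs)) (lstr f xs)"
  using naturality[OF is_laxD(4)[OF f], of fs xs ys] assms by simp

text \<open>Naturality of \<open>lstr f\<close> at the list consisting of \<open>g\<close> padded
  with identities, which \<open>lfun f\<close> preserves.\<close>

lemma lstr_whisk:
  assumes f: "is_lax U V f" and g: "g \<in> Arr (ucat U)"
    and "xs \<in> lists (Obj (ucat U))" "zs \<in> lists (Obj (ucat U))"
    "Dom (ucat U) g = a" "Cod (ucat U) g = b"
  shows "Comp (ucat V) (lstr f (xs @ b # zs))
      (whisk V (map (fOb (lfun f)) xs) (fAr (lfun f) g) (map (fOb (lfun f)) zs)) =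
    Comp (ucat V) (fAr (lfun f) (whisk U xs g zs)) (lstr f (xs @ a # zs))"
  using assms is_laxD[OF f] functor_listD[OF is_laxD(3)[OF f]] is_oplaxD(1)[OF is_laxD(1)[OF f]]
    lstr_naturality[OF f, of "map (Ident (ucat U)) xs @ g # map (Ident (ucat U)) zs"]
  by (simp add: whisk_def del: map_map)

text \<open>The naturality clause is freed of \<open>list_cat\<close>, \<open>fcomp\<close> and
  \<open>list_fctr\<close>, which leaves equations in \<open>ucat V\<close> about plain
  lists.\<close>

lemma is_laxI:
  assumes "is_oplax U" "is_oplax V" "is_functor (ucat U) (ucat V) (lfun f)"
    and "lstr f \<in> extensional (lists (Obj (ucat U)))"
    and "\<And>xs. xs \<in> lists (Obj (ucat U)) \<Longrightarrow> lstr f xs \<in> Arr (ucat V) \<and>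
      Dom (ucat V) (lstr f xs) = fOb (tens V) (map (fOb (lfun f)) xs) \<and>
      Cod (ucat V) (lstr f xs) = fOb (lfun f) (fOb (tens U) xs)"
    and "\<And>fs. fs \<in> lists (Arr (ucat U)) \<Longrightarrow>
      Comp (ucat V) (lstr f (map (Cod (ucat U)) fs)) (fAr (tens V) (map (fAr (lfun f)) fs)) =
      Comp (ucat V) (fAr (lfun f) (fAr (tens U) fs)) (lstr f (map (Dom (ucat U)) fs))"
    and "\<And>x. x \<in> Obj (ucat U) \<Longrightarrow>
      Comp (ucat V) (fAr (lfun f) (counit U x)) (lstr f [x]) = counit V (fOb (lfun f) x)"
    and "\<And>xs ys zs. \<lbrakk>xs \<in> lists (Obj (ucat U)); ys \<in> lists (Obj (ucat U)); zs \<in> lists (Obj (ucat U))\<rbrakk> \<Longrightarrow>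
      Comp (ucat V) (fAr (lfun f) (splt U (xs, ys, zs))) (lstr f (xs @ ys @ zs)) =
      Comp (ucat V) (lstr f (xs @ fOb (tens U) ys # zs))
        (Comp (ucat V) (whisk V (map (fOb (lfun f)) xs) (lstr f ys) (map (fOb (lfun f)) zs))
          (splt V (map (fOb (lfun f)) xs, map (fOb (lfun f)) ys, map (fOb (lfun f)) zs)))"
  shows "is_lax U V f"
  unfolding is_lax_def Let_def
proof (intro conjI)
  note UV = is_oplaxD[OF assms(1)] is_oplaxD[OF assms(2)]
  show "is_nat (list_cat (ucat U)) (ucat V) (fcomp (list_cat (ucat U)) (tens V) (list_fctr (ucat U) (lfun f)))
       (fcomp (list_cat (ucat U)) (lfun f) (tens U)) (lstr f)"
    using assms(3) UV(2,6) assms(4-6)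
    by (intro is_natI is_functor_fcomp[OF is_functor_list_fctr] is_functor_fcomp)
      (auto simp: UV)
qed (use assms in auto)

lemma is_lax_id:
  assumes V: "is_oplax V"
  shows "is_lax V V (lax_id V)"
proof (rule is_laxI)
  note [simp] = V is_oplaxD(1)[OF V]
  fix xs ys zs
  assume "xs \<in> lists (Obj (ucat V))" "ys \<in> lists (Obj (ucat V))" "zs \<in> lists (Obj (ucat V))"
  then show "Comp (ucat V) (fAr (lfun (lax_id V)) (splt V (xs, ys, zs))) (lstr (lax_id V) (xs @ ys @ zs)) =
      Comp (ucat V) (lstr (lax_id V) (xs @ fOb (tens V) ys # zs))
        (Comp (ucat V) (whisk V (map (fOb (lfun (lax_id V))) xs) (lstr (lax_id V) ys)
           (map (fOb (lfun (lax_id V))) zs))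
          (splt V (map (fOb (lfun (lax_id V))) xs, map (fOb (lfun (lax_id V))) ys,
            map (fOb (lfun (lax_id V))) zs)))"
    by (simp add: lax_id_def whisk_Ident)
next
  show "lstr (lax_id V) \<in> extensional (lists (Obj (ucat V)))"
    by (auto simp: lax_id_def nt_id_def)
qed (use V is_oplaxD(1)[OF V] in \<open>auto simp: lax_id_def is_functor_id\<close>)

lemma lax_comp_simps:
  "lfun (lax_comp U W g f) = fcomp (ucat U) (lfun g) (lfun f)"
  "xs \<in> lists (Obj (ucat U)) \<Longrightarrow> lstr (lax_comp U W g f) xs =
     Comp (ucat W) (fAr (lfun g) (lstr f xs)) (lstr g (map (fOb (lfun f)) xs))"
  by (auto simp: lax_comp_def)

lemma is_lax_comp:
  assumes f: "is_lax U V f" and g: "is_lax V W g"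
  shows "is_lax U W (lax_comp U W g f)"
proof (rule is_laxI)
  note fD = is_laxD[OF f] and gD = is_laxD[OF g]
  note [simp] = fD(1,2) gD(2) is_oplaxD(1)[OF fD(1)] is_oplaxD(1)[OF fD(2)] is_oplaxD(1)[OF gD(2)]
    is_functorD[OF fD(3)] functor_listD[OF fD(3)] is_functorD[OF gD(3)] functor_listD[OF gD(3)]
    lstrD[OF f] lstrD[OF g] map_fcomp[OF fD(3)] lax_comp_simps
  note [simp del] = map_map
  let ?gf = "lax_comp U W g f"
  let ?F = "map (fOb (lfun f))" and ?G = "map (fOb (lfun g))" and ?C = "Comp (ucat W)"
    and ?Ff = "fAr (lfun f)" and ?Gf = "fAr (lfun g)"
  show "is_oplax U" "is_oplax W" "is_functor (ucat U) (ucat W) (lfun ?gf)"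
    using is_functor_fcomp[OF fD(3) gD(3)] by simp_all
  show "lstr ?gf \<in> extensional (lists (Obj (ucat U)))"
    by (simp add: lax_comp_def)
  show "lstr ?gf xs \<in> Arr (ucat W) \<and>
      Dom (ucat W) (lstr ?gf xs) = fOb (tens W) (map (fOb (lfun ?gf)) xs) \<and>
      Cod (ucat W) (lstr ?gf xs) = fOb (lfun ?gf) (fOb (tens U) xs)"
    if "xs \<in> lists (Obj (ucat U))" for xs
    using that by simp
  show "?C (lstr ?gf (map (Cod (ucat U)) fs)) (fAr (tens W) (map (fAr (lfun ?gf)) fs)) =
      ?C (fAr (lfun ?gf) (fAr (tens U) fs)) (lstr ?gf (map (Dom (ucat U)) fs))"
    if fs[simp]: "fs \<in> lists (Arr (ucat U))" for fs
  proof -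
    let ?c = "map (Cod (ucat U)) fs" and ?d = "map (Dom (ucat U)) fs"
    have "?C (lstr g (?F ?c)) (fAr (tens W) (map ?Gf (map ?Ff fs))) =
        ?C (?Gf (fAr (tens V) (map ?Ff fs))) (lstr g (?F ?d))"
      by (rule lstr_naturality[OF g]) auto
    moreover have "?C (?Gf (lstr f ?c)) (?C (?Gf (fAr (tens V) (map ?Ff fs))) (lstr g (?F ?d))) =
        ?C (?Gf (?Ff (fAr (tens U) fs))) (?C (?Gf (lstr f ?d)) (lstr g (?F ?d)))"
      by (rule comp_square)
        (use arg_cong[OF lstr_naturality[OF f fs refl refl], of ?Gf] in simp_all)
    ultimately show ?thesis by simp
  qed
  show "?C (fAr (lfun ?gf) (counit U x)) (lstr ?gf [x]) = counit W (fOb (lfun ?gf) x)"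
    if [simp]: "x \<in> Obj (ucat U)" for x
  proof -
    have "?C (?Gf (?Ff (counit U x))) (?C (?Gf (lstr f [x])) (lstr g [fOb (lfun f) x])) =
       ?C (?Gf (Comp (ucat V) (?Ff (counit U x)) (lstr f [x]))) (lstr g [fOb (lfun f) x])"
      by simp
    also have "\<dots> = counit W (fOb (lfun ?gf) x)"
      by (simp add: fD(5) gD(5))
    finally show ?thesis by simp
  qed
  fix xs ys zs
  assume [simp]: "xs \<in> lists (Obj (ucat U))" "ys \<in> lists (Obj (ucat U))" "zs \<in> lists (Obj (ucat U))"
  let ?n = "xs @ fOb (tens U) ys # zs" and ?fl = "xs @ ys @ zs"
  let ?w = "whisk V (?F xs) (lstr f ys) (?F zs)" and ?s = "splt V (?F xs, ?F ys, ?F zs)"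
  let ?s' = "splt W (?G (?F xs), ?G (?F ys), ?G (?F zs))"
  have "?C (?Gf (?Ff (splt U (xs, ys, zs)))) (?C (?Gf (lstr f ?fl)) (lstr g (?F ?fl))) =
      ?C (?Gf (Comp (ucat V) (?Ff (splt U (xs, ys, zs))) (lstr f ?fl))) (lstr g (?F ?fl))"
    by simp
  also have "\<dots> = ?C (?Gf (lstr f ?n)) (?C (?Gf ?w) (?C (?Gf ?s) (lstr g (?F ?fl))))"
    by (simp add: fD(6))
  \<comment> \<open>Coherence of \<open>f\<close> has been used under \<open>lfun g\<close>; the end
    of the composite is now one side of the coherence square of \<open>g\<close> at the image
    lists.\<close>
  also have "?C (?Gf ?s) (lstr g (?F ?fl)) =
      ?C (lstr g (?F xs @ fOb (tens V) (?F ys) # ?F zs))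
        (?C (whisk W (?G (?F xs)) (lstr g (?F ys)) (?G (?F zs))) ?s')"
    using gD(6)[of "?F xs" "?F ys" "?F zs"] by simp
  \<comment> \<open>\<open>?w\<close> is \<open>lstr f ys\<close> with identities on both sides, so
    naturality of \<open>lstr g\<close> moves the image of \<open>?w\<close> past it.\<close>
  also have "?C (?Gf ?w) \<dots> = ?C (lstr g (?F ?n))
      (?C (whisk W (?G (?F xs)) (?Gf (lstr f ys)) (?G (?F zs)))
        (?C (whisk W (?G (?F xs)) (lstr g (?F ys)) (?G (?F zs))) ?s'))"
    by (rule comp_square[OF sym]) (simp_all add: lstr_whisk[OF g])
  \<comment> \<open>Two whiskerings in the same position merge, and the merged middle entry is by
    definition the structure map of the composite at \<open>ys\<close>.\<close>
  also have "?C (whisk W (?G (?F xs)) (?Gf (lstr f ys)) (?G (?F zs)))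
        (?C (whisk W (?G (?F xs)) (lstr g (?F ys)) (?G (?F zs))) ?s') =
      ?C (whisk W (?G (?F xs)) (lstr ?gf ys) (?G (?F zs))) ?s'"
    by (simp add: whisk_Comp)
  finally show "?C (fAr (lfun ?gf) (splt U (xs, ys, zs))) (lstr ?gf (xs @ ys @ zs)) =
      ?C (lstr ?gf (xs @ fOb (tens U) ys # zs))
        (?C (whisk W (map (fOb (lfun ?gf)) xs) (lstr ?gf ys) (map (fOb (lfun ?gf)) zs))
          (splt W (map (fOb (lfun ?gf)) xs, map (fOb (lfun ?gf)) ys, map (fOb (lfun ?gf)) zs)))"
    by simp
qed

section \<open>Monoidal natural transformations and the laws of lax composition\<close>

lemma is_monoidal_natD:
  assumes "is_monoidal_nat U V f g t"
  shows "is_lax U V f" "is_lax U V g" "is_nat (ucat U) (ucat V) (lfun f) (lfun g) t"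
    and "xs \<in> lists (Obj (ucat U)) \<Longrightarrow>
      Comp (ucat V) (lstr g xs) (fAr (tens V) (map t xs)) =
      Comp (ucat V) (t (fOb (tens U) xs)) (lstr f xs)"
  using assms unfolding is_monoidal_nat_def by auto

lemma is_monoidal_natI:
  assumes "is_lax U V f" "is_lax U V g" "is_nat (ucat U) (ucat V) (lfun f) (lfun g) t"
    and "\<And>xs. xs \<in> lists (Obj (ucat U)) \<Longrightarrow>
      Comp (ucat V) (lstr g xs) (fAr (tens V) (map t xs)) =
      Comp (ucat V) (t (fOb (tens U) xs)) (lstr f xs)"
  shows "is_monoidal_nat U V f g t"
  using assms unfolding is_monoidal_nat_def by auto

lemma is_monoidal_nat_nt_id:
  assumes f: "is_lax U V f"
  shows "is_monoidal_nat U V f f (nt_id (ucat U) (ucat V) (lfun f))"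
proof (rule is_monoidal_natI)
  note fD = is_laxD[OF f]
  note [simp] = fD(1,2) is_oplaxD(1)[OF fD(1)] is_oplaxD(1)[OF fD(2)] lstrD[OF f]
    is_functorD[OF fD(3)] functor_listD[OF fD(3)]
  fix xs assume xs[simp]: "xs \<in> lists (Obj (ucat U))"
  have "map (nt_id (ucat U) (ucat V) (lfun f)) xs = map (Ident (ucat V)) (map (fOb (lfun f)) xs)"
    using xs by (auto simp: in_lists_conv_set)
  then show "Comp (ucat V) (lstr f xs) (fAr (tens V) (map (nt_id (ucat U) (ucat V) (lfun f)) xs)) =
      Comp (ucat V) (nt_id (ucat U) (ucat V) (lfun f) (fOb (tens U) xs)) (lstr f xs)"
    by (simp del: map_map)
qed (use f is_laxD[OF f] is_nat_nt_id in auto)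

lemma is_monoidal_nat_vcomp:
  assumes t: "is_monoidal_nat U V f g t" and s: "is_monoidal_nat U V g h s"
  shows "is_monoidal_nat U V f h (nt_vcomp (ucat U) (ucat V) s t)"
proof (rule is_monoidal_natI)
  note tD = is_monoidal_natD[OF t] and sD = is_monoidal_natD[OF s]
  note f = is_laxD[OF tD(1)] and g = is_laxD[OF tD(2)] and h = is_laxD[OF sD(2)]
  show "is_lax U V f" "is_lax U V h"
    "is_nat (ucat U) (ucat V) (lfun f) (lfun h) (nt_vcomp (ucat U) (ucat V) s t)"
    using tD sD is_nat_nt_vcomp[OF tD(3) sD(3)] by simp_all
  note [simp] = f(1,2) is_oplaxD(1)[OF f(1)] is_oplaxD(1)[OF f(2)]
    is_functorD[OF f(3)] functor_listD[OF f(3)] is_functorD[OF g(3)] functor_listD[OF g(3)]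
    is_functorD[OF h(3)] functor_listD[OF h(3)] lstrD[OF tD(1)] lstrD[OF tD(2)] lstrD[OF sD(2)]
    is_natD[OF tD(3)] is_natD[OF sD(3)] nat_listD[OF tD(3)] nat_listD[OF sD(3)]
  note [simp del] = map_map
  let ?C = "Comp (ucat V)" and ?T = "fAr (tens V)"
  fix xs assume xs[simp]: "xs \<in> lists (Obj (ucat U))"
  \<comment> \<open>Functoriality of the tensor is about entrywise composites, so the list of
    components is first written as a \<open>map2\<close>.\<close>
  have "map (nt_vcomp (ucat U) (ucat V) s t) xs = map2 ?C (map s xs) (map t xs)"
    using xs by (auto simp: in_lists_conv_set map2_map_map)
  then have "?T (map (nt_vcomp (ucat U) (ucat V) s t) xs) = ?C (?T (map s xs)) (?T (map t xs))"
    using tens_Comp[of V "map s xs" "map t xs"] by simp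
  moreover have "?C (lstr h xs) (?C (?T (map s xs)) (?T (map t xs))) =
      ?C (s (fOb (tens U) xs)) (?C (lstr g xs) (?T (map t xs)))"
    by (rule comp_square[OF sD(4)]) auto
  ultimately show "?C (lstr h xs) (?T (map (nt_vcomp (ucat U) (ucat V) s t) xs)) =
      ?C (nt_vcomp (ucat U) (ucat V) s t (fOb (tens U) xs)) (lstr f xs)"
    using tD(4)[OF xs] by simp
qed

lemma is_monoidal_nat_hcomp:
  assumes t: "is_monoidal_nat U V f f' t" and s: "is_monoidal_nat V W g g' s"
  shows "is_monoidal_nat U W (lax_comp U W g f) (lax_comp U W g' f')
    (nt_hcomp (ucat U) (ucat W) (lfun g) s (lfun f') t)"
proof (rule is_monoidal_natI)
  note tD = is_monoidal_natD[OF t] and sD = is_monoidal_natD[OF s]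
  note f = is_laxD[OF tD(1)] and f' = is_laxD[OF tD(2)] and g = is_laxD[OF sD(1)]
    and g' = is_laxD[OF sD(2)]
  let ?st = "nt_hcomp (ucat U) (ucat W) (lfun g) s (lfun f') t"
  show "is_lax U W (lax_comp U W g f)" "is_lax U W (lax_comp U W g' f')"
    by (fact is_lax_comp[OF tD(1) sD(1)] is_lax_comp[OF tD(2) sD(2)])+
  show "is_nat (ucat U) (ucat W) (lfun (lax_comp U W g f)) (lfun (lax_comp U W g' f')) ?st"
    using is_nat_nt_hcomp[OF tD(3) sD(3)] by (simp add: lax_comp_simps)
  note [simp] = f(1,2) g(2) is_oplaxD(1)[OF f(1)] is_oplaxD(1)[OF f(2)] is_oplaxD(1)[OF g(2)]
    is_functorD[OF f(3)] functor_listD[OF f(3)] is_functorD[OF f'(3)] functor_listD[OF f'(3)]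
    is_functorD[OF g(3)] functor_listD[OF g(3)] is_functorD[OF g'(3)] functor_listD[OF g'(3)]
    lstrD[OF tD(1)] lstrD[OF tD(2)] lstrD[OF sD(1)] lstrD[OF sD(2)]
    is_natD[OF tD(3)] is_natD[OF sD(3)] nat_listD[OF tD(3)] nat_listD[OF sD(3)] lax_comp_simps
  note [simp del] = map_map
  let ?C = "Comp (ucat W)" and ?T = "fAr (tens W)" and ?G = "fAr (lfun g)" and ?G' = "fAr (lfun g')"
  fix xs assume xs[simp]: "xs \<in> lists (Obj (ucat U))"
  let ?Fxs = "map (fOb (lfun f)) xs" and ?F'xs = "map (fOb (lfun f')) xs" and ?x = "fOb (tens U) xs"
  have "map ?st xs = map2 ?C (map s ?F'xs) (map ?G (map t xs))"
    using xs by (auto simp: in_lists_conv_set map2_map_map map_map)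
  then have "?T (map ?st xs) = ?C (?T (map s ?F'xs)) (?T (map ?G (map t xs)))"
    using tens_Comp[of W "map s ?F'xs" "map ?G (map t xs)"] by simp
  then have "?C (lstr (lax_comp U W g' f') xs) (?T (map ?st xs)) =
      ?C (?G' (lstr f' xs)) (?C (lstr g' ?F'xs) (?C (?T (map s ?F'xs)) (?T (map ?G (map t xs)))))"
    by simp
  \<comment> \<open>The chase uses in turn monoidality of \<open>s\<close> at the image list
    \<open>?F'xs\<close>, naturality of \<open>lstr g\<close> at \<open>map t xs\<close>, naturality
    of \<open>s\<close> at the arrow \<open>lstr f' xs\<close>, and \<open>lfun g\<close> applied to
    monoidality of \<open>t\<close>.\<close>
  also have "?C (lstr g' ?F'xs) (?C (?T (map s ?F'xs)) (?T (map ?G (map t xs)))) =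
      ?C (s (fOb (tens V) ?F'xs)) (?C (lstr g ?F'xs) (?T (map ?G (map t xs))))"
    by (rule comp_square[OF sD(4)]) auto
  also have "?C (lstr g ?F'xs) (?T (map ?G (map t xs))) = ?C (?G (fAr (tens V) (map t xs))) (lstr g ?Fxs)"
    by (rule lstr_naturality[OF sD(1)]) auto
  also have "?C (?G' (lstr f' xs)) (?C (s (fOb (tens V) ?F'xs)) \<dots>) =
      ?C (s (fOb (lfun f') ?x)) (?C (?G (lstr f' xs)) (?C (?G (fAr (tens V) (map t xs))) (lstr g ?Fxs)))"
    by (rule comp_square[OF naturality[OF sD(3), symmetric]]) auto
  also have "?C (?G (lstr f' xs)) (?C (?G (fAr (tens V) (map t xs))) (lstr g ?Fxs)) =
      ?C (?G (t ?x)) (?C (?G (lstr f xs)) (lstr g ?Fxs))"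
    by (rule comp_square) (use arg_cong[OF tD(4)[OF xs], of ?G] in simp_all)
  finally show "?C (lstr (lax_comp U W g' f') xs) (?T (map ?st xs)) =
      ?C (?st ?x) (lstr (lax_comp U W g f) xs)"
    by simp
qed

lemma laxdata_eqI:
  assumes f: "is_lax U V f" and g: "is_lax U V g" and "lfun f = lfun g"
    and "\<And>xs. xs \<in> lists (Obj (ucat U)) \<Longrightarrow> lstr f xs = lstr g xs"
  shows "f = g"
proof (rule laxdata.equality)
  show "lstr f = lstr g"
    using is_natD(3)[OF is_laxD(4)[OF f]] is_natD(3)[OF is_laxD(4)[OF g]] assms(4)
    by (intro extensionalityI[of _ "lists (Obj (ucat U))"]) simp_all
qed (use assms in auto)

lemma lax_comp_id:
  assumes f: "is_lax U V f"
  shows "lax_comp U V f (lax_id U) = f" "lax_comp U V (lax_id V) f = f"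
proof -
  note fD = is_laxD[OF f]
  note [simp] = fD(1,2) is_oplaxD(1)[OF fD(1)] is_oplaxD(1)[OF fD(2)] lstrD[OF f]
    is_functorD[OF fD(3)] functor_listD[OF fD(3)]
  have [simp]: "lfun (lax_id U) = id_fctr (ucat U)" "lfun (lax_id V) = id_fctr (ucat V)"
    by (simp_all add: lax_id_def)
  show "lax_comp U V f (lax_id U) = f"
    by (rule laxdata_eqI[OF is_lax_comp[OF is_lax_id f] f])
      (simp_all add: lax_comp_simps fcomp_id_right[OF fD(3)], simp add: lax_id_def)
  show "lax_comp U V (lax_id V) f = f"
    by (rule laxdata_eqI[OF is_lax_comp[OF f is_lax_id] f])
      (simp_all add: lax_comp_simps fcomp_id_left[OF fD(3)], simp add: lax_id_def)
qed

lemma lax_comp_assoc: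
  assumes f: "is_lax A B f" and g: "is_lax B C g" and h: "is_lax C D h"
  shows "lax_comp A D h (lax_comp A C g f) = lax_comp A D (lax_comp B D h g) f"
proof (rule laxdata_eqI)
  note fD = is_laxD[OF f] and gD = is_laxD[OF g] and hD = is_laxD[OF h]
  note [simp] = fD(1,2) gD(2) hD(2) is_oplaxD(1)[OF fD(1)] is_oplaxD(1)[OF fD(2)]
    is_oplaxD(1)[OF gD(2)] is_oplaxD(1)[OF hD(2)]
    is_functorD[OF fD(3)] functor_listD[OF fD(3)] is_functorD[OF gD(3)] functor_listD[OF gD(3)]
    is_functorD[OF hD(3)] functor_listD[OF hD(3)]
    lstrD[OF f] lstrD[OF g] lstrD[OF h] map_fcomp[OF fD(3)] lax_comp_simps
  show "lfun (lax_comp A D h (lax_comp A C g f)) = lfun (lax_comp A D (lax_comp B D h g) f)"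
    by (simp add: fcomp_assoc[OF fD(3)])
  show "lstr (lax_comp A D h (lax_comp A C g f)) xs = lstr (lax_comp A D (lax_comp B D h g) f) xs"
    if "xs \<in> lists (Obj (ucat A))" for xs
    using that by (simp del: map_map)
qed (fact is_lax_comp[OF is_lax_comp[OF f g] h] is_lax_comp[OF f is_lax_comp[OF g h]])+

lemma concrete_2cat_Oplax_lax:
  "concrete_2cat {V. is_oplax V} is_lax lax_id (\<lambda>U W g f. lax_comp U W g f) is_monoidal_nat ucat lfun"
  by standard (auto simp: is_laxD lax_comp_id lax_comp_assoc lax_comp_simps is_lax_id is_monoidal_natD
      is_monoidal_nat_nt_id lax_id_def[THEN arg_cong, of lfun]
    intro: is_lax_comp is_monoidal_nat_vcomp is_monoidal_nat_hcomp)

interpretation Oplax_lax: concrete_2cat "{V. is_oplax V}" is_lax lax_id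
  "\<lambda>U W g f. lax_comp U W g f" is_monoidal_nat ucat lfun
  by (rule concrete_2cat_Oplax_lax)

lemma Oplax_lax_eq: "Oplax_lax = Oplax_lax.cells"
  unfolding Oplax_lax_def Oplax_lax.cells_def by simp

section \<open>The 2-category of enriched categories\<close>

abbreviation opp_cat :: "('c, 'm) cat \<Rightarrow> ('c \<times> 'c, 'm \<times> 'm) cat" where
  "opp_cat B \<equiv> prod_cat (op_cat B) B"

text \<open>The first variable is contravariant. All endpoints and composites are expressed in
  \<open>B\<close> itself, which keeps \<open>op_cat\<close> and \<open>prod_cat\<close> out of
  later goals.\<close>

lemma opp_functorD:
  assumes F: "is_functor (opp_cat B) D F" and B: "category B"
  shows "\<lbrakk>x \<in> Obj B; y \<in> Obj B\<rbrakk> \<Longrightarrow> fOb F (x, y) \<in> Obj D"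
    and "\<lbrakk>f \<in> Arr B; g \<in> Arr B\<rbrakk> \<Longrightarrow> fAr F (f, g) \<in> Arr D"
    and "\<lbrakk>f \<in> Arr B; g \<in> Arr B\<rbrakk> \<Longrightarrow> Dom D (fAr F (f, g)) = fOb F (Cod B f, Dom B g)"
    and "\<lbrakk>f \<in> Arr B; g \<in> Arr B\<rbrakk> \<Longrightarrow> Cod D (fAr F (f, g)) = fOb F (Dom B f, Cod B g)"
    and "\<lbrakk>x \<in> Obj B; y \<in> Obj B\<rbrakk> \<Longrightarrow> fAr F (Ident B x, Ident B y) = Ident D (fOb F (x, y))"
    and "\<lbrakk>f \<in> Arr B; f' \<in> Arr B; g \<in> Arr B; g' \<in> Arr B; Dom B f = Cod B f'; Dom B g' = Cod B g\<rbrakk> \<Longrightarrow>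
      Comp D (fAr F (f', g')) (fAr F (f, g)) = fAr F (Comp B f f', Comp B g' g)"
  using is_functorD(3)[OF F, of "(x, y)"] is_functorD(4-6)[OF F, of "(f, g)"]
    is_functorD(7)[OF F, of "(x, y)"] is_functorD(8)[OF F, of "(f', g')" "(f, g)"] B
  by simp_all

lemma is_ecatD:
  assumes "is_ecat V C"
  shows "is_oplax V" "category (ecat C)" "is_functor (opp_cat (ecat C)) (ucat V) (ehom C)"
    "eunit C \<in> extensional (Obj (ecat C))"
    "ecomp C \<in> extensional (Obj (ecat C) \<times> Obj (ecat C) \<times> Obj (ecat C))"
  using assms unfolding is_ecat_def Let_def by auto

lemma eunitD:
  assumes "is_ecat V C" "x \<in> Obj (ecat C)"
  shows "eunit C x \<in> Arr (ucat V)" "Dom (ucat V) (eunit C x) = fOb (tens V) []"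
    "Cod (ucat V) (eunit C x) = fOb (ehom C) (x, x)"
  using assms unfolding is_ecat_def Let_def by (auto simp: Hom_def)

lemma ecompD:
  assumes "is_ecat V C" "x \<in> Obj (ecat C)" "y \<in> Obj (ecat C)" "z \<in> Obj (ecat C)"
  shows "ecomp C (x, y, z) \<in> Arr (ucat V)"
    "Dom (ucat V) (ecomp C (x, y, z)) = fOb (tens V) [fOb (ehom C) (y, z), fOb (ehom C) (x, y)]"
    "Cod (ucat V) (ecomp C (x, y, z)) = fOb (ehom C) (x, z)"
  using assms unfolding is_ecat_def Let_def by (auto simp: Hom_def)

lemma ehomD:
  assumes C: "is_ecat V C"
  shows "\<lbrakk>x \<in> Obj (ecat C); y \<in> Obj (ecat C)\<rbrakk> \<Longrightarrow> fOb (ehom C) (x, y) \<in> Obj (ucat V)"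
    and "\<lbrakk>f \<in> Arr (ecat C); g \<in> Arr (ecat C)\<rbrakk> \<Longrightarrow> fAr (ehom C) (f, g) \<in> Arr (ucat V)"
    and "\<lbrakk>f \<in> Arr (ecat C); g \<in> Arr (ecat C)\<rbrakk> \<Longrightarrow>
      Dom (ucat V) (fAr (ehom C) (f, g)) = fOb (ehom C) (Cod (ecat C) f, Dom (ecat C) g)"
    and "\<lbrakk>f \<in> Arr (ecat C); g \<in> Arr (ecat C)\<rbrakk> \<Longrightarrow>
      Cod (ucat V) (fAr (ehom C) (f, g)) = fOb (ehom C) (Dom (ecat C) f, Cod (ecat C) g)"
    and "\<lbrakk>x \<in> Obj (ecat C); y \<in> Obj (ecat C)\<rbrakk> \<Longrightarrow>
      fAr (ehom C) (Ident (ecat C) x, Ident (ecat C) y) = Ident (ucat V) (fOb (ehom C) (x, y))"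
  using opp_functorD[OF is_ecatD(3)[OF C] is_ecatD(2)[OF C]] by simp_all

lemma ehom_Comp:
  assumes C: "is_ecat V C"
    and "f \<in> Arr (ecat C)" "f' \<in> Arr (ecat C)" "g \<in> Arr (ecat C)" "g' \<in> Arr (ecat C)"
    and "Dom (ecat C) f = Cod (ecat C) f'" "Dom (ecat C) g' = Cod (ecat C) g"
  shows "Comp (ucat V) (fAr (ehom C) (f', g')) (fAr (ehom C) (f, g)) =
    fAr (ehom C) (Comp (ecat C) f f', Comp (ecat C) g' g)"
  using opp_functorD(6)[OF is_ecatD(3)[OF C] is_ecatD(2)[OF C]] assms(2-) by simp

lemma tens_Comp2:
  assumes "is_oplax V" "g \<in> Arr (ucat V)" "f \<in> Arr (ucat V)" "g' \<in> Arr (ucat V)" "f' \<in> Arr (ucat V)"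
    "Dom (ucat V) g = Cod (ucat V) f" "Dom (ucat V) g' = Cod (ucat V) f'"
  shows "Comp (ucat V) (fAr (tens V) [g, g']) (fAr (tens V) [f, f']) =
    fAr (tens V) [Comp (ucat V) g f, Comp (ucat V) g' f']"
  using tens_Comp[of V "[g, g']" "[f, f']"] assms by simp

section \<open>Enriched functors and enriched transformations\<close>

lemma is_efunD:
  assumes "is_efun V B C f"
  shows "is_ecat V B" "is_ecat V C" "is_functor (ecat B) (ecat C) (efun f)"
    "is_nat (opp_cat (ecat B)) (ucat V) (ehom B)
       (fcomp (opp_cat (ecat B)) (ehom C) (prod_fctr (op_cat (ecat B)) (ecat B) (efun f) (efun f)))
       (estr f)"
    and "x \<in> Obj (ecat B) \<Longrightarrow>
      Comp (ucat V) (estr f (x, x)) (eunit B x) = eunit C (fOb (efun f) x)"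
    and "\<lbrakk>x \<in> Obj (ecat B); y \<in> Obj (ecat B); z \<in> Obj (ecat B)\<rbrakk> \<Longrightarrow>
      Comp (ucat V) (estr f (x, z)) (ecomp B (x, y, z)) =
      Comp (ucat V) (ecomp C (fOb (efun f) x, fOb (efun f) y, fOb (efun f) z))
        (fAr (tens V) [estr f (y, z), estr f (x, y)])"
  using assms unfolding is_efun_def Let_def by auto

lemma estrD:
  assumes f: "is_efun V B C f" and xy: "x \<in> Obj (ecat B)" "y \<in> Obj (ecat B)"
  shows "estr f (x, y) \<in> Arr (ucat V)" "Dom (ucat V) (estr f (x, y)) = fOb (ehom B) (x, y)"
    "Cod (ucat V) (estr f (x, y)) = fOb (ehom C) (fOb (efun f) x, fOb (efun f) y)"
  using is_natD(4-6)[OF is_efunD(4)[OF f], of "(x, y)"] xy by simp_all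

lemma estr_naturality:
  assumes f: "is_efun V B C f" and "k \<in> Arr (ecat B)" "k' \<in> Arr (ecat B)"
    "Dom (ecat B) k = x'" "Cod (ecat B) k = x" "Dom (ecat B) k' = y" "Cod (ecat B) k' = y'"
  shows "Comp (ucat V) (estr f (x', y')) (fAr (ehom B) (k, k')) =
    Comp (ucat V) (fAr (ehom C) (fAr (efun f) k, fAr (efun f) k')) (estr f (x, y))"
  using naturality[OF is_efunD(4)[OF f], of "(k, k')" "(x, y)" "(x', y')"] assms by simp

lemma is_efunI:
  assumes "is_ecat V B" "is_ecat V C" "is_functor (ecat B) (ecat C) (efun f)"
    and "estr f \<in> extensional (Obj (ecat B) \<times> Obj (ecat B))"
    and "\<And>x y. \<lbrakk>x \<in> Obj (ecat B); y \<in> Obj (ecat B)\<rbrakk> \<Longrightarrow> estr f (x, y) \<in> Arr (ucat V) \<and>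
      Dom (ucat V) (estr f (x, y)) = fOb (ehom B) (x, y) \<and>
      Cod (ucat V) (estr f (x, y)) = fOb (ehom C) (fOb (efun f) x, fOb (efun f) y)"
    and "\<And>k k'. \<lbrakk>k \<in> Arr (ecat B); k' \<in> Arr (ecat B)\<rbrakk> \<Longrightarrow>
      Comp (ucat V) (estr f (Dom (ecat B) k, Cod (ecat B) k')) (fAr (ehom B) (k, k')) =
      Comp (ucat V) (fAr (ehom C) (fAr (efun f) k, fAr (efun f) k'))
        (estr f (Cod (ecat B) k, Dom (ecat B) k'))"
    and "\<And>x. x \<in> Obj (ecat B) \<Longrightarrow>
      Comp (ucat V) (estr f (x, x)) (eunit B x) = eunit C (fOb (efun f) x)"
    and "\<And>x y z. \<lbrakk>x \<in> Obj (ecat B); y \<in> Obj (ecat B); z \<in> Obj (ecat B)\<rbrakk> \<Longrightarrow>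
      Comp (ucat V) (estr f (x, z)) (ecomp B (x, y, z)) =
      Comp (ucat V) (ecomp C (fOb (efun f) x, fOb (efun f) y, fOb (efun f) z))
        (fAr (tens V) [estr f (y, z), estr f (x, y)])"
  shows "is_efun V B C f"
  unfolding is_efun_def Let_def
proof (intro conjI)
  show "is_nat (opp_cat (ecat B)) (ucat V) (ehom B)
       (fcomp (opp_cat (ecat B)) (ehom C) (prod_fctr (op_cat (ecat B)) (ecat B) (efun f) (efun f)))
       (estr f)"
    using assms(4-6) is_ecatD(2)[OF assms(1)]
    by (intro is_natI is_ecatD(3)[OF assms(1)] is_functor_fcomp[OF _ is_ecatD(3)[OF assms(2)]]
        is_functor_prod_fctr is_functor_op_cat assms(3)) auto
qed (use assms in auto)

lemma is_enatD:
  assumes "is_enat V B C f g t"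
  shows "is_efun V B C f" "is_efun V B C g" "is_nat (ecat B) (ecat C) (efun f) (efun g) t"
    and "\<lbrakk>x \<in> Obj (ecat B); y \<in> Obj (ecat B)\<rbrakk> \<Longrightarrow>
      Comp (ucat V) (fAr (ehom C) (Ident (ecat C) (fOb (efun f) x), t y)) (estr f (x, y)) =
      Comp (ucat V) (fAr (ehom C) (t x, Ident (ecat C) (fOb (efun g) y))) (estr g (x, y))"
  using assms unfolding is_enat_def by auto

lemma is_enatI:
  assumes "is_efun V B C f" "is_efun V B C g" "is_nat (ecat B) (ecat C) (efun f) (efun g) t"
    and "\<And>x y. \<lbrakk>x \<in> Obj (ecat B); y \<in> Obj (ecat B)\<rbrakk> \<Longrightarrow>
      Comp (ucat V) (fAr (ehom C) (Ident (ecat C) (fOb (efun f) x), t y)) (estr f (x, y)) =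
      Comp (ucat V) (fAr (ehom C) (t x, Ident (ecat C) (fOb (efun g) y))) (estr g (x, y))"
  shows "is_enat V B C f g t"
  using assms unfolding is_enat_def by auto

lemma efun_id_simps [simp]:
  "efun (efun_id V C) = id_fctr (ecat C)"
  "\<lbrakk>x \<in> Obj (ecat C); y \<in> Obj (ecat C)\<rbrakk> \<Longrightarrow>
     estr (efun_id V C) (x, y) = Ident (ucat V) (fOb (ehom C) (x, y))"
  by (simp_all add: efun_id_def)

lemma efun_comp_simps [simp]:
  "efun (efun_comp V A g f) = fcomp (ecat A) (efun g) (efun f)"
  "\<lbrakk>x \<in> Obj (ecat A); y \<in> Obj (ecat A)\<rbrakk> \<Longrightarrow> estr (efun_comp V A g f) (x, y) =
     Comp (ucat V) (estr g (fOb (efun f) x, fOb (efun f) y)) (estr f (x, y))"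
  by (simp_all add: efun_comp_def)

lemma is_efun_id:
  assumes C: "is_ecat V C"
  shows "is_efun V C C (efun_id V C)"
proof (rule is_efunI)
  note CD = is_ecatD[OF C]
  note [simp] = CD(1,2) is_oplaxD(1)[OF CD(1)] ehomD[OF C] ecompD[OF C] eunitD[OF C]
  show "is_functor (ecat C) (ecat C) (efun (efun_id V C))"
    by (simp add: is_functor_id)
  show "estr (efun_id V C) \<in> extensional (Obj (ecat C) \<times> Obj (ecat C))"
    by (auto simp: efun_id_def nt_id_def)
  fix x y z assume [simp]: "x \<in> Obj (ecat C)" "y \<in> Obj (ecat C)" "z \<in> Obj (ecat C)"
  show "Comp (ucat V) (estr (efun_id V C) (x, z)) (ecomp C (x, y, z)) =
      Comp (ucat V) (ecomp C (fOb (efun (efun_id V C)) x, fOb (efun (efun_id V C)) y,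
        fOb (efun (efun_id V C)) z))
        (fAr (tens V) [estr (efun_id V C) (y, z), estr (efun_id V C) (x, y)])"
    using tensD(5)[OF CD(1), of "[fOb (ehom C) (y, z), fOb (ehom C) (x, y)]"] by simp
qed (use C is_ecatD[OF C] is_oplaxD(1)[OF is_ecatD(1)[OF C]] in
    \<open>simp_all add: ehomD[OF C] ecompD[OF C] eunitD[OF C]\<close>)

lemma is_efun_comp:
  assumes f: "is_efun V A B f" and g: "is_efun V B C g"
  shows "is_efun V A C (efun_comp V A g f)"
proof (rule is_efunI)
  note fD = is_efunD[OF f] and gD = is_efunD[OF g]
  note V = is_ecatD(1)[OF fD(1)]
  note [simp] = V is_oplaxD(1)[OF V] is_ecatD(2)[OF fD(1)] is_ecatD(2)[OF fD(2)] is_ecatD(2)[OF gD(2)]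
    ehomD[OF fD(1)] ecompD[OF fD(1)] eunitD[OF fD(1)]
    ehomD[OF fD(2)] ecompD[OF fD(2)] eunitD[OF fD(2)]
    ehomD[OF gD(2)] ecompD[OF gD(2)] eunitD[OF gD(2)]
    is_functorD[OF fD(3)] is_functorD[OF gD(3)] estrD[OF f] estrD[OF g]
  let ?D = "Comp (ucat V)" and ?F = "fOb (efun f)" and ?Ff = "fAr (efun f)" and ?gf = "efun_comp V A g f"
  show "is_ecat V A" "is_ecat V C" by (fact fD gD)+
  show "is_functor (ecat A) (ecat C) (efun ?gf)"
    using is_functor_fcomp[OF fD(3) gD(3)] by simp
  show "estr ?gf \<in> extensional (Obj (ecat A) \<times> Obj (ecat A))"
    by (auto simp: efun_comp_def)
  show "?D (estr ?gf (Dom (ecat A) k, Cod (ecat A) k')) (fAr (ehom A) (k, k')) =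
      ?D (fAr (ehom C) (fAr (efun ?gf) k, fAr (efun ?gf) k')) (estr ?gf (Cod (ecat A) k, Dom (ecat A) k'))"
    if [simp]: "k \<in> Arr (ecat A)" "k' \<in> Arr (ecat A)" for k k'
  proof -
    let ?x' = "Dom (ecat A) k" and ?x = "Cod (ecat A) k" and ?y = "Dom (ecat A) k'" and ?y' = "Cod (ecat A) k'"
    have "?D (estr g (?F ?x', ?F ?y')) (?D (estr f (?x', ?y')) (fAr (ehom A) (k, k'))) =
        ?D (estr g (?F ?x', ?F ?y')) (?D (fAr (ehom B) (?Ff k, ?Ff k')) (estr f (?x, ?y)))"
      by (simp add: estr_naturality[OF f])
    also have "\<dots> = ?D (fAr (ehom C) (fAr (efun g) (?Ff k), fAr (efun g) (?Ff k')))
        (?D (estr g (?F ?x, ?F ?y)) (estr f (?x, ?y)))"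
      by (rule comp_square[OF estr_naturality[OF g]]) auto
    finally show ?thesis by simp
  qed
  show "?D (estr ?gf (x, x)) (eunit A x) = eunit C (fOb (efun ?gf) x)" if "x \<in> Obj (ecat A)" for x
    using that by (simp add: fD(5) gD(5))
  fix x y z assume [simp]: "x \<in> Obj (ecat A)" "y \<in> Obj (ecat A)" "z \<in> Obj (ecat A)"
  have "?D (estr g (?F x, ?F z)) (?D (ecomp B (?F x, ?F y, ?F z)) (fAr (tens V) [estr f (y, z), estr f (x, y)])) =
      ?D (ecomp C (fOb (efun g) (?F x), fOb (efun g) (?F y), fOb (efun g) (?F z)))
        (?D (fAr (tens V) [estr g (?F y, ?F z), estr g (?F x, ?F y)]) (fAr (tens V) [estr f (y, z), estr f (x, y)]))"
    by (rule comp_square[OF gD(6)]) auto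
  then show "?D (estr ?gf (x, z)) (ecomp A (x, y, z)) =
      ?D (ecomp C (fOb (efun ?gf) x, fOb (efun ?gf) y, fOb (efun ?gf) z))
        (fAr (tens V) [estr ?gf (y, z), estr ?gf (x, y)])"
    by (simp add: fD(6) tens_Comp2)
qed (use estrD[OF f] estrD[OF g] is_functorD[OF is_efunD(3)[OF f]] is_oplaxD(1)[OF is_ecatD(1)[OF is_efunD(1)[OF f]]] in simp)

lemma is_enat_nt_id:
  assumes f: "is_efun V B C f"
  shows "is_enat V B C f f (nt_id (ecat B) (ecat C) (efun f))"
  using f is_efunD[OF f] by (auto intro!: is_enatI is_nat_nt_id)

lemma is_enat_vcomp:
  assumes t: "is_enat V B C f g t" and s: "is_enat V B C g h s"
  shows "is_enat V B C f h (nt_vcomp (ecat B) (ecat C) s t)"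
proof (rule is_enatI)
  note tD = is_enatD[OF t] and sD = is_enatD[OF s]
  note f = is_efunD[OF tD(1)] and g = is_efunD[OF tD(2)] and h = is_efunD[OF sD(2)]
  show "is_efun V B C f" "is_efun V B C h"
    "is_nat (ecat B) (ecat C) (efun f) (efun h) (nt_vcomp (ecat B) (ecat C) s t)"
    by (fact tD sD is_nat_nt_vcomp[OF tD(3) sD(3)])+
  note V = is_ecatD(1)[OF f(1)]
  note [simp] = V is_oplaxD(1)[OF V] is_ecatD(2)[OF f(1)] is_ecatD(2)[OF f(2)]
    ehomD[OF f(1)] ehomD[OF f(2)] is_functorD[OF f(3)] is_functorD[OF g(3)] is_functorD[OF h(3)]
    estrD[OF tD(1)] estrD[OF tD(2)] estrD[OF sD(2)] is_natD[OF tD(3)] is_natD[OF sD(3)]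
  fix x y assume [simp]: "x \<in> Obj (ecat B)" "y \<in> Obj (ecat B)"
  let ?D = "Comp (ucat V)" and ?H = "fAr (ehom C)" and ?i = "Ident (ecat C)"
  let ?F = "fOb (efun f)" and ?G = "fOb (efun g)" and ?K = "fOb (efun h)"
  have "?D (?H (?i (?F x), Comp (ecat C) (s y) (t y))) (estr f (x, y)) =
      ?D (?H (?i (?F x), s y)) (?D (?H (?i (?F x), t y)) (estr f (x, y)))"
    \<comment> \<open>Associativity is reversed here: the two actions through \<open>?H\<close> must
      stand next to each other as a subterm before \<open>ehom_Comp\<close> can merge them.\<close>
    using ehom_Comp[OF f(2), of "?i (?F x)" "?i (?F x)" "t y" "s y"]
    by (simp flip: category_simps(11))
  also have "?D (?H (?i (?F x), t y)) (estr f (x, y)) = ?D (?H (t x, ?i (?G y))) (estr g (x, y))"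
    by (rule tD(4)) auto
  \<comment> \<open>Actions on different variables commute: by bifunctoriality both composites act
    by \<open>t x\<close> in the first variable and by \<open>s y\<close> in the second.\<close>
  also have "?D (?H (?i (?F x), s y)) \<dots> = ?D (?H (t x, ?i (?K y))) (?D (?H (?i (?G x), s y)) (estr g (x, y)))"
    by (rule comp_square) (auto simp: ehom_Comp[OF f(2)])
  also have "?D (?H (?i (?G x), s y)) (estr g (x, y)) = ?D (?H (s x, ?i (?K y))) (estr h (x, y))"
    by (rule sD(4)) auto
  also have "?D (?H (t x, ?i (?K y))) \<dots> = ?D (?H (Comp (ecat C) (s x) (t x), ?i (?K y))) (estr h (x, y))"
    using ehom_Comp[OF f(2), of "s x" "t x" "?i (?K y)" "?i (?K y)"]
    by (simp flip: category_simps(11))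
  finally show "?D (?H (?i (?F x), nt_vcomp (ecat B) (ecat C) s t y)) (estr f (x, y)) =
     ?D (?H (nt_vcomp (ecat B) (ecat C) s t x, ?i (?K y))) (estr h (x, y))"
    by simp
qed

lemma is_enat_hcomp:
  assumes t: "is_enat V A B f f' t" and s: "is_enat V B C g g' s"
  shows "is_enat V A C (efun_comp V A g f) (efun_comp V A g' f')
    (nt_hcomp (ecat A) (ecat C) (efun g) s (efun f') t)"
proof (rule is_enatI)
  note tD = is_enatD[OF t] and sD = is_enatD[OF s]
  note f = is_efunD[OF tD(1)] and f' = is_efunD[OF tD(2)] and g = is_efunD[OF sD(1)]
    and g' = is_efunD[OF sD(2)]
  let ?st = "nt_hcomp (ecat A) (ecat C) (efun g) s (efun f') t"
  show "is_efun V A C (efun_comp V A g f)" "is_efun V A C (efun_comp V A g' f')"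
    by (fact is_efun_comp[OF tD(1) sD(1)] is_efun_comp[OF tD(2) sD(2)])+
  show "is_nat (ecat A) (ecat C) (efun (efun_comp V A g f)) (efun (efun_comp V A g' f')) ?st"
    using is_nat_nt_hcomp[OF tD(3) sD(3)] by simp
  note V = is_ecatD(1)[OF f(1)]
  note [simp] = V is_oplaxD(1)[OF V] is_ecatD(2)[OF f(1)] is_ecatD(2)[OF f(2)] is_ecatD(2)[OF g(2)]
    ehomD[OF f(1)] ehomD[OF f(2)] ehomD[OF g(2)] is_functorD[OF f(3)] is_functorD[OF f'(3)]
    is_functorD[OF g(3)] is_functorD[OF g'(3)]
    estrD[OF tD(1)] estrD[OF tD(2)] estrD[OF sD(1)] estrD[OF sD(2)] is_natD[OF tD(3)] is_natD[OF sD(3)]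
  fix x y assume [simp]: "x \<in> Obj (ecat A)" "y \<in> Obj (ecat A)"
  let ?D = "Comp (ucat V)" and ?H = "fAr (ehom C)" and ?i = "Ident (ecat C)"
  let ?F = "fOb (efun f)" and ?F' = "fOb (efun f')" and ?G = "fOb (efun g)" and ?G' = "fOb (efun g')"
    and ?Gf = "fAr (efun g)"
  have "?D (?H (?i (?G (?F x)), Comp (ecat C) (s (?F' y)) (?Gf (t y))))
      (?D (estr g (?F x, ?F y)) (estr f (x, y))) =
    ?D (?H (?i (?G (?F x)), s (?F' y))) (?D (?H (?i (?G (?F x)), ?Gf (t y)))
      (?D (estr g (?F x, ?F y)) (estr f (x, y))))"
    using ehom_Comp[OF g(2), of "?i (?G (?F x))" "?i (?G (?F x))" "?Gf (t y)" "s (?F' y)"]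
    by (simp flip: category_simps(11))
  \<comment> \<open>Naturality of the structure map of \<open>g\<close> moves the action of
    \<open>t\<close> from \<open>C\<close> to \<open>B\<close>, where the condition on
    \<open>t\<close> turns it from the second variable into the first; the same naturality then
    brings it back to \<open>C\<close>.\<close>
  also have "?D (?H (?i (?G (?F x)), ?Gf (t y))) (?D (estr g (?F x, ?F y)) (estr f (x, y))) =
      ?D (estr g (?F x, ?F' y)) (?D (fAr (ehom B) (Ident (ecat B) (?F x), t y)) (estr f (x, y)))"
    by (rule comp_square) (auto simp: estr_naturality[OF sD(1)])
  also have "?D (fAr (ehom B) (Ident (ecat B) (?F x), t y)) (estr f (x, y)) =
      ?D (fAr (ehom B) (t x, Ident (ecat B) (?F' y))) (estr f' (x, y))"
    by (rule tD(4)) auto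
  also have "?D (estr g (?F x, ?F' y)) \<dots> = ?D (?H (?Gf (t x), ?i (?G (?F' y))))
      (?D (estr g (?F' x, ?F' y)) (estr f' (x, y)))"
    by (rule comp_square) (auto simp: estr_naturality[OF sD(1)])
  \<comment> \<open>Commuting the actions in the two variables exposes one side of the condition on
    \<open>s\<close> at the objects \<open>?F' x\<close> and \<open>?F' y\<close>.\<close>
  also have "?D (?H (?i (?G (?F x)), s (?F' y))) \<dots> = ?D (?H (?Gf (t x), ?i (?G' (?F' y))))
      (?D (?H (?i (?G (?F' x)), s (?F' y))) (?D (estr g (?F' x, ?F' y)) (estr f' (x, y))))"
    by (rule comp_square) (auto simp: ehom_Comp[OF g(2)])
  also have "?D (?H (?i (?G (?F' x)), s (?F' y))) (?D (estr g (?F' x, ?F' y)) (estr f' (x, y))) =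
      ?D (?H (s (?F' x), ?i (?G' (?F' y)))) (?D (estr g' (?F' x, ?F' y)) (estr f' (x, y)))"
    by (rule comp_square[OF sD(4)]) auto
  also have "?D (?H (?Gf (t x), ?i (?G' (?F' y)))) \<dots> =
      ?D (?H (Comp (ecat C) (s (?F' x)) (?Gf (t x)), ?i (?G' (?F' y))))
      (?D (estr g' (?F' x, ?F' y)) (estr f' (x, y)))"
    using ehom_Comp[OF g(2), of "s (?F' x)" "?Gf (t x)" "?i (?G' (?F' y))" "?i (?G' (?F' y))"]
    by (simp flip: category_simps(11))
  finally show "?D (?H (?i (fOb (efun (efun_comp V A g f)) x), ?st y)) (estr (efun_comp V A g f) (x, y)) =
     ?D (?H (?st x, ?i (fOb (efun (efun_comp V A g' f')) y))) (estr (efun_comp V A g' f') (x, y))"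
    by simp
qed

text \<open>Sources and targets may be different enriched categories as long as the sources have the
  same underlying category. Thus data can be compared before, say, a pushforward along a composite
  has been identified with an iterated one.\<close>

lemma efun_eqI:
  assumes f: "is_efun V B C f" and g: "is_efun V B' C' g" and "ecat B = ecat B'" "efun f = efun g"
    and "\<And>x y. \<lbrakk>x \<in> Obj (ecat B); y \<in> Obj (ecat B)\<rbrakk> \<Longrightarrow> estr f (x, y) = estr g (x, y)"
  shows "f = g"
proof (rule efun_data.equality)
  show "estr f = estr g"
    using is_natD(3)[OF is_efunD(4)[OF f]] is_natD(3)[OF is_efunD(4)[OF g]] assms(3,5)
    by (intro extensionalityI[of _ "Obj (ecat B) \<times> Obj (ecat B)"]) auto
qed (use assms in auto)

lemma efun_comp_id:
  assumes f: "is_efun V B C f"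
  shows "efun_comp V B f (efun_id V B) = f" "efun_comp V B (efun_id V C) f = f"
proof -
  note fD = is_efunD[OF f]
  note V = is_ecatD(1)[OF fD(1)]
  note [simp] = V is_oplaxD(1)[OF V] is_functorD[OF fD(3)] ehomD[OF fD(1)] ehomD[OF fD(2)] estrD[OF f]
  show "efun_comp V B f (efun_id V B) = f"
    by (rule efun_eqI[OF is_efun_comp[OF is_efun_id f] f]) (simp_all add: fD fcomp_id_right[OF fD(3)])
  show "efun_comp V B (efun_id V C) f = f"
    by (rule efun_eqI[OF is_efun_comp[OF f is_efun_id] f]) (simp_all add: fD fcomp_id_left[OF fD(3)])
qed

lemma efun_comp_assoc:
  assumes f: "is_efun V A B f" and g: "is_efun V B C g" and h: "is_efun V C D h"
  shows "efun_comp V A h (efun_comp V A g f) = efun_comp V A (efun_comp V B h g) f"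
proof (rule efun_eqI)
  note fD = is_efunD[OF f] and gD = is_efunD[OF g] and hD = is_efunD[OF h]
  note V = is_ecatD(1)[OF fD(1)]
  note [simp] = is_oplaxD(1)[OF V] is_functorD[OF fD(3)] is_functorD[OF gD(3)] is_functorD[OF hD(3)]
    estrD[OF f] estrD[OF g] estrD[OF h]
  show "efun (efun_comp V A h (efun_comp V A g f)) = efun (efun_comp V A (efun_comp V B h g) f)"
    by (simp add: fcomp_assoc[OF fD(3)])
  show "estr (efun_comp V A h (efun_comp V A g f)) (x, y) =
      estr (efun_comp V A (efun_comp V B h g) f) (x, y)"
    if "x \<in> Obj (ecat A)" "y \<in> Obj (ecat A)" for x y
    using that by simp
qed (fact refl is_efun_comp[OF is_efun_comp[OF f g] h] is_efun_comp[OF f is_efun_comp[OF g h]])+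

text \<open>\<open>is_ecat V C\<close> contains \<open>is_oplax V\<close>, so the construction is
  uniform in \<open>V\<close>: for a \<open>V\<close> that is not oplax monoidal the collection of
  objects is empty.\<close>

interpretation Cat_over: concrete_2cat "{C. is_ecat V C}" "is_efun V" "efun_id V"
  "\<lambda>A C g f. efun_comp V A g f" "is_enat V" ecat efun for V
  by standard (auto simp: is_efunD efun_comp_id efun_comp_assoc is_efun_id is_enatD is_enat_nt_id
    intro: is_efun_comp is_enat_vcomp is_enat_hcomp)

lemma Cat_over_eq: "Cat_over V = Cat_over.cells V"
  unfolding Cat_over_def Cat_over.cells_def by simp

section \<open>Pushforwards\<close>

text \<open>The three axioms with splittings are phrased through \<open>whisk\<close>, the form that
  \<open>lstr_whisk_splt\<close> handles; a pair of an arrow and an identity is such a whiskering.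
  \<open>is_ecatI\<close> goes back from this form to the definition.\<close>

lemma is_ecat_laws:
  assumes C: "is_ecat V C"
  shows "\<lbrakk>k \<in> Arr (ecat C); Dom (ecat C) k = x; Cod (ecat C) k = y\<rbrakk> \<Longrightarrow>
      Comp (ucat V) (fAr (ehom C) (Ident (ecat C) x, k)) (eunit C x) =
      Comp (ucat V) (fAr (ehom C) (k, Ident (ecat C) y)) (eunit C y)"
    and "\<lbrakk>k \<in> Arr (ecat C); Dom (ecat C) k = x'; Cod (ecat C) k = x;
        y \<in> Obj (ecat C); z \<in> Obj (ecat C)\<rbrakk> \<Longrightarrow>
      Comp (ucat V) (fAr (ehom C) (k, Ident (ecat C) z)) (ecomp C (x, y, z)) =
      Comp (ucat V) (ecomp C (x', y, z)) (fAr (tens V)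
        [Ident (ucat V) (fOb (ehom C) (y, z)), fAr (ehom C) (k, Ident (ecat C) y)])"
    and "\<lbrakk>k \<in> Arr (ecat C); Dom (ecat C) k = z; Cod (ecat C) k = z';
        x \<in> Obj (ecat C); y \<in> Obj (ecat C)\<rbrakk> \<Longrightarrow>
      Comp (ucat V) (fAr (ehom C) (Ident (ecat C) x, k)) (ecomp C (x, y, z)) =
      Comp (ucat V) (ecomp C (x, y, z')) (fAr (tens V)
        [fAr (ehom C) (Ident (ecat C) y, k), Ident (ucat V) (fOb (ehom C) (x, y))])"
    and "\<lbrakk>k \<in> Arr (ecat C); Dom (ecat C) k = y; Cod (ecat C) k = y';
        x \<in> Obj (ecat C); z \<in> Obj (ecat C)\<rbrakk> \<Longrightarrow>
      Comp (ucat V) (ecomp C (x, y, z)) (fAr (tens V)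
        [fAr (ehom C) (k, Ident (ecat C) z), Ident (ucat V) (fOb (ehom C) (x, y))]) =
      Comp (ucat V) (ecomp C (x, y', z)) (fAr (tens V)
        [Ident (ucat V) (fOb (ehom C) (y', z)), fAr (ehom C) (Ident (ecat C) x, k)])"
    and "\<lbrakk>w \<in> Obj (ecat C); x \<in> Obj (ecat C); y \<in> Obj (ecat C); z \<in> Obj (ecat C)\<rbrakk> \<Longrightarrow>
      Comp (ucat V) (ecomp C (w, x, z))
        (Comp (ucat V) (whisk V [] (ecomp C (x, y, z)) [fOb (ehom C) (w, x)])
          (splt V ([], [fOb (ehom C) (y, z), fOb (ehom C) (x, y)], [fOb (ehom C) (w, x)]))) =
      Comp (ucat V) (ecomp C (w, y, z))
        (Comp (ucat V) (whisk V [fOb (ehom C) (y, z)] (ecomp C (w, x, y)) [])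
          (splt V ([fOb (ehom C) (y, z)], [fOb (ehom C) (x, y), fOb (ehom C) (w, x)], [])))"
    and "\<lbrakk>x \<in> Obj (ecat C); y \<in> Obj (ecat C)\<rbrakk> \<Longrightarrow>
      Comp (ucat V) (ecomp C (x, y, y))
        (Comp (ucat V) (whisk V [] (eunit C y) [fOb (ehom C) (x, y)])
          (splt V ([], [], [fOb (ehom C) (x, y)]))) = counit V (fOb (ehom C) (x, y))"
    and "\<lbrakk>x \<in> Obj (ecat C); y \<in> Obj (ecat C)\<rbrakk> \<Longrightarrow>
      Comp (ucat V) (ecomp C (x, x, y))
        (Comp (ucat V) (whisk V [fOb (ehom C) (x, y)] (eunit C x) [])
          (splt V ([fOb (ehom C) (x, y)], [], []))) = counit V (fOb (ehom C) (x, y))"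
  using C category_simps(1,2)[of "ecat C" k]
  unfolding is_ecat_def Let_def by (auto simp: Hom_def whisk_def)

lemma is_ecatI:
  assumes "is_oplax V" "category (ecat C)" "is_functor (opp_cat (ecat C)) (ucat V) (ehom C)"
    "eunit C \<in> extensional (Obj (ecat C))"
    "ecomp C \<in> extensional (Obj (ecat C) \<times> Obj (ecat C) \<times> Obj (ecat C))"
    and "\<And>x. x \<in> Obj (ecat C) \<Longrightarrow> eunit C x \<in> Arr (ucat V) \<and>
      Dom (ucat V) (eunit C x) = fOb (tens V) [] \<and> Cod (ucat V) (eunit C x) = fOb (ehom C) (x, x)"
    and "\<And>x y z. \<lbrakk>x \<in> Obj (ecat C); y \<in> Obj (ecat C); z \<in> Obj (ecat C)\<rbrakk> \<Longrightarrow>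
      ecomp C (x, y, z) \<in> Arr (ucat V) \<and>
      Dom (ucat V) (ecomp C (x, y, z)) = fOb (tens V) [fOb (ehom C) (y, z), fOb (ehom C) (x, y)] \<and>
      Cod (ucat V) (ecomp C (x, y, z)) = fOb (ehom C) (x, z)"
    and "\<And>k x y. \<lbrakk>x \<in> Obj (ecat C); y \<in> Obj (ecat C);
        k \<in> Arr (ecat C); Dom (ecat C) k = x; Cod (ecat C) k = y\<rbrakk> \<Longrightarrow>
      Comp (ucat V) (fAr (ehom C) (Ident (ecat C) x, k)) (eunit C x) =
      Comp (ucat V) (fAr (ehom C) (k, Ident (ecat C) y)) (eunit C y)"
    and "\<And>k x x' y z. \<lbrakk>x \<in> Obj (ecat C); x' \<in> Obj (ecat C); y \<in> Obj (ecat C); z \<in> Obj (ecat C);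
        k \<in> Arr (ecat C); Dom (ecat C) k = x'; Cod (ecat C) k = x\<rbrakk> \<Longrightarrow>
      Comp (ucat V) (fAr (ehom C) (k, Ident (ecat C) z)) (ecomp C (x, y, z)) =
      Comp (ucat V) (ecomp C (x', y, z)) (fAr (tens V)
        [Ident (ucat V) (fOb (ehom C) (y, z)), fAr (ehom C) (k, Ident (ecat C) y)])"
    and "\<And>k x y z z'. \<lbrakk>x \<in> Obj (ecat C); y \<in> Obj (ecat C); z \<in> Obj (ecat C); z' \<in> Obj (ecat C);
        k \<in> Arr (ecat C); Dom (ecat C) k = z; Cod (ecat C) k = z'\<rbrakk> \<Longrightarrow>
      Comp (ucat V) (fAr (ehom C) (Ident (ecat C) x, k)) (ecomp C (x, y, z)) =
      Comp (ucat V) (ecomp C (x, y, z')) (fAr (tens V)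
        [fAr (ehom C) (Ident (ecat C) y, k), Ident (ucat V) (fOb (ehom C) (x, y))])"
    and "\<And>k x y y' z. \<lbrakk>x \<in> Obj (ecat C); y \<in> Obj (ecat C); y' \<in> Obj (ecat C); z \<in> Obj (ecat C);
        k \<in> Arr (ecat C); Dom (ecat C) k = y; Cod (ecat C) k = y'\<rbrakk> \<Longrightarrow>
      Comp (ucat V) (ecomp C (x, y, z)) (fAr (tens V)
        [fAr (ehom C) (k, Ident (ecat C) z), Ident (ucat V) (fOb (ehom C) (x, y))]) =
      Comp (ucat V) (ecomp C (x, y', z)) (fAr (tens V)
        [Ident (ucat V) (fOb (ehom C) (y', z)), fAr (ehom C) (Ident (ecat C) x, k)])"
    and "\<And>w x y z. \<lbrakk>w \<in> Obj (ecat C); x \<in> Obj (ecat C); y \<in> Obj (ecat C); z \<in> Obj (ecat C)\<rbrakk> \<Longrightarrow>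
      Comp (ucat V) (ecomp C (w, x, z))
        (Comp (ucat V) (whisk V [] (ecomp C (x, y, z)) [fOb (ehom C) (w, x)])
          (splt V ([], [fOb (ehom C) (y, z), fOb (ehom C) (x, y)], [fOb (ehom C) (w, x)]))) =
      Comp (ucat V) (ecomp C (w, y, z))
        (Comp (ucat V) (whisk V [fOb (ehom C) (y, z)] (ecomp C (w, x, y)) [])
          (splt V ([fOb (ehom C) (y, z)], [fOb (ehom C) (x, y), fOb (ehom C) (w, x)], [])))"
    and "\<And>x y. \<lbrakk>x \<in> Obj (ecat C); y \<in> Obj (ecat C)\<rbrakk> \<Longrightarrow>
      Comp (ucat V) (ecomp C (x, y, y))
        (Comp (ucat V) (whisk V [] (eunit C y) [fOb (ehom C) (x, y)])
          (splt V ([], [], [fOb (ehom C) (x, y)]))) = counit V (fOb (ehom C) (x, y))"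
    and "\<And>x y. \<lbrakk>x \<in> Obj (ecat C); y \<in> Obj (ecat C)\<rbrakk> \<Longrightarrow>
      Comp (ucat V) (ecomp C (x, x, y))
        (Comp (ucat V) (whisk V [fOb (ehom C) (x, y)] (eunit C x) [])
          (splt V ([fOb (ehom C) (x, y)], [], []))) = counit V (fOb (ehom C) (x, y))"
  shows "is_ecat V C"
  unfolding is_ecat_def Let_def
  using assms(1-7)
  by (auto simp: Hom_def intro!: assms(8-11) assms(12-14)[unfolded whisk_def, simplified])

lemma push_ecat_simps [simp]:
  "ecat (push_ecat f C) = ecat C"
  "ehom (push_ecat f C) = fcomp (opp_cat (ecat C)) (lfun (dat f)) (ehom C)"
  "x \<in> Obj (ecat C) \<Longrightarrow> eunit (push_ecat f C) x =
     Comp (ucat (trg f)) (fAr (lfun (dat f)) (eunit C x)) (lstr (dat f) [])"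
  "\<lbrakk>x \<in> Obj (ecat C); y \<in> Obj (ecat C); z \<in> Obj (ecat C)\<rbrakk> \<Longrightarrow> ecomp (push_ecat f C) (x, y, z) =
     Comp (ucat (trg f)) (fAr (lfun (dat f)) (ecomp C (x, y, z)))
       (lstr (dat f) [fOb (ehom C) (y, z), fOb (ehom C) (x, y)])"
  "eunit (push_ecat f C) \<in> extensional (Obj (ecat C))"
  "ecomp (push_ecat f C) \<in> extensional (Obj (ecat C) \<times> Obj (ecat C) \<times> Obj (ecat C))"
  by (simp_all add: push_ecat_def Let_def)

lemma lstr_naturality2:
  assumes f: "is_lax U V f" and "a \<in> Arr (ucat U)" "b \<in> Arr (ucat U)"
    "Dom (ucat U) a = x" "Dom (ucat U) b = y" "Cod (ucat U) a = x'" "Cod (ucat U) b = y'"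
  shows "Comp (ucat V) (lstr f [x', y']) (fAr (tens V) [fAr (lfun f) a, fAr (lfun f) b]) =
    Comp (ucat V) (fAr (lfun f) (fAr (tens U) [a, b])) (lstr f [x, y])"
  using lstr_naturality[OF f, of "[a, b]"] assms by simp

text \<open>For \<open>a\<close> out of a tensor,
  \<open>Comp (ucat V) (fAr (lfun f) a) (lstr f ys)\<close> is its pushforward: the new composition
  if \<open>ys\<close> has length two, the new unit if \<open>ys\<close> is empty. Whiskering splits
  it into two factors. Naturality of \<open>lstr f\<close> takes the factor with \<open>a\<close> to
  the front, and the coherence axiom absorbs the other one together with the splitting of
  \<open>V\<close>.\<close>

lemma lstr_whisk_splt:
  assumes f: "is_lax U V f"
    and xs: "xs \<in> lists (Obj (ucat U))" "ys \<in> lists (Obj (ucat U))" "zs \<in> lists (Obj (ucat U))"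
    and a: "a \<in> Arr (ucat U)" "Dom (ucat U) a = fOb (tens U) ys" "Cod (ucat U) a = b"
  shows "Comp (ucat V) (lstr f (xs @ b # zs))
      (Comp (ucat V) (whisk V (map (fOb (lfun f)) xs) (Comp (ucat V) (fAr (lfun f) a) (lstr f ys))
          (map (fOb (lfun f)) zs))
        (splt V (map (fOb (lfun f)) xs, map (fOb (lfun f)) ys, map (fOb (lfun f)) zs))) =
    Comp (ucat V) (fAr (lfun f) (Comp (ucat U) (whisk U xs a zs) (splt U (xs, ys, zs))))
      (lstr f (xs @ ys @ zs))"
proof -
  note fD = is_laxD[OF f]
  note [simp] = fD(1,2) is_oplaxD(1)[OF fD(1)] is_oplaxD(1)[OF fD(2)]
    is_functorD[OF fD(3)] functor_listD[OF fD(3)] lstrD[OF f] xs a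
  let ?D = "Comp (ucat V)" and ?F = "map (fOb (lfun f))" and ?Ff = "fAr (lfun f)"
  have b[simp]: "b \<in> Obj (ucat U)"
    using a category_simps(2)[of "ucat U" a] by simp
  have "?D (lstr f (xs @ b # zs)) (?D (whisk V (?F xs) (?Ff a) (?F zs))
      (?D (whisk V (?F xs) (lstr f ys) (?F zs)) (splt V (?F xs, ?F ys, ?F zs)))) =
    ?D (?Ff (whisk U xs a zs)) (?D (lstr f (xs @ fOb (tens U) ys # zs))
      (?D (whisk V (?F xs) (lstr f ys) (?F zs)) (splt V (?F xs, ?F ys, ?F zs))))"
    by (rule comp_square) (simp_all add: lstr_whisk[OF f])
  also have "\<dots> = ?D (?Ff (whisk U xs a zs)) (?D (?Ff (splt U (xs, ys, zs))) (lstr f (xs @ ys @ zs)))"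
    by (simp add: fD(6))
  finally show ?thesis by (simp add: whisk_Comp)
qed

lemma is_ecat_push_ecat:
  assumes l: "is_lax U V l" and C: "is_ecat U C"
  shows "is_ecat V (push_ecat (Cell U V l) C)"
proof (rule is_ecatI)
  note lD = is_laxD[OF l] and CD = is_ecatD[OF C]
  note [simp] = lD(1,2) is_oplaxD(1)[OF lD(1)] is_oplaxD(1)[OF lD(2)] CD(2)
    is_functorD[OF lD(3)] lstrD[OF l] ehomD[OF C] ecompD[OF C] eunitD[OF C]
  let ?P = "push_ecat (Cell U V l) C" and ?D = "Comp (ucat V)" and ?X = "Obj (ecat C)"
    and ?F = "fAr (lfun l)" and ?H = "fAr (ehom C)" and ?i = "Ident (ecat C)"
    and ?h = "\<lambda>x y. fOb (ehom C) (x, y)" and ?I = "Ident (ucat U)"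
  show "is_functor (opp_cat (ecat ?P)) (ucat V) (ehom ?P)"
    using is_functor_fcomp[OF CD(3) lD(3)] by simp
  show "?D (fAr (ehom ?P) (Ident (ecat ?P) x, k)) (eunit ?P x) =
      ?D (fAr (ehom ?P) (k, Ident (ecat ?P) y)) (eunit ?P y)"
    if "x \<in> Obj (ecat ?P)" "y \<in> Obj (ecat ?P)" "k \<in> Arr (ecat ?P)" "Dom (ecat ?P) k = x"
      "Cod (ecat ?P) k = y" for k x y
  proof -
    have [simp]: "x \<in> ?X" "y \<in> ?X" "k \<in> Arr (ecat C)" "Dom (ecat C) k = x" "Cod (ecat C) k = y"
      using that by simp_all
    have "?D (?F (?H (?i x, k))) (?D (?F (eunit C x)) (lstr l [])) =
        ?D (?F (?H (k, ?i y))) (?D (?F (eunit C y)) (lstr l []))"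
      by (rule comp_square) (use is_ecat_laws(1)[OF C, of k x y, THEN arg_cong, of ?F] in simp_all)
    then show ?thesis by simp
  qed
  show "?D (fAr (ehom ?P) (k, Ident (ecat ?P) z)) (ecomp ?P (x, y, z)) =
      ?D (ecomp ?P (x', y, z)) (fAr (tens V)
        [Ident (ucat V) (fOb (ehom ?P) (y, z)), fAr (ehom ?P) (k, Ident (ecat ?P) y)])"
    if "x \<in> Obj (ecat ?P)" "x' \<in> Obj (ecat ?P)" "y \<in> Obj (ecat ?P)" "z \<in> Obj (ecat ?P)"
        "k \<in> Arr (ecat ?P)" "Dom (ecat ?P) k = x'" "Cod (ecat ?P) k = x" for k x x' y z
  proof -
    have [simp]: "x \<in> ?X" "x' \<in> ?X" "y \<in> ?X" "z \<in> ?X" "k \<in> Arr (ecat C)"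
      "Dom (ecat C) k = x'" "Cod (ecat C) k = x"
      using that by simp_all
    have "?D (?F (?H (k, ?i z))) (?D (?F (ecomp C (x, y, z))) (lstr l [?h y z, ?h x y])) =
        ?D (?F (ecomp C (x', y, z))) (?D (?F (fAr (tens U) [?I (?h y z), ?H (k, ?i y)]))
          (lstr l [?h y z, ?h x y]))"
      by (rule comp_square) (use is_ecat_laws(2)[OF C, of k x' x y z, THEN arg_cong, of ?F] in simp_all)
    then show ?thesis
      \<comment> \<open>The new identity entry is the image of \<open>?I (?h y z)\<close>, so the
        whole pair is an image under \<open>lfun l\<close> and \<open>lstr l\<close> can be moved
        past it.\<close>
      using lstr_naturality2[OF l _ _ refl refl refl refl, of "?I (?h y z)" "?H (k, ?i y)"] by simp
  qed
  show "?D (fAr (ehom ?P) (Ident (ecat ?P) x, k)) (ecomp ?P (x, y, z)) =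
      ?D (ecomp ?P (x, y, z')) (fAr (tens V)
        [fAr (ehom ?P) (Ident (ecat ?P) y, k), Ident (ucat V) (fOb (ehom ?P) (x, y))])"
    if "x \<in> Obj (ecat ?P)" "y \<in> Obj (ecat ?P)" "z \<in> Obj (ecat ?P)" "z' \<in> Obj (ecat ?P)"
        "k \<in> Arr (ecat ?P)" "Dom (ecat ?P) k = z" "Cod (ecat ?P) k = z'" for k x y z z'
  proof -
    have [simp]: "x \<in> ?X" "y \<in> ?X" "z \<in> ?X" "z' \<in> ?X" "k \<in> Arr (ecat C)"
      "Dom (ecat C) k = z" "Cod (ecat C) k = z'"
      using that by simp_all
    have "?D (?F (?H (?i x, k))) (?D (?F (ecomp C (x, y, z))) (lstr l [?h y z, ?h x y])) =
        ?D (?F (ecomp C (x, y, z'))) (?D (?F (fAr (tens U) [?H (?i y, k), ?I (?h x y)]))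
          (lstr l [?h y z, ?h x y]))"
      by (rule comp_square) (use is_ecat_laws(3)[OF C, of k z z' x y, THEN arg_cong, of ?F] in simp_all)
    then show ?thesis
      using lstr_naturality2[OF l _ _ refl refl refl refl, of "?H (?i y, k)" "?I (?h x y)"] by simp
  qed
  show "?D (ecomp ?P (x, y, z)) (fAr (tens V)
        [fAr (ehom ?P) (k, Ident (ecat ?P) z), Ident (ucat V) (fOb (ehom ?P) (x, y))]) =
      ?D (ecomp ?P (x, y', z)) (fAr (tens V)
        [Ident (ucat V) (fOb (ehom ?P) (y', z)), fAr (ehom ?P) (Ident (ecat ?P) x, k)])"
    if "x \<in> Obj (ecat ?P)" "y \<in> Obj (ecat ?P)" "y' \<in> Obj (ecat ?P)" "z \<in> Obj (ecat ?P)"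
        "k \<in> Arr (ecat ?P)" "Dom (ecat ?P) k = y" "Cod (ecat ?P) k = y'" for k x y y' z
  proof -
    have [simp]: "x \<in> ?X" "y \<in> ?X" "y' \<in> ?X" "z \<in> ?X" "k \<in> Arr (ecat C)"
      "Dom (ecat C) k = y" "Cod (ecat C) k = y'"
      using that by simp_all
    have "?D (?F (ecomp C (x, y, z))) (?D (?F (fAr (tens U) [?H (k, ?i z), ?I (?h x y)]))
          (lstr l [?h y' z, ?h x y])) =
        ?D (?F (ecomp C (x, y', z))) (?D (?F (fAr (tens U) [?I (?h y' z), ?H (?i x, k)]))
          (lstr l [?h y' z, ?h x y]))"
      by (rule comp_square) (use is_ecat_laws(4)[OF C, of k y y' x z, THEN arg_cong, of ?F] in simp_all)
    then show ?thesis
      using lstr_naturality2[OF l _ _ refl refl refl refl, of "?H (k, ?i z)" "?I (?h x y)"]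
        lstr_naturality2[OF l _ _ refl refl refl refl, of "?I (?h y' z)" "?H (?i x, k)"] by simp
  qed
  show "?D (ecomp ?P (w, x, z))
        (?D (whisk V [] (ecomp ?P (x, y, z)) [fOb (ehom ?P) (w, x)])
          (splt V ([], [fOb (ehom ?P) (y, z), fOb (ehom ?P) (x, y)], [fOb (ehom ?P) (w, x)]))) =
      ?D (ecomp ?P (w, y, z))
        (?D (whisk V [fOb (ehom ?P) (y, z)] (ecomp ?P (w, x, y)) [])
          (splt V ([fOb (ehom ?P) (y, z)], [fOb (ehom ?P) (x, y), fOb (ehom ?P) (w, x)], [])))"
    if "w \<in> Obj (ecat ?P)" "x \<in> Obj (ecat ?P)" "y \<in> Obj (ecat ?P)" "z \<in> Obj (ecat ?P)" for w x y z
  proof -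
    have [simp]: "w \<in> ?X" "x \<in> ?X" "y \<in> ?X" "z \<in> ?X"
      using that by simp_all
    \<comment> \<open>Both sides of the pushed forward law end in the same \<open>lstr l\<close> at
      the flat list of three homs; what stands in front of it is the image of associativity in
      \<open>U\<close>.\<close>
    have "?D (?F (ecomp C (w, x, z))) (?D (?F (Comp (ucat U) (whisk U [] (ecomp C (x, y, z)) [?h w x])
        (splt U ([], [?h y z, ?h x y], [?h w x])))) (lstr l [?h y z, ?h x y, ?h w x])) =
      ?D (?F (ecomp C (w, y, z))) (?D (?F (Comp (ucat U) (whisk U [?h y z] (ecomp C (w, x, y)) [])
        (splt U ([?h y z], [?h x y, ?h w x], [])))) (lstr l [?h y z, ?h x y, ?h w x]))"
      by (rule comp_square) (use is_ecat_laws(5)[OF C, of w x y z, THEN arg_cong, of ?F] in simp_all)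
    then show ?thesis
      using lstr_whisk_splt[OF l _ _ _ _ _ refl, of "[]" "[?h y z, ?h x y]" "[?h w x]" "ecomp C (x, y, z)"]
        lstr_whisk_splt[OF l _ _ _ _ _ refl, of "[?h y z]" "[?h x y, ?h w x]" "[]" "ecomp C (w, x, y)"]
      by simp
  qed
  show "?D (ecomp ?P (x, y, y))
        (?D (whisk V [] (eunit ?P y) [fOb (ehom ?P) (x, y)])
          (splt V ([], [], [fOb (ehom ?P) (x, y)]))) = counit V (fOb (ehom ?P) (x, y))"
    if "x \<in> Obj (ecat ?P)" "y \<in> Obj (ecat ?P)" for x y
  proof -
    have [simp]: "x \<in> ?X" "y \<in> ?X" using that by simp_all
    have "?D (?F (ecomp C (x, y, y))) (?D (?F (Comp (ucat U) (whisk U [] (eunit C y) [?h x y])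
        (splt U ([], [], [?h x y])))) (lstr l [?h x y])) =
      ?D (?F (Comp (ucat U) (ecomp C (x, y, y)) (Comp (ucat U) (whisk U [] (eunit C y) [?h x y])
        (splt U ([], [], [?h x y]))))) (lstr l [?h x y])" by simp
    then show ?thesis
      \<comment> \<open>The case of an empty middle list. The unit law in \<open>U\<close> leaves
        the image of a counit after \<open>lstr l\<close> at a one-entry list, which
        \<open>lD(5)\<close> identifies with the counit of \<open>V\<close>.\<close>
      using lstr_whisk_splt[OF l _ _ _ _ _ refl, of "[]" "[]" "[?h x y]" "eunit C y"] lD(5)
      by (simp add: is_ecat_laws(6)[OF C])
  qed
  show "?D (ecomp ?P (x, x, y))
        (?D (whisk V [fOb (ehom ?P) (x, y)] (eunit ?P x) [])
          (splt V ([fOb (ehom ?P) (x, y)], [], []))) = counit V (fOb (ehom ?P) (x, y))"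
    if "x \<in> Obj (ecat ?P)" "y \<in> Obj (ecat ?P)" for x y
  proof -
    have [simp]: "x \<in> ?X" "y \<in> ?X" using that by simp_all
    have "?D (?F (ecomp C (x, x, y))) (?D (?F (Comp (ucat U) (whisk U [?h x y] (eunit C x) [])
        (splt U ([?h x y], [], [])))) (lstr l [?h x y])) =
      ?D (?F (Comp (ucat U) (ecomp C (x, x, y)) (Comp (ucat U) (whisk U [?h x y] (eunit C x) [])
        (splt U ([?h x y], [], []))))) (lstr l [?h x y])" by simp
    then show ?thesis
      using lstr_whisk_splt[OF l _ _ _ _ _ refl, of "[?h x y]" "[]" "[]" "eunit C x"] lD(5)
      by (simp add: is_ecat_laws(7)[OF C])
  qed
qed (use is_laxD[OF l] is_ecatD[OF C] is_oplaxD(1)[OF is_laxD(1)[OF l]]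
  is_oplaxD(1)[OF is_laxD(2)[OF l]] is_functorD[OF is_laxD(3)[OF l]] in
  \<open>simp_all add: lstrD[OF l] ehomD[OF C] ecompD[OF C] eunitD[OF C]\<close>)

section \<open>Pushforward of enriched functors and transformations along a lax monoidal
  functor\<close>

definition push_efun_data :: "('o, 'a, 'o, 'a) laxdata \<Rightarrow> ('c, 'm, 'o, 'a) ecat
    \<Rightarrow> ('c, 'm, 'c, 'm, 'a) efun_data \<Rightarrow> ('c, 'm, 'c, 'm, 'a) efun_data" where
  "push_efun_data l A e =
    \<lparr>efun = efun e, estr = compose (Obj (ecat A) \<times> Obj (ecat A)) (fAr (lfun l)) (estr e)\<rparr>"

lemma push_efun_data_simps [simp]:
  "efun (push_efun_data l A e) = efun e"
  "\<lbrakk>x \<in> Obj (ecat A); y \<in> Obj (ecat A)\<rbrakk> \<Longrightarrow>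
     estr (push_efun_data l A e) (x, y) = fAr (lfun l) (estr e (x, y))"
  "estr (push_efun_data l A e) \<in> extensional (Obj (ecat A) \<times> Obj (ecat A))"
  by (simp_all add: push_efun_data_def compose_def)

lemma is_efun_push_efun:
  assumes l: "is_lax U V l" and e: "is_efun U A B e"
  shows "is_efun V (push_ecat (Cell U V l) A) (push_ecat (Cell U V l) B) (push_efun_data l A e)"
proof (rule is_efunI)
  note lD = is_laxD[OF l] and eD = is_efunD[OF e]
  note [simp] = lD(1,2) is_oplaxD(1)[OF lD(1)] is_oplaxD(1)[OF lD(2)]
    is_ecatD(2)[OF eD(1)] is_ecatD(2)[OF eD(2)]
    is_functorD[OF lD(3)] is_functorD[OF eD(3)] lstrD[OF l] estrD[OF e]
    ehomD[OF eD(1)] ecompD[OF eD(1)] eunitD[OF eD(1)]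
    ehomD[OF eD(2)] ecompD[OF eD(2)] eunitD[OF eD(2)]
  let ?p = "push_ecat (Cell U V l)" and ?q = "push_efun_data l A e" and ?D = "Comp (ucat V)"
    and ?X = "Obj (ecat A)" and ?F = "fAr (lfun l)"
  show "is_ecat V (?p A)" "is_ecat V (?p B)"
    using is_ecat_push_ecat[OF l] eD by auto
  show "is_functor (ecat (?p A)) (ecat (?p B)) (efun ?q)"
    using eD(3) by simp
  show "estr ?q \<in> extensional (Obj (ecat (?p A)) \<times> Obj (ecat (?p A)))"
    by simp
  show "estr ?q (x, y) \<in> Arr (ucat V) \<and> Dom (ucat V) (estr ?q (x, y)) = fOb (ehom (?p A)) (x, y) \<and>
      Cod (ucat V) (estr ?q (x, y)) = fOb (ehom (?p B)) (fOb (efun ?q) x, fOb (efun ?q) y)"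
    if "x \<in> Obj (ecat (?p A))" "y \<in> Obj (ecat (?p A))" for x y
    using that by simp
  show "?D (estr ?q (Dom (ecat (?p A)) k, Cod (ecat (?p A)) k')) (fAr (ehom (?p A)) (k, k')) =
      ?D (fAr (ehom (?p B)) (fAr (efun ?q) k, fAr (efun ?q) k'))
        (estr ?q (Cod (ecat (?p A)) k, Dom (ecat (?p A)) k'))"
    if "k \<in> Arr (ecat (?p A))" "k' \<in> Arr (ecat (?p A))" for k k'
    using that estr_naturality[OF e _ _ refl refl refl refl, of k k', THEN arg_cong, of ?F] by simp
  show "?D (estr ?q (x, x)) (eunit (?p A) x) = eunit (?p B) (fOb (efun ?q) x)"
    if "x \<in> Obj (ecat (?p A))" for x
  proof -
    have [simp]: "x \<in> ?X" using that by simp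
    have "?D (?F (estr e (x, x))) (?D (?F (eunit A x)) (lstr l [])) =
        ?D (?F (Comp (ucat U) (estr e (x, x)) (eunit A x))) (lstr l [])"
      by simp
    then show ?thesis by (simp add: eD(5))
  qed
  show "?D (estr ?q (x, z)) (ecomp (?p A) (x, y, z)) =
      ?D (ecomp (?p B) (fOb (efun ?q) x, fOb (efun ?q) y, fOb (efun ?q) z))
        (fAr (tens V) [estr ?q (y, z), estr ?q (x, y)])"
    if "x \<in> Obj (ecat (?p A))" "y \<in> Obj (ecat (?p A))" "z \<in> Obj (ecat (?p A))" for x y z
  proof -
    have [simp]: "x \<in> ?X" "y \<in> ?X" "z \<in> ?X" using that by simp_all
    let ?l = "lstr l [fOb (ehom A) (y, z), fOb (ehom A) (x, y)]"
    have "?D (?F (estr e (x, z))) (?D (?F (ecomp A (x, y, z))) ?l) =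
        ?D (?F (Comp (ucat U) (estr e (x, z)) (ecomp A (x, y, z)))) ?l"
      by simp
    then show ?thesis
      using lstr_naturality2[OF l _ _ refl refl refl refl, of "estr e (y, z)" "estr e (x, y)"]
      by (simp add: eD(6))
  qed
qed

lemma is_enat_push_enat:
  assumes l: "is_lax U V l" and t: "is_enat U A B e e' t"
  shows "is_enat V (push_ecat (Cell U V l) A) (push_ecat (Cell U V l) B)
    (push_efun_data l A e) (push_efun_data l A e') t"
proof (rule is_enatI)
  note lD = is_laxD[OF l] and tD = is_enatD[OF t]
  note e = is_efunD[OF tD(1)] and e' = is_efunD[OF tD(2)]
  let ?p = "push_ecat (Cell U V l)" and ?q = "push_efun_data l A e" and ?q' = "push_efun_data l A e'"
    and ?D = "Comp (ucat V)" and ?F = "fAr (lfun l)"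
  show "is_efun V (?p A) (?p B) ?q" "is_efun V (?p A) (?p B) ?q'"
    by (fact is_efun_push_efun[OF l tD(1)] is_efun_push_efun[OF l tD(2)])+
  show "is_nat (ecat (?p A)) (ecat (?p B)) (efun ?q) (efun ?q') t"
    using tD(3) by simp
  note [simp] = lD(1,2) is_oplaxD(1)[OF lD(1)] is_oplaxD(1)[OF lD(2)]
    is_ecatD(2)[OF e(1)] is_ecatD(2)[OF e(2)]
    is_functorD[OF lD(3)] is_functorD[OF e(3)] is_functorD[OF e'(3)] estrD[OF tD(1)] estrD[OF tD(2)]
    is_natD[OF tD(3)] ehomD[OF e(1)] ehomD[OF e(2)]
  fix x y assume "x \<in> Obj (ecat (?p A))" "y \<in> Obj (ecat (?p A))"
  then show "?D (fAr (ehom (?p B)) (Ident (ecat (?p B)) (fOb (efun ?q) x), t y)) (estr ?q (x, y)) =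
      ?D (fAr (ehom (?p B)) (t x, Ident (ecat (?p B)) (fOb (efun ?q') y))) (estr ?q' (x, y))"
    using tD(4)[of x y, THEN arg_cong, of ?F] by simp
qed

lemma push_efun_data_id:
  assumes l: "is_lax U V l" and A: "is_ecat U A"
  shows "push_efun_data l A (efun_id U A) = efun_id V (push_ecat (Cell U V l) A)"
proof (rule efun_eqI[OF is_efun_push_efun[OF l is_efun_id[OF A]] is_efun_id[OF is_ecat_push_ecat[OF l A]]])
  note [simp] = is_functorD[OF is_laxD(3)[OF l]] ehomD[OF A]
  show "estr (push_efun_data l A (efun_id U A)) (x, y) = estr (efun_id V (push_ecat (Cell U V l) A)) (x, y)"
    if "x \<in> Obj (ecat (push_ecat (Cell U V l) A))" "y \<in> Obj (ecat (push_ecat (Cell U V l) A))" for x y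
    using that by simp
qed simp_all

lemma push_efun_data_comp:
  assumes l: "is_lax U V l" and e: "is_efun U A B e" and e': "is_efun U B C e'"
  shows "push_efun_data l A (efun_comp U A e' e) =
    efun_comp V (push_ecat (Cell U V l) A) (push_efun_data l B e') (push_efun_data l A e)"
proof (rule efun_eqI[OF is_efun_push_efun[OF l is_efun_comp[OF e e']]
      is_efun_comp[OF is_efun_push_efun[OF l e] is_efun_push_efun[OF l e']]])
  note [simp] = is_functorD[OF is_laxD(3)[OF l]] is_functorD[OF is_efunD(3)[OF e]]
    estrD[OF e] estrD[OF e']
  let ?p = "push_ecat (Cell U V l)"
  show "estr (push_efun_data l A (efun_comp U A e' e)) (x, y) =
      estr (efun_comp V (?p A) (push_efun_data l B e') (push_efun_data l A e)) (x, y)"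
    if "x \<in> Obj (ecat (?p A))" "y \<in> Obj (ecat (?p A))" for x y
    using that by simp
qed simp_all

text \<open>Pushing forward changes structure maps but neither underlying functors nor families, so
  \<open>\<phi>2\<close> returns its family and its laws are immediate.
  \<open>push_efun_data\<close> is what remains of \<open>push_efun\<close> when the endpoints are
  stripped off, as \<open>\<phi>1\<close> requires.\<close>

lemma concrete_2functor_push:
  assumes l: "is_lax U V l"
  shows "concrete_2functor {C. is_ecat U C} (is_efun U) (efun_id U) (\<lambda>A C g f. efun_comp U A g f)
      (is_enat U) ecat efun
    {C. is_ecat V C} (is_efun V) (efun_id V) (\<lambda>A C g f. efun_comp V A g f) (is_enat V) ecat efun
    (push_ecat (Cell U V l)) (\<lambda>A B e. push_efun_data l A e) (\<lambda>A B e e' t. t)"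
proof (intro concrete_2functor.intro concrete_2functor_axioms.intro Cat_over.concrete_2cat_axioms;
    (elim CollectE)?)
qed (simp_all add: is_ecat_push_ecat[OF l] is_efun_push_efun[OF l] is_enat_push_enat[OF l]
    push_efun_data_id[OF l] push_efun_data_comp[OF l])

lemma push_cell_simps:
  "push_efun (Cell U V l) (Cell A B e) =
    Cell (push_ecat (Cell U V l) A) (push_ecat (Cell U V l) B) (push_efun_data l A e)"
  "push_enat (Cell U V l) (Cell F G t) = Cell (push_efun (Cell U V l) F) (push_efun (Cell U V l) G) t"
  by (simp_all add: push_efun_def push_enat_def push_efun_data_def)

text \<open>Meant to be read from right to left, as the left side recurs on the right:
  \<open>is_2functor_cells\<close> asks for a cell with data \<open>dat (push_lax _)\<close>, and
  this folds it into \<open>push_lax\<close>. \<open>push_nat_cell\<close> does the same for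
  2-cells.\<close>

lemma push_lax_cell:
  "push_lax (Cell U V l) = Cell (Cat_over U) (Cat_over V) (dat (push_lax (Cell U V l)))"
  by (simp add: push_lax_def)

lemma push_lax_simps:
  "A \<in> Obj (C1 (Cat_over U)) \<Longrightarrow> F0 (dat (push_lax (Cell U V l))) A = push_ecat (Cell U V l) A"
  "F \<in> Arr (C1 (Cat_over U)) \<Longrightarrow> F1 (dat (push_lax (Cell U V l))) F = push_efun (Cell U V l) F"
  "a \<in> Arr (C2 (Cat_over U)) \<Longrightarrow> F2 (dat (push_lax (Cell U V l))) a = push_enat (Cell U V l) a"
  by (simp_all add: push_lax_def)

lemma push_lax_extensional:
  "F0 (dat (push_lax (Cell U V l))) \<in> extensional (Obj (C1 (Cat_over U)))"
  "F1 (dat (push_lax (Cell U V l))) \<in> extensional (Arr (C1 (Cat_over U)))"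
  "F2 (dat (push_lax (Cell U V l))) \<in> extensional (Arr (C2 (Cat_over U)))"
  by (simp_all add: push_lax_def)

lemma is_2functor_push_lax:
  assumes l: "is_lax U V l"
  shows "is_2functor (Cat_over U) (Cat_over V) (dat (push_lax (Cell U V l)))"
  using push_lax_extensional[of U V l] unfolding Cat_over_eq
  by (intro concrete_2functor.is_2functor_cells[OF concrete_2functor_push[OF l]])
    (simp_all add: push_lax_simps Cat_over_eq push_cell_simps)

section \<open>The 2-natural transformation induced by a monoidal transformation\<close>

definition component_data :: "('o \<Rightarrow> 'a) \<Rightarrow> ('c, 'm, 'o, 'a) ecat
    \<Rightarrow> ('c, 'm, 'c, 'm, 'a) efun_data" where
  "component_data t C =
    \<lparr>efun = id_fctr (ecat C), estr = compose (Obj (ecat C) \<times> Obj (ecat C)) t (fOb (ehom C))\<rparr>"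

lemma component_data_simps [simp]:
  "efun (component_data t C) = id_fctr (ecat C)"
  "\<lbrakk>x \<in> Obj (ecat C); y \<in> Obj (ecat C)\<rbrakk> \<Longrightarrow>
     estr (component_data t C) (x, y) = t (fOb (ehom C) (x, y))"
  "estr (component_data t C) \<in> extensional (Obj (ecat C) \<times> Obj (ecat C))"
  by (simp_all add: component_data_def compose_def)

lemma is_efun_component:
  assumes t: "is_monoidal_nat U V f g t" and C: "is_ecat U C"
  shows "is_efun V (push_ecat (Cell U V f) C) (push_ecat (Cell U V g) C) (component_data t C)"
proof (rule is_efunI)
  note tD = is_monoidal_natD[OF t]
  note f = is_laxD[OF tD(1)] and g = is_laxD[OF tD(2)] and CD = is_ecatD[OF C]
  note [simp] = f(1,2) is_oplaxD(1)[OF f(1)] is_oplaxD(1)[OF f(2)] CD(2)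
    is_functorD[OF f(3)] is_functorD[OF g(3)] lstrD[OF tD(1)] lstrD[OF tD(2)] is_natD[OF tD(3)]
    ehomD[OF C] ecompD[OF C] eunitD[OF C]
  let ?p = "push_ecat (Cell U V f) C" and ?q = "push_ecat (Cell U V g) C"
    and ?c = "component_data t C" and ?D = "Comp (ucat V)" and ?h = "\<lambda>x y. fOb (ehom C) (x, y)"
    and ?F = "fAr (lfun f)" and ?G = "fAr (lfun g)"
  show "is_ecat V ?p" "is_ecat V ?q"
    by (fact is_ecat_push_ecat[OF tD(1) C] is_ecat_push_ecat[OF tD(2) C])+
  show "is_functor (ecat ?p) (ecat ?q) (efun ?c)"
    by (simp add: is_functor_id)
  show "estr ?c \<in> extensional (Obj (ecat ?p) \<times> Obj (ecat ?p))"
    by simp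
  show "estr ?c (x, y) \<in> Arr (ucat V) \<and> Dom (ucat V) (estr ?c (x, y)) = fOb (ehom ?p) (x, y) \<and>
      Cod (ucat V) (estr ?c (x, y)) = fOb (ehom ?q) (fOb (efun ?c) x, fOb (efun ?c) y)"
    if "x \<in> Obj (ecat ?p)" "y \<in> Obj (ecat ?p)" for x y
    using that by simp
  show "?D (estr ?c (Dom (ecat ?p) k, Cod (ecat ?p) k')) (fAr (ehom ?p) (k, k')) =
      ?D (fAr (ehom ?q) (fAr (efun ?c) k, fAr (efun ?c) k'))
        (estr ?c (Cod (ecat ?p) k, Dom (ecat ?p) k'))"
    if "k \<in> Arr (ecat ?p)" "k' \<in> Arr (ecat ?p)" for k k'
    using that naturality[OF tD(3) _ refl refl, of "fAr (ehom C) (k, k')"] by simp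
  show "?D (estr ?c (x, x)) (eunit ?p x) = eunit ?q (fOb (efun ?c) x)"
    if "x \<in> Obj (ecat ?p)" for x
  proof -
    have [simp]: "x \<in> Obj (ecat C)" using that by simp
    have "?D (t (?h x x)) (?D (?F (eunit C x)) (lstr f [])) =
        ?D (?G (eunit C x)) (?D (t (fOb (tens U) [])) (lstr f []))"
      by (rule comp_square[OF naturality[OF tD(3)]]) simp_all
    \<comment> \<open>Monoidality at the empty list: the tensor of no arrows is an identity, which
      leaves the equation between the unit maps \<open>lstr f []\<close> and
      \<open>lstr g []\<close>.\<close>
    also have "?D (t (fOb (tens U) [])) (lstr f []) = lstr g []"
      using tD(4)[of "[]"] tensD(5)[OF f(2), of "[]"] by simp
    finally show ?thesis by simp
  qed
  show "?D (estr ?c (x, z)) (ecomp ?p (x, y, z)) =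
      ?D (ecomp ?q (fOb (efun ?c) x, fOb (efun ?c) y, fOb (efun ?c) z))
        (fAr (tens V) [estr ?c (y, z), estr ?c (x, y)])"
    if "x \<in> Obj (ecat ?p)" "y \<in> Obj (ecat ?p)" "z \<in> Obj (ecat ?p)" for x y z
  proof -
    have [simp]: "x \<in> Obj (ecat C)" "y \<in> Obj (ecat C)" "z \<in> Obj (ecat C)" using that by simp_all
    let ?hs = "[?h y z, ?h x y]"
    \<comment> \<open>Naturality of \<open>t\<close> at the composition map of \<open>C\<close>;
      monoidality at the list \<open>?hs\<close> does the rest.\<close>
    have "?D (t (?h x z)) (?D (?F (ecomp C (x, y, z))) (lstr f ?hs)) =
        ?D (?G (ecomp C (x, y, z))) (?D (t (fOb (tens U) ?hs)) (lstr f ?hs))"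
      by (rule comp_square[OF naturality[OF tD(3)]]) simp_all
    then show ?thesis
      using tD(4)[of ?hs] by simp
  qed
qed

lemma push_nat_cell:
  "push_nat (Cell F G t) = Cell (push_lax F) (push_lax G) (dat (push_nat (Cell F G t)))"
  by (simp add: push_nat_def)

lemma push_nat_simps:
  "A \<in> Obj (C1 (Cat_over U)) \<Longrightarrow> dat (push_nat (Cell (Cell U V f) (Cell U V g) t)) A =
     Cell (push_ecat (Cell U V f) A) (push_ecat (Cell U V g) A) (component_data t A)"
  "dat (push_nat (Cell (Cell U V f) (Cell U V g) t)) \<in> extensional (Obj (C1 (Cat_over U)))"
  by (simp_all add: push_nat_def push_component_def component_data_def)

text \<open>Components lie over identity functors, so both underlying functors are that of
  \<open>e\<close>. On structure maps the equation is naturality of \<open>t\<close> at the arrow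
  \<open>estr e (x, y)\<close> of \<open>U\<close>.\<close>

lemma component_naturality:
  assumes t: "is_monoidal_nat U V f g t" and e: "is_efun U A B e"
  shows "efun_comp V (push_ecat (Cell U V f) A) (component_data t B) (push_efun_data f A e) =
    efun_comp V (push_ecat (Cell U V f) A) (push_efun_data g A e) (component_data t A)"
proof -
  note tD = is_monoidal_natD[OF t] and eD = is_efunD[OF e]
  note [simp] = is_natD[OF tD(3)] is_functorD[OF eD(3)] ehomD[OF eD(1)] estrD[OF e]
  show ?thesis
  proof (rule efun_eqI[OF is_efun_comp[OF is_efun_push_efun[OF tD(1) e] is_efun_component[OF t eD(2)]]
      is_efun_comp[OF is_efun_component[OF t eD(1)] is_efun_push_efun[OF tD(2) e]]])
    show "estr (efun_comp V (push_ecat (Cell U V f) A) (component_data t B) (push_efun_data f A e)) (x, y) =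
      estr (efun_comp V (push_ecat (Cell U V f) A) (push_efun_data g A e) (component_data t A)) (x, y)"
      if "x \<in> Obj (ecat (push_ecat (Cell U V f) A))" "y \<in> Obj (ecat (push_ecat (Cell U V f) A))" for x y
      using that naturality[OF tD(3), of "estr e (x, y)"] by simp
  qed (simp_all add: fcomp_id_left[OF eD(3)] fcomp_id_right[OF eD(3)])
qed

lemma is_2nat_push_nat:
  assumes t: "is_monoidal_nat U V f g t"
  shows "is_2nat (Cat_over U) (Cat_over V) (dat (push_lax (Cell U V f))) (dat (push_lax (Cell U V g)))
    (dat (push_nat (Cell (Cell U V f) (Cell U V g) t)))"
proof (rule is_2natI)
  note tD = is_monoidal_natD[OF t]
  note f = is_laxD[OF tD(1)] and g = is_laxD[OF tD(2)]
  let ?f = "dat (push_lax (Cell U V f))" and ?g = "dat (push_lax (Cell U V g))"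
    and ?t = "dat (push_nat (Cell (Cell U V f) (Cell U V g) t))"
  note pf = is_efun_push_efun[OF tD(1)] and pg = is_efun_push_efun[OF tD(2)]
    and c = is_efun_component[OF t]
  note [simp] = push_lax_simps push_cell_simps push_nat_simps F01_def F02_def
  show fun2: "is_2functor (Cat_over U) (Cat_over V) ?f" "is_2functor (Cat_over U) (Cat_over V) ?g"
    by (fact is_2functor_push_lax[OF tD(1)] is_2functor_push_lax[OF tD(2)])+
  show "is_nat (C1 (Cat_over U)) (C1 (Cat_over V)) (F01 ?f) (F01 ?g) ?t"
  proof (rule is_natI)
    show "is_functor (C1 (Cat_over U)) (C1 (Cat_over V)) (F01 ?f)"
      "is_functor (C1 (Cat_over U)) (C1 (Cat_over V)) (F01 ?g)"
      by (fact is_2functorD(3)[OF fun2(1)] is_2functorD(3)[OF fun2(2)])+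
    show "?t A \<in> Arr (C1 (Cat_over V)) \<and> Dom (C1 (Cat_over V)) (?t A) = fOb (F01 ?f) A \<and>
        Cod (C1 (Cat_over V)) (?t A) = fOb (F01 ?g) A" if "A \<in> Obj (C1 (Cat_over U))" for A
      using that c[of A] by (auto simp: Cat_over_eq)
    fix F assume F: "F \<in> Arr (C1 (Cat_over U))"
    then obtain A B e where e: "F = Cell A B e" "is_efun U A B e"
      unfolding Cat_over_eq by (rule Cat_over.Arr1_cellsE)
    note eD = is_efunD[OF e(2)]
    show "Comp (C1 (Cat_over V)) (?t (Cod (C1 (Cat_over U)) F)) (fAr (F01 ?f) F) =
        Comp (C1 (Cat_over V)) (fAr (F01 ?g) F) (?t (Dom (C1 (Cat_over U)) F))"
      using F e(2) eD(1,2) pf[OF e(2)] pg[OF e(2)] c[OF eD(1)] c[OF eD(2)] component_naturality[OF t e(2)]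
      unfolding e(1) by (simp add: Cat_over_eq)
  qed simp
  fix a assume a: "a \<in> Arr (C2 (Cat_over U))"
  then obtain A B e e' s where s: "a = Cell (Cell A B e) (Cell A B e') s" "is_enat U A B e e' s"
    unfolding Cat_over_eq by (rule Cat_over.Arr2_cellsE)
  note sD = is_enatD[OF s(2)]
  note e = is_efunD[OF sD(1)] and e' = is_efunD[OF sD(2)]
  note qf = is_enat_push_enat[OF tD(1) s(2)] and qg = is_enat_push_enat[OF tD(2) s(2)]
  note cA = c[OF e(1)] and cB = c[OF e(2)]
  note iA = is_enat_nt_id[OF cA] and iB = is_enat_nt_id[OF cB]
  \<comment> \<open>Since components lie over identity functors, whiskering with them on either side
    returns the family \<open>s\<close>. The condition on 2-cells thus only compares endpoints, and
    these agree by \<open>component_naturality\<close>.\<close>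
  have *: "nt_hcomp (ecat A) (ecat B) (id_fctr (ecat B)) (nt_id (ecat B) (ecat B) (id_fctr (ecat B))) (efun e') s =
      nt_hcomp (ecat A) (ecat B) (efun e) s (id_fctr (ecat A)) (nt_id (ecat A) (ecat A) (id_fctr (ecat A)))"
    by (simp only: nt_hcomp_id[OF sD(3)])
  show "Comp (horiz (Cat_over V)) (Ident (C2 (Cat_over V)) (?t (Cod (horiz (Cat_over U)) a))) (fAr (F02 ?f) a) =
      Comp (horiz (Cat_over V)) (fAr (F02 ?g) a) (Ident (C2 (Cat_over V)) (?t (Dom (horiz (Cat_over U)) a)))"
    using a s(2) e(1,2) qf qg cA cB iA iB component_naturality[OF t sD(1)] component_naturality[OF t sD(2)] *
    unfolding s(1) by (simp add: Cat_over_eq)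
qed

section \<open>The enrichment 2-functor\<close>

lemma ecat_eqI:
  assumes C: "is_ecat V C" and C': "is_ecat V C'" and "ecat C = ecat C'" "ehom C = ehom C'"
    and "\<And>x. x \<in> Obj (ecat C) \<Longrightarrow> eunit C x = eunit C' x"
    and "\<And>x y z. \<lbrakk>x \<in> Obj (ecat C); y \<in> Obj (ecat C); z \<in> Obj (ecat C)\<rbrakk> \<Longrightarrow>
      ecomp C (x, y, z) = ecomp C' (x, y, z)"
  shows "C = C'"
proof (rule ecat.equality)
  show "eunit C = eunit C'"
    using is_ecatD(4)[OF C] is_ecatD(4)[OF C'] assms(3,5)
    by (intro extensionalityI[of _ "Obj (ecat C)"]) auto
  show "ecomp C = ecomp C'"
    using is_ecatD(5)[OF C] is_ecatD(5)[OF C'] assms(3,6)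
    by (intro extensionalityI[of _ "Obj (ecat C) \<times> Obj (ecat C) \<times> Obj (ecat C)"]) auto
qed (use assms in auto)

section \<open>Pushing forward along identities and composites\<close>

lemma lax_id_simps [simp]:
  "lfun (lax_id V) = id_fctr (ucat V)"
  "xs \<in> lists (Obj (ucat V)) \<Longrightarrow> lstr (lax_id V) xs = Ident (ucat V) (fOb (tens V) xs)"
  by (simp_all add: lax_id_def)

lemma push_ecat_lax_id:
  assumes C: "is_ecat V C"
  shows "push_ecat (Cell V V (lax_id V)) C = C"
proof -
  note CD = is_ecatD[OF C]
  note [simp] = CD(1,2) is_oplaxD(1)[OF CD(1)] ehomD[OF C] ecompD[OF C] eunitD[OF C]
  show ?thesis
    by (rule ecat_eqI[OF is_ecat_push_ecat[OF is_lax_id[OF CD(1)] C] C])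
      (simp_all add: fcomp_id_left[OF CD(3)])
qed

text \<open>Equality is strict because the structure map of the composite is defined as the image of
  \<open>lstr f\<close> under \<open>g\<close>, preceded by \<open>lstr g\<close>: both units are
  the same composite of three arrows once \<open>lfun g\<close> is distributed and brackets are
  moved, and likewise both compositions. The homs agree by \<open>fcomp_assoc\<close>.\<close>

lemma push_ecat_lax_comp:
  assumes f: "is_lax U V f" and g: "is_lax V W g" and C: "is_ecat U C"
  shows "push_ecat (Cell U W (lax_comp U W g f)) C = push_ecat (Cell V W g) (push_ecat (Cell U V f) C)"
proof -
  note fD = is_laxD[OF f] and gD = is_laxD[OF g] and CD = is_ecatD[OF C]
  note [simp] = fD(1,2) gD(2) is_oplaxD(1)[OF fD(1)] is_oplaxD(1)[OF fD(2)] is_oplaxD(1)[OF gD(2)]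
    is_functorD[OF fD(3)] is_functorD[OF gD(3)] lstrD[OF f] lstrD[OF g] lax_comp_simps
    CD(2) ehomD[OF C] ecompD[OF C] eunitD[OF C]
  show ?thesis
    by (rule ecat_eqI[OF is_ecat_push_ecat[OF is_lax_comp[OF f g] C]
        is_ecat_push_ecat[OF g is_ecat_push_ecat[OF f C]]])
      (simp_all add: fcomp_assoc[OF CD(3)])
qed

lemma push_efun_data_lax_id:
  assumes e: "is_efun V A B e"
  shows "push_efun_data (lax_id V) A e = e"
  using is_efunD(1,2)[OF e] is_ecatD(1)[OF is_efunD(1)[OF e]]
  by (intro efun_eqI[OF is_efun_push_efun[OF is_lax_id e] e]) (simp_all add: estrD[OF e])

lemma push_efun_data_lax_comp:
  assumes f: "is_lax U V f" and g: "is_lax V W g" and e: "is_efun U A B e"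
  shows "push_efun_data (lax_comp U W g f) A e =
    push_efun_data g (push_ecat (Cell U V f) A) (push_efun_data f A e)"
  by (rule efun_eqI[OF is_efun_push_efun[OF is_lax_comp[OF f g] e]
        is_efun_push_efun[OF g is_efun_push_efun[OF f e]]])
    (simp_all add: estrD[OF e] lax_comp_simps)

lemma fctr2_eq_on:
  fixes F G :: "('o, 'f, 't, 'p, 'g, 'u) fctr2"
  assumes "F0 F \<in> extensional X0" "F0 G \<in> extensional X0" "F1 F \<in> extensional X1" "F1 G \<in> extensional X1"
    "F2 F \<in> extensional X2" "F2 G \<in> extensional X2"
    and "\<And>x. x \<in> X0 \<Longrightarrow> F0 F x = F0 G x" "\<And>f. f \<in> X1 \<Longrightarrow> F1 F f = F1 G f"
    "\<And>a. a \<in> X2 \<Longrightarrow> F2 F a = F2 G a"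
  shows "F = G"
  using assms by (intro fctr2.equality) (auto intro: extensionalityI)

lemma Cat_over_cells:
  "Obj (C1 (Cat_over V)) = {C. is_ecat V C}"
  "Cell A B e \<in> Arr (C1 (Cat_over V)) \<longleftrightarrow> is_efun V A B e"
  "Cell (Cell A B e) (Cell A B e') s \<in> Arr (C2 (Cat_over V)) \<longleftrightarrow> is_enat V A B e e' s"
  by (simp_all add: Cat_over_eq)

lemma Cat_over_cellE:
  "\<lbrakk>F \<in> Arr (C1 (Cat_over V)); \<And>A B e. \<lbrakk>F = Cell A B e; is_efun V A B e\<rbrakk> \<Longrightarrow> thesis\<rbrakk> \<Longrightarrow> thesis"
  "\<lbrakk>a \<in> Arr (C2 (Cat_over V)); \<And>A B e e' s. \<lbrakk>a = Cell (Cell A B e) (Cell A B e') s;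
     is_enat V A B e e' s\<rbrakk> \<Longrightarrow> thesis\<rbrakk> \<Longrightarrow> thesis"
  unfolding Cat_over_eq by (auto elim: Cat_over.Arr1_cellsE Cat_over.Arr2_cellsE)

lemma push_lax_lax_id:
  assumes V: "is_oplax V"
  shows "dat (push_lax (Cell V V (lax_id V))) = id_2fctr (Cat_over V)"
proof (rule fctr2_eq_on[OF push_lax_extensional(1) _ push_lax_extensional(2) _ push_lax_extensional(3)])
  show "F1 (dat (push_lax (Cell V V (lax_id V)))) F = F1 (id_2fctr (Cat_over V)) F"
    if F: "F \<in> Arr (C1 (Cat_over V))" for F
  proof -
    from F obtain A B e where e: "F = Cell A B e" "is_efun V A B e" by (rule Cat_over_cellE)
    then show ?thesis
      using is_efunD(1,2)[OF e(2)]
      by (simp add: push_lax_simps Cat_over_cells id_2fctr_def push_cell_simps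
          push_ecat_lax_id push_efun_data_lax_id)
  qed
  show "F2 (dat (push_lax (Cell V V (lax_id V)))) a = F2 (id_2fctr (Cat_over V)) a"
    if a: "a \<in> Arr (C2 (Cat_over V))" for a
  proof -
    from a obtain A B e e' s where s: "a = Cell (Cell A B e) (Cell A B e') s" "is_enat V A B e e' s"
      by (rule Cat_over_cellE)
    then show ?thesis
      using is_enatD(1,2)[OF s(2)] is_efunD(1,2)[OF is_enatD(1)[OF s(2)]]
      by (simp add: push_lax_simps Cat_over_cells id_2fctr_def push_cell_simps
          push_ecat_lax_id push_efun_data_lax_id)
  qed
qed (simp_all add: push_lax_simps id_2fctr_def Cat_over_cells push_ecat_lax_id)

lemma push_lax_lax_comp:
  assumes f: "is_lax U V f" and g: "is_lax V W g"
  shows "dat (push_lax (Cell U W (lax_comp U W g f))) =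
    comp_2fctr (Cat_over U) (dat (push_lax (Cell V W g))) (dat (push_lax (Cell U V f)))"
proof (rule fctr2_eq_on[OF push_lax_extensional(1) _ push_lax_extensional(2) _ push_lax_extensional(3)])
  let ?gf = "dat (push_lax (Cell U W (lax_comp U W g f)))"
    and ?c = "comp_2fctr (Cat_over U) (dat (push_lax (Cell V W g))) (dat (push_lax (Cell U V f)))"
  note [simp] = push_lax_simps Cat_over_cells comp_2fctr_def compose_def push_cell_simps
    push_ecat_lax_comp[OF f g] push_efun_data_lax_comp[OF f g] is_ecat_push_ecat[OF f]
    is_efun_push_efun[OF f] is_enat_push_enat[OF f]
  show "F0 ?gf C = F0 ?c C" if "C \<in> Obj (C1 (Cat_over U))" for C
    using that by simp
  show "F1 ?gf F = F1 ?c F" if F: "F \<in> Arr (C1 (Cat_over U))" for F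
  proof -
    from F obtain A B e where e: "F = Cell A B e" "is_efun U A B e" by (rule Cat_over_cellE)
    then show ?thesis using is_efunD(1,2)[OF e(2)] by simp
  qed
  show "F2 ?gf a = F2 ?c a" if a: "a \<in> Arr (C2 (Cat_over U))" for a
  proof -
    from a obtain A B e e' s where s: "a = Cell (Cell A B e) (Cell A B e') s" "is_enat U A B e e' s"
      by (rule Cat_over_cellE)
    then show ?thesis
      using is_enatD(1,2)[OF s(2)] is_efunD(1,2)[OF is_enatD(1)[OF s(2)]] by simp
  qed
qed (simp_all add: comp_2fctr_def)

lemma nt_eq_on:
  assumes "s \<in> extensional (Obj (C1 (Cat_over U)))" "t \<in> extensional (Obj (C1 (Cat_over U)))"
    and "\<And>C. is_ecat U C \<Longrightarrow> s C = t C"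
  shows "s = t"
  using assms by (intro extensionalityI) (auto simp: Cat_over_cells)

section \<open>Preservation of identity 2-cells and of both compositions of 2-cells\<close>

lemma push_nat_nt_id:
  assumes f: "is_lax U V f"
  shows "dat (push_nat (Cell (Cell U V f) (Cell U V f) (nt_id (ucat U) (ucat V) (lfun f)))) =
    nt_id (C1 (Cat_over U)) (C1 (Cat_over V)) (F01 (dat (push_lax (Cell U V f))))"
proof (rule nt_eq_on)
  fix C assume C: "is_ecat U C"
  note P = is_ecat_push_ecat[OF f C]
  have "component_data (nt_id (ucat U) (ucat V) (lfun f)) C = efun_id V (push_ecat (Cell U V f) C)"
    by (rule efun_eqI[OF is_efun_component[OF is_monoidal_nat_nt_id[OF f] C] is_efun_id[OF P]])
      (simp_all add: ehomD[OF C])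
  then show "dat (push_nat (Cell (Cell U V f) (Cell U V f) (nt_id (ucat U) (ucat V) (lfun f)))) C =
    nt_id (C1 (Cat_over U)) (C1 (Cat_over V)) (F01 (dat (push_lax (Cell U V f)))) C"
    using C P by (simp add: push_nat_simps Cat_over_cells F01_def push_lax_simps)
      (simp add: Cat_over_eq)
qed (simp_all add: push_nat_simps)

lemma push_nat_vcomp:
  assumes t: "is_monoidal_nat U V f g t" and s: "is_monoidal_nat U V g h s"
  shows "dat (push_nat (Cell (Cell U V f) (Cell U V h) (nt_vcomp (ucat U) (ucat V) s t))) =
    nt_vcomp (C1 (Cat_over U)) (C1 (Cat_over V)) (dat (push_nat (Cell (Cell U V g) (Cell U V h) s)))
      (dat (push_nat (Cell (Cell U V f) (Cell U V g) t)))"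
proof (rule nt_eq_on)
  fix C assume C: "is_ecat U C"
  note tD = is_monoidal_natD[OF t] and sD = is_monoidal_natD[OF s]
  note cs = is_efun_component[OF s C] and ct = is_efun_component[OF t C]
  \<comment> \<open>Over a composite of identity functors, both sides have the structure map
    \<open>s\<close> after \<open>t\<close> at each hom object.\<close>
  have "component_data (nt_vcomp (ucat U) (ucat V) s t) C =
      efun_comp V (push_ecat (Cell U V f) C) (component_data s C) (component_data t C)"
    by (rule efun_eqI[OF is_efun_component[OF is_monoidal_nat_vcomp[OF t s] C] is_efun_comp[OF ct cs]])
      (simp_all add: ehomD[OF C] fcomp_id_left[OF is_functor_id] is_ecatD[OF C])
  then show "dat (push_nat (Cell (Cell U V f) (Cell U V h) (nt_vcomp (ucat U) (ucat V) s t))) C =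
    nt_vcomp (C1 (Cat_over U)) (C1 (Cat_over V)) (dat (push_nat (Cell (Cell U V g) (Cell U V h) s)))
      (dat (push_nat (Cell (Cell U V f) (Cell U V g) t))) C"
    using C cs ct by (simp add: push_nat_simps Cat_over_cells) (simp add: Cat_over_eq)
qed (simp_all add: push_nat_simps)

text \<open>At \<open>C\<close> the right side is the component of \<open>s\<close> at the
  pushforward of \<open>C\<close> along \<open>f'\<close>, after the image under \<open>g\<close> of
  the component of \<open>t\<close>. Its structure map at a hom object \<open>h\<close> is
  \<open>s\<close> at the image of \<open>h\<close> under \<open>f'\<close>, after
  \<open>lfun g\<close> applied to \<open>t h\<close>, and this is \<open>nt_hcomp\<close> at
  \<open>h\<close> because both levels whisker in the same order.\<close>

lemma push_nat_hcomp:
  assumes t: "is_monoidal_nat U V f f' t" and s: "is_monoidal_nat V W g g' s"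
  shows "dat (push_nat (Cell (Cell U W (lax_comp U W g f)) (Cell U W (lax_comp U W g' f'))
      (nt_hcomp (ucat U) (ucat W) (lfun g) s (lfun f') t))) =
    nt_hcomp (C1 (Cat_over U)) (C1 (Cat_over W)) (F01 (dat (push_lax (Cell V W g))))
      (dat (push_nat (Cell (Cell V W g) (Cell V W g') s)))
      (F01 (dat (push_lax (Cell U V f')))) (dat (push_nat (Cell (Cell U V f) (Cell U V f') t)))"
proof (rule nt_eq_on)
  fix C assume C: "is_ecat U C"
  note tD = is_monoidal_natD[OF t] and sD = is_monoidal_natD[OF s]
  let ?st = "nt_hcomp (ucat U) (ucat W) (lfun g) s (lfun f') t"
    and ?pf = "push_ecat (Cell U V f) C" and ?pf' = "push_ecat (Cell U V f') C"
  note P = is_ecat_push_ecat[OF tD(1) C] and P' = is_ecat_push_ecat[OF tD(2) C]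
  note cs = is_efun_component[OF s P'] and ct = is_efun_component[OF t C]
  note gt = is_efun_push_efun[OF sD(1) ct]
  \<comment> \<open>Equal data do not suffice: the cells must also share endpoints, which are
    pushforwards along composites on one side and iterated pushforwards on the other.\<close>
  note comp = push_ecat_lax_comp[OF tD(1) sD(1) C] push_ecat_lax_comp[OF tD(2) sD(2) C]
  have "component_data ?st C =
      efun_comp W (push_ecat (Cell V W g) ?pf) (component_data s ?pf') (push_efun_data g ?pf (component_data t C))"
    by (rule efun_eqI[OF is_efun_component[OF is_monoidal_nat_hcomp[OF t s] C] is_efun_comp[OF gt cs]])
      (simp_all add: ehomD[OF C] fcomp_id_left[OF is_functor_id] is_ecatD[OF C])
  then show "dat (push_nat (Cell (Cell U W (lax_comp U W g f)) (Cell U W (lax_comp U W g' f')) ?st)) C =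
    nt_hcomp (C1 (Cat_over U)) (C1 (Cat_over W)) (F01 (dat (push_lax (Cell V W g))))
      (dat (push_nat (Cell (Cell V W g) (Cell V W g') s)))
      (F01 (dat (push_lax (Cell U V f')))) (dat (push_nat (Cell (Cell U V f) (Cell U V f') t))) C"
    using C P' cs ct gt
    by (simp add: push_nat_simps Cat_over_cells F01_def push_lax_simps push_cell_simps comp)
      (simp add: Cat_over_eq)
qed (simp_all add: push_nat_simps)

lemma concrete_2functor_enrichment:
  "concrete_2functor {V. is_oplax V} is_lax lax_id (\<lambda>U W g f. lax_comp U W g f) is_monoidal_nat ucat lfun
    {S. two_category S} is_2functor id_2fctr (\<lambda>S U G F. comp_2fctr S G F) is_2nat C1 F01
    Cat_over (\<lambda>U V l. dat (push_lax (Cell U V l)))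
    (\<lambda>U V f g t. dat (push_nat (Cell (Cell U V f) (Cell U V g) t)))"
proof (intro concrete_2functor.intro concrete_2functor_axioms.intro concrete_2cat_Oplax_lax
    concrete_2cat_Two_Cat; (elim CollectE)?)
  show "Cat_over V \<in> {S. two_category S}" for V
    using Cat_over.two_category_cells by (simp add: Cat_over_eq)
qed (fact is_2functor_push_lax push_lax_lax_id push_lax_lax_comp is_2nat_push_nat push_nat_nt_id
    push_nat_vcomp push_nat_hcomp)+

theorem mainTheorem4:
  "is_2functor
     (Oplax_lax :: (('o, 'a) oplax, ('o, 'a) lax_fun, ('o, 'a) mon_nat) cat2)
     (Two_Cat :: (('c, 'm, 'o, 'a) enr_cat2,
        (('c, 'm, 'o, 'a) ecat, ('c, 'm, 'o, 'a) enr_fun, ('c, 'm, 'o, 'a) enr_nat) fun2,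
        (('c, 'm, 'o, 'a) ecat, ('c, 'm, 'o, 'a) enr_fun, ('c, 'm, 'o, 'a) enr_nat) nat2) cat2)
     enrichment"
  unfolding Oplax_lax_eq Two_Cat_eq
  by (rule concrete_2functor.is_2functor_cells[OF concrete_2functor_enrichment])
    (simp_all add: enrichment_def Oplax_lax_eq push_lax_cell[symmetric] push_nat_cell[symmetric])

end
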